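(* Let $k$ be an algebraically closed field of characteristic zero, and consider nets of conics, i.e. $3$-dimensional subspaces $V\subset R_2$, under the action of $PGL(3)$. With the notation of the context: (i) If the discriminant cubic $\Gamma(V)$ of a net $V$ is a smooth cubic curve, then $V=J_\phi$ for a smooth plane cubic $\phi$; and the isomorphism class (i.e. the $PGL(3)$-orbit) of such a net $V=J_\phi$ is determined by the $j$-invariant of $\phi$. (ii) For every smooth cubic $\phi$ not isomorphic to $X^3+Y^3+Z^3=0$ there is an elementary specialization from the orbit of $J_\phi$ to the orbit of the net $\#7b=\langle X^2+YZ,\,XY,\,Z^2\rangle$, whose discriminant cubic is cuspidal. That is, $\#7b$ lies in the closure of the single orbit $PGL(3)\cdot J_\phi$ (so with $j$ held constant), and there is no orbit strictly in between. (iii) For every smooth cubic $\phi$ not isomorphic to $X^3+Y^3+Z^3=0$, each of the orbits $\#6b,\#6c,\#5a,\#5b,\#4,\#2a,\#2b$ (specializations of $\#7b$) is contained in the closure of the single orbit $PGL(3)\cdot J_\phi$. (iv) For the two orbits $\#8a,\#8c$, whose discriminant cubic is an irreducible cubic having a node with two distinct tangents, the orbits different from itself contained in the closure of $\#8a$ are exactly $\#7a,\#7b,\#6a,\#6b,\#6c,\#5a,\#5b,\#4,\#2a,\#2b$, and the orbits different from itself contained in the closure of $\#8c$ are exactly $\#7b,\#7c,\#6b,\#6c,\#6d,\#5a,\#5b,\#4,\#2a,\#2b$.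
   Context: $R_i$ is the space of degree-$i$ forms in $X,Y,Z$ over $k$. $PGL(3)$ acts by linear substitution on the Grassmannian $\mathrm{Grass}(3,R_2)$ of $3$-dimensional subspaces of $R_2$; closures are Zariski closures in $\mathrm{Grass}(3,R_2)$. Two nets are isomorphic if they are in the same orbit. For $V\in\mathrm{Grass}(3,R_2)$, $\Gamma(V)=\mathbb P(V)\cap S_4$ (scheme-theoretic intersection), where $S_4\subset\mathbb P(R_2)=\mathbb P^5$ is the cubic hypersurface of singular conics (vanishing determinant of the symmetric matrix of the quadratic form). If $\mathbb P(V)\not\subset S_4$, then $\Gamma(V)$ is a plane cubic curve in $\mathbb P(V)$. For a cubic form $\phi\in R_3$, $J_\phi=\langle\partial\phi/\partial X,\partial\phi/\partial Y,\partial\phi/\partial Z\rangle\subset R_2$. An orbit $B$ is a specialization of an orbit $A$ if $B\subset\overline{A}$. The specialization is elementary if $A\ne B$ and every orbit $C$ with $B\subset\overline{C}$ and $C\subset\overline{A}$ is equal to $A$ or $B$. The named orbits are the $PGL(3)$-orbits of the following nets: $\#8a=\langle XY,X^2+YZ,Y^2+XZ\rangle$; $\#8c=\langle Z^2,X^2-YZ,Y^2-XZ\rangle$; $\#7a=\langle X^2+YZ,XY,XZ\rangle$; $\#7b=\langle X^2+YZ,XY,Z^2\rangle$; $\#7c=\langle X^2+YZ,Y^2,Z^2\rangle$; $\#6a=\langle XY,YZ,XZ\rangle$; $\#6b=\langle X^2,(Y+Z)Z,XY\rangle$; $\#6c=\langle XZ,X^2+Z^2,YZ\rangle$; $\#6d=\langle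 X^2,Y^2,Z^2\rangle$; $\#5a=\langle XY,XZ,Z^2\rangle$; $\#5b=\langle Y^2,Z^2,XY\rangle$; $\#4=\langle X^2+YZ,XY,Y^2\rangle$; $\#2a=\langle X^2,XY,XZ\rangle$; $\#2b=\langle X^2,Y^2,(X+Y)^2\rangle$. *)

theory Defs
  imports "HOL-Analysis.Analysis" "HOL-Library.Poly_Mapping"
begin

section \<open>Polynomials in several variables\<close>

text \<open>
  Polynomials with coefficients in \<open>'a\<close> and variables indexed by \<open>'v\<close> are finitely supported
  functions from exponent vectors to coefficients; the ring structure is the convolution product
  of \<^theory>\<open>HOL-Library.Poly_Mapping\<close>.
\<close>

type_synonym ('v, 'a) mpoly = "('v \<Rightarrow>\<^sub>0 nat) \<Rightarrow>\<^sub>0 'a"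

definition Const :: "'a \<Rightarrow> ('v, 'a::zero) mpoly" where
  "Const c = Poly_Mapping.single 0 c"

definition Var :: "'v \<Rightarrow> ('v, 'a::zero_neq_one) mpoly" where
  "Var i = Poly_Mapping.single (Poly_Mapping.single i 1) 1"

definition mp_eval :: "('v \<Rightarrow> 'a) \<Rightarrow> ('v, 'a::comm_semiring_1) mpoly \<Rightarrow> 'a" where
  "mp_eval x p = (\<Sum>m\<in>Poly_Mapping.keys p. Poly_Mapping.lookup p m *
     (\<Prod>i\<in>Poly_Mapping.keys m. x i ^ Poly_Mapping.lookup m i))"

definition mp_subst ::
    "('v \<Rightarrow> ('w, 'a) mpoly) \<Rightarrow> ('v, 'a::comm_semiring_1) mpoly \<Rightarrow> ('w, 'a) mpoly" where
  "mp_subst s p = (\<Sum>m\<in>Poly_Mapping.keys p. Const (Poly_Mapping.lookup p m) *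
     (\<Prod>i\<in>Poly_Mapping.keys m. s i ^ Poly_Mapping.lookup m i))"

definition mp_diff :: "'v \<Rightarrow> ('v, 'a::comm_semiring_1) mpoly \<Rightarrow> ('v, 'a) mpoly" where
  "mp_diff i p = (\<Sum>m\<in>Poly_Mapping.keys p.
     Poly_Mapping.single (m - Poly_Mapping.single i 1)
       (of_nat (Poly_Mapping.lookup m i) * Poly_Mapping.lookup p m))"

definition homogeneous :: "nat \<Rightarrow> ('v, 'a::zero) mpoly set" where
  "homogeneous d = {p. \<forall>m\<in>Poly_Mapping.keys p.
     (\<Sum>i\<in>Poly_Mapping.keys m. Poly_Mapping.lookup m i) = d}"

text \<open>Polynomials over a field as a vector space, providing \<open>mp.span\<close>, \<open>mp.dim\<close> etc.\<close>

global_interpretation mp: vector_space "\<lambda>(c::'a::field) (p::('v, 'a) mpoly). Const c * p"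
  by unfold_locales
    (simp_all add: Const_def algebra_simps single_add mult_single flip: mult.assoc)


section \<open>Forms in three variables and the action of \<open>PGL(3)\<close>\<close>

text \<open>The three elements of the index type \<open>3\<close> are \<open>1\<close>, \<open>2\<close> and \<open>3 = 0\<close>.\<close>

type_synonym 'a form = "(3, 'a) mpoly"

abbreviation R :: "nat \<Rightarrow> 'a::zero form set" where "R d \<equiv> homogeneous d"

abbreviation X :: "'a::zero_neq_one form" where "X \<equiv> Var 1"
abbreviation Y :: "'a::zero_neq_one form" where "Y \<equiv> Var 2"
abbreviation Z :: "'a::zero_neq_one form" where "Z \<equiv> Var 3"

definition lin_subst :: "'a^3^3 \<Rightarrow> 'a::comm_semiring_1 form \<Rightarrow> 'a form" where
  "lin_subst A = mp_subst (\<lambda>i. \<Sum>j\<in>UNIV. Const (A $ i $ j) * Var j)"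

definition form_iso :: "'a::field form \<Rightarrow> 'a form \<Rightarrow> bool" where
  "form_iso \<phi> \<psi> \<longleftrightarrow> (\<exists>A c. invertible A \<and> c \<noteq> 0 \<and> lin_subst A \<phi> = Const c * \<psi>)"

definition nets :: "'a::field form set set" where
  "nets = {V. V \<subseteq> R 2 \<and> mp.subspace V \<and> mp.dim V = 3}"

text \<open>Scalar matrices map every subspace of \<open>R 2\<close> onto itself, so the orbits of \<open>PGL(3)\<close> are those
  of the group of invertible matrices.\<close>

definition orbit :: "'a::field form set \<Rightarrow> 'a form set set" where
  "orbit V = {lin_subst A ` V | A. invertible A}"

definition orbits :: "'a::field form set set set" where
  "orbits = orbit ` nets"

definition is_basis :: "(3 \<Rightarrow> 'a::field form) \<Rightarrow> 'a form set \<Rightarrow> bool" where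
  "is_basis b V \<longleftrightarrow> inj b \<and> mp.independent (range b) \<and> mp.span (range b) = V"


section \<open>Zariski topology on the Grassmannian\<close>

text \<open>
  The Pluecker coordinates of a net with respect to the monomial basis of \<open>R 2\<close>: the minors of
  the coefficient matrix of a basis, indexed by all triples of monomials. (Triples containing a
  repeated monomial, or one not of degree 2, contribute coordinates that are 0.) A change of
  basis multiplies all coordinates by a common nonzero scalar, so the vanishing of a
  homogeneous polynomial in them does not depend on the basis.
\<close>

definition pluecker :: "(3 \<Rightarrow> 'a::field form) \<Rightarrow> (3 \<Rightarrow> (3 \<Rightarrow>\<^sub>0 nat)) \<Rightarrow> 'a" where
  "pluecker b \<mu> = det (\<chi> i j. Poly_Mapping.lookup (b i) (\<mu> j))"

definition principal_open ::
    "(3 \<Rightarrow> (3 \<Rightarrow>\<^sub>0 nat), 'a::field) mpoly \<Rightarrow> 'a form set set" where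
  "principal_open F = {V \<in> nets. \<exists>b. is_basis b V \<and> mp_eval (pluecker b) F \<noteq> 0}"

definition zariski :: "'a::field form set topology" where
  "zariski = topology_generated_by {principal_open F | F d. F \<in> homogeneous d}"

lemma is_basis_exists:
  assumes "V \<in> nets"
  shows "\<exists>b. is_basis b V"
proof -
  from assms have V: "mp.subspace V" "mp.dim V = 3" by (auto simp: nets_def)
  obtain B where B: "B \<subseteq> V" "mp.independent B" "V \<subseteq> mp.span B" "card B = mp.dim V"
    using mp.basis_exists by blast
  have "finite B" using B(4) V(2) by (auto intro: card_ge_0_finite)
  then obtain b :: "3 \<Rightarrow> 'a form" where b: "bij_betw b UNIV B"
    using finite_same_card_bij[of "UNIV :: 3 set" B] B(4) V(2) by auto
  have "mp.span B = V" using mp.span_minimal[OF B(1) V(1)] B(3) by auto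
  with b B(2) show ?thesis unfolding is_basis_def bij_betw_def by metis
qed

lemma topspace_zariski: "topspace (zariski :: 'a::field form set topology) = nets"
proof -
  have "mp_eval x (1 :: (3 \<Rightarrow> (3 \<Rightarrow>\<^sub>0 nat), 'a) mpoly) = 1" for x
    by (simp add: mp_eval_def)
  hence "principal_open (1 :: (3 \<Rightarrow> (3 \<Rightarrow>\<^sub>0 nat), 'a) mpoly) = nets"
    using is_basis_exists by (auto simp: principal_open_def)
  moreover have "(1 :: (3 \<Rightarrow> (3 \<Rightarrow>\<^sub>0 nat), 'a) mpoly) \<in> homogeneous 0"
    by (simp add: homogeneous_def)
  ultimately have "nets \<subseteq> \<Union> {principal_open F | F d. F \<in> (homogeneous d :: (3 \<Rightarrow> (3 \<Rightarrow>\<^sub>0 nat), 'a) mpoly set)}"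
    by blast
  moreover have "\<dots> \<subseteq> nets" by (auto simp: principal_open_def)
  ultimately show ?thesis by (simp add: zariski_def topology_generated_by_topspace subset_antisym)
qed

definition specialization :: "'a::field form set set \<Rightarrow> 'a form set set \<Rightarrow> bool" where
  "specialization A B \<longleftrightarrow> B \<subseteq> zariski closure_of A"

definition elementary_specialization ::
    "'a::field form set set \<Rightarrow> 'a form set set \<Rightarrow> bool" where
  "elementary_specialization A B \<longleftrightarrow> A \<in> orbits \<and> B \<in> orbits \<and> specialization A B \<and> A \<noteq> B \<and>
     (\<forall>C\<in>orbits. specialization C B \<and> specialization A C \<longrightarrow> C = A \<or> C = B)"


section \<open>Plane cubics\<close>

definition singular_point :: "'a::field form \<Rightarrow> 'a^3 \<Rightarrow> bool" where
  "singular_point F p \<longleftrightarrow> p \<noteq> 0 \<and> mp_eval (($) p) F = 0 \<and> (\<forall>i. mp_eval (($) p) (mp_diff i F) = 0)"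

text \<open>The zero form does not count as smooth, since all points are singular points of it.\<close>

definition smooth_cubic :: "'a::field form \<Rightarrow> bool" where
  "smooth_cubic F \<longleftrightarrow> F \<in> R 3 \<and> \<not> (\<exists>p. singular_point F p)"

text \<open>
  At a singular point \<open>p\<close>, this is twice the quadratic part of the Taylor expansion of \<open>F\<close> at \<open>p\<close>.
  If it is nonzero, then \<open>p\<close> is a double point and the zero locus is the union of the tangent lines
  at \<open>p\<close>.
\<close>

definition tangent_cone :: "'a::field form \<Rightarrow> 'a^3 \<Rightarrow> 'a form" where
  "tangent_cone F p =
     (\<Sum>i\<in>UNIV. \<Sum>j\<in>UNIV. Const (mp_eval (($) p) (mp_diff i (mp_diff j F))) * Var i * Var j)"

definition node :: "'a::field form \<Rightarrow> 'a^3 \<Rightarrow> bool" where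
  "node F p \<longleftrightarrow> singular_point F p \<and>
     (\<exists>l\<in>R 1. \<exists>l'\<in>R 1. l \<noteq> l' \<and> mp.independent {l, l'} \<and> tangent_cone F p = l * l')"

definition cusp :: "'a::field form \<Rightarrow> 'a^3 \<Rightarrow> bool" where
  "cusp F p \<longleftrightarrow> singular_point F p \<and> (\<exists>l\<in>R 1. l \<noteq> 0 \<and> tangent_cone F p = l * l)"

definition nodal_cubic :: "'a::field form \<Rightarrow> bool" where
  "nodal_cubic F \<longleftrightarrow> F \<in> R 3 \<and> irreducible F \<and> (\<exists>p. node F p)"

text \<open>On an irreducible cubic, a double point with a single tangent is an ordinary cusp.\<close>

definition cuspidal_cubic :: "'a::field form \<Rightarrow> bool" where
  "cuspidal_cubic F \<longleftrightarrow> F \<in> R 3 \<and> irreducible F \<and> (\<exists>p. cusp F p)"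

definition weierstrass :: "'a::field \<Rightarrow> 'a \<Rightarrow> 'a form" where
  "weierstrass a b = Y^2 * Z - X^3 - Const a * X * Z^2 - Const b * Z^3"

text \<open>For fields of characteristic other than 2 and 3, with the normalisation \<open>j = 1728\<close> for
  \<open>y\<^sup>2 = x\<^sup>3 + x\<close>.\<close>

definition j_invariant :: "'a::field form \<Rightarrow> 'a" where
  "j_invariant \<phi> = (THE j. \<exists>a b. 4 * a^3 + 27 * b^2 \<noteq> 0 \<and> form_iso \<phi> (weierstrass a b) \<and>
     j = 1728 * (4 * a^3) / (4 * a^3 + 27 * b^2))"

definition fermat :: "'a::field form" where
  "fermat = X^3 + Y^3 + Z^3"

definition J :: "'a::field form \<Rightarrow> 'a form set" where
  "J \<phi> = mp.span {mp_diff 1 \<phi>, mp_diff 2 \<phi>, mp_diff 3 \<phi>}"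


section \<open>The discriminant cubic of a net\<close>

definition conic_matrix :: "'a::field form \<Rightarrow> 'a^3^3" where
  "conic_matrix q = (\<chi> i j. Poly_Mapping.lookup q (Poly_Mapping.single i 1 + Poly_Mapping.single j 1)
     / (if i = j then 1 else 2))"

text \<open>
  The determinant of the generic member of the net with basis \<open>b\<close>: the equation of the discriminant
  cubic in the projective plane of the net, in the coordinates given by \<open>b\<close>. It is zero iff all
  conics in the net are singular.
\<close>

definition discriminant_form :: "(3 \<Rightarrow> 'a::field form) \<Rightarrow> 'a form" where
  "discriminant_form b = det (\<chi> i j. \<Sum>l\<in>UNIV. Const (conic_matrix (b l) $ i $ j) * Var l)"

text \<open>
  The discriminant cubic of \<open>V\<close> has the property \<open>P\<close>. A change of basis transforms the discriminant
  form by a linear substitution, so for projectively invariant \<open>P\<close> all bases give the same answer.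
\<close>

definition discriminant_cubic :: "('a::field form \<Rightarrow> bool) \<Rightarrow> 'a form set \<Rightarrow> bool" where
  "discriminant_cubic P V \<longleftrightarrow> (\<exists>b. is_basis b V \<and> P (discriminant_form b))"


section \<open>The named nets\<close>

definition net_8a :: "'a::field form set" where "net_8a = mp.span {X * Y, X^2 + Y * Z, Y^2 + X * Z}"
definition net_8c :: "'a::field form set" where "net_8c = mp.span {Z^2, X^2 - Y * Z, Y^2 - X * Z}"
definition net_7a :: "'a::field form set" where "net_7a = mp.span {X^2 + Y * Z, X * Y, X * Z}"
definition net_7b :: "'a::field form set" where "net_7b = mp.span {X^2 + Y * Z, X * Y, Z^2}"
definition net_7c :: "'a::field form set" where "net_7c = mp.span {X^2 + Y * Z, Y^2, Z^2}"
definition net_6a :: "'a::field form set" where "net_6a = mp.span {X * Y, Y * Z, X * Z}"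
definition net_6b :: "'a::field form set" where "net_6b = mp.span {X^2, (Y + Z) * Z, X * Y}"
definition net_6c :: "'a::field form set" where "net_6c = mp.span {X * Z, X^2 + Z^2, Y * Z}"
definition net_6d :: "'a::field form set" where "net_6d = mp.span {X^2, Y^2, Z^2}"
definition net_5a :: "'a::field form set" where "net_5a = mp.span {X * Y, X * Z, Z^2}"
definition net_5b :: "'a::field form set" where "net_5b = mp.span {Y^2, Z^2, X * Y}"
definition net_4  :: "'a::field form set" where "net_4  = mp.span {X^2 + Y * Z, X * Y, Y^2}"
definition net_2a :: "'a::field form set" where "net_2a = mp.span {X^2, X * Y, X * Z}"
definition net_2b :: "'a::field form set" where "net_2b = mp.span {X^2, Y^2, (X + Y)^2}"

end

theory Submission
  imports Defs
begin

text \<open>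
  Three members of a net \<open>V\<close> are the partial derivatives of a cubic iff their 9 coefficients
  satisfy 8 linear equations, so \<open>V\<close> contains the partial derivatives of some cubic \<open>\<phi> \<noteq> 0\<close>. If
  they are dependent, \<open>V\<close> contains the square of a linear form. If they are independent, then
  \<open>V = J \<phi>\<close>, and every singular point of \<open>\<phi>\<close> is a base point of \<open>V\<close>. In the two degenerate cases
  the discriminant cubic is singular, and normal forms show that \<open>V\<close> is in one of the named orbits.
  If \<open>\<phi>\<close> is smooth, then it meets its Hessian in a flex, whence a Weierstrass form.

  The orbits are separated by invariants of the Pluecker coordinates. The space
  \<open>\<Lambda>\<^sup>3(Sym\<^sup>2) = Sym\<^sup>3 \<oplus> Sym\<^sup>3*\<close> has the quartic invariants \<open>S(F)\<close> (Aronhold) and \<open>\<langle>F, G\<rangle>\<^sup>2\<close>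
  (apolar pairing). For \<open>y\<^sup>2 = x\<^sup>3 + a x + b\<close> they are combinations of \<open>a\<^sup>3\<close> and \<open>b\<^sup>2\<close>, so their
  ratio determines \<open>j\<close> and is constant on the closure of the orbit wherever it is defined. Both
  vanish on \<open>#7b\<close> and the orbits below it; of these, only \<open>#7b\<close> has a Jacobian cubic \<open>F\<close> which is
  not a cone. The specializations themselves are explicit lines in the space of triples of conics.
\<close>

section \<open>Evaluation, substitution and differentiation\<close>

text \<open>The two invariants enter through the pencil \<open>kinv c\<close> = \<open>inv4\<close>
  + c * \<open>inv2\<close>^2. On the net of y^2 = x^3 + a x + b the member c = 1 is proportional to
  4 a^3 + 27 b^2 and the member c = 4 to a^3. The first vanishes on #8a, #7a and #6a, which thus sit
  at j = infinity, the second on #8c, #7c and #6d, which sit at j = 0; on #7b and below the whole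
  pencil vanishes. An orbit in the closure of a non-null one has the same j in this sense or is
  null. The Fermat cubic is exceptional because its net is #6d itself, which is fixed by all
  diagonal matrices and lies in the closure of #8c. Intermediate orbits are excluded without
  counting dimensions: every net belongs to a known orbit, and each candidate is rejected by the
  pencil or, among the null orbits, by the cone condition. Invariance is not deduced from
  representation theory; it is a polynomial identity checked for generators of GL(3), which is why
  the generating set is kept small.\<close>

abbreviation expo :: "('v \<Rightarrow>\<^sub>0 nat) \<Rightarrow> 'v \<Rightarrow> nat" where "expo \<equiv> Poly_Mapping.lookup"
abbreviation cf :: "('v, 'a::zero) mpoly \<Rightarrow> ('v \<Rightarrow>\<^sub>0 nat) \<Rightarrow> 'a" where "cf \<equiv> Poly_Mapping.lookup"

definition mon_val :: "('v \<Rightarrow> 'b) \<Rightarrow> ('v \<Rightarrow>\<^sub>0 nat) \<Rightarrow> 'b::comm_semiring_1" where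
  "mon_val x m = (\<Prod>i\<in>Poly_Mapping.keys m. x i ^ expo m i)"

lemma mon_val_superset:
  assumes "finite I" "Poly_Mapping.keys m \<subseteq> I"
  shows "mon_val x m = (\<Prod>i\<in>I. x i ^ expo m i)"
  unfolding mon_val_def
  by (rule prod.mono_neutral_left) (use assms in \<open>auto simp: in_keys_iff\<close>)

lemma mon_val_add: "mon_val x (m + n) = mon_val x m * mon_val x n"
proof -
  let ?I = "Poly_Mapping.keys m \<union> Poly_Mapping.keys n"
  have "Poly_Mapping.keys (m + n) \<subseteq> ?I" by (rule keys_add)
  then show ?thesis
    by (simp add: mon_val_superset[of ?I] lookup_add power_add prod.distrib)
qed

lemma mon_val_0 [simp]: "mon_val x 0 = 1"
  by (simp add: mon_val_def)

lemma mon_val_single [simp]: "mon_val x (Poly_Mapping.single i k) = x i ^ k"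
  by (simp add: mon_val_def)

text \<open>Evaluation is the case where \<open>h\<close> is the identity, substitution the case
  \<open>h = Const\<close>; the decomposition by degree in \<open>grading\<close> is a third
  instance, so multiplicativity is proved once.\<close>

definition mp_hom :: "('a::comm_semiring_1 \<Rightarrow> 'b::comm_semiring_1) \<Rightarrow> ('v \<Rightarrow> 'b) \<Rightarrow> ('v, 'a) mpoly \<Rightarrow> 'b" where
  "mp_hom h x p = (\<Sum>m\<in>Poly_Mapping.keys p. h (cf p m) * mon_val x m)"

definition coeff_hom :: "('a::comm_semiring_1 \<Rightarrow> 'b::comm_semiring_1) \<Rightarrow> bool" where
  "coeff_hom h \<longleftrightarrow> h 0 = 0 \<and> h 1 = 1 \<and> (\<forall>a b. h (a + b) = h a + h b \<and> h (a * b) = h a * h b)"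

lemma mpoly_single_induct [case_names single add]:
  fixes p :: "('v, 'a::comm_semiring_1) mpoly"
  assumes "\<And>m c. P (Poly_Mapping.single m c)" "\<And>p q. P p \<Longrightarrow> P q \<Longrightarrow> P (p + q)"
  shows "P p"
proof -
  have dec: "p = (\<Sum>m\<in>Poly_Mapping.keys p. Poly_Mapping.single m (cf p m))"
    by (rule poly_mapping_eqI) (auto simp: lookup_sum lookup_single when_def in_keys_iff)
  have "P (\<Sum>m\<in>K. Poly_Mapping.single m (cf p m))" if "finite K" for K
    using that
  proof (induction K)
    case empty
    show ?case using assms(1)[of 0 0] by simp
  next
    case (insert m K)
    then show ?case using assms by simp
  qed
  then show ?thesis using dec finite_keys by metis
qed

lemma mp_hom_superset:
  assumes "coeff_hom h" "finite K" "Poly_Mapping.keys p \<subseteq> K"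
  shows "mp_hom h x p = (\<Sum>m\<in>K. h (cf p m) * mon_val x m)"
  unfolding mp_hom_def
  by (rule sum.mono_neutral_left) (use assms in \<open>auto simp: in_keys_iff coeff_hom_def\<close>)

lemma mp_hom_add:
  assumes "coeff_hom h"
  shows "mp_hom h x (p + q) = mp_hom h x p + mp_hom h x q"
proof -
  let ?K = "Poly_Mapping.keys p \<union> Poly_Mapping.keys q"
  have K: "Poly_Mapping.keys (p + q) \<subseteq> ?K" by (rule keys_add)
  show ?thesis
    using assms
    by (simp add: mp_hom_superset[OF assms, of ?K] K lookup_add coeff_hom_def distrib_right sum.distrib)
qed

lemma mp_hom_single:
  assumes "coeff_hom h"
  shows "mp_hom h x (Poly_Mapping.single m c) = h c * mon_val x m"
  using assms by (simp add: mp_hom_def coeff_hom_def)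

lemma mp_hom_mult:
  assumes h: "coeff_hom h"
  shows "mp_hom h x (p * q) = mp_hom h x p * mp_hom h x q"
proof (induction p rule: mpoly_single_induct)
  case (add p p')
  then show ?case by (simp add: distrib_right mp_hom_add[OF h])
next
  case (single m c)
  show ?case
  proof (induction q rule: mpoly_single_induct)
    case (add q q')
    then show ?case by (simp add: distrib_left mp_hom_add[OF h])
  next
    case (single n d)
    show ?case
      using h by (simp add: mult_single mp_hom_single[OF h] mon_val_add coeff_hom_def mult_ac)
  qed
qed

lemma Const_0 [simp]: "Const 0 = 0" by (simp add: Const_def)
lemma Const_1 [simp]: "Const 1 = 1" by (simp add: Const_def)
lemma Const_add: "Const (a + b) = Const a + Const b" by (simp add: Const_def single_add)
lemma Const_mult: "Const (a * b) = Const a * (Const b :: ('v, 'a::comm_semiring_1) mpoly)"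
  by (simp add: Const_def mult_single)
lemma Const_diff: "Const (a - b) = Const a - Const (b::'a::comm_ring_1)"
  by (simp add: Const_def single_diff)
lemma Const_uminus: "Const (- a) = - Const (a::'a::comm_ring_1)"
  by (simp add: Const_def single_uminus)
lemma Const_numeral: "Const (numeral n) = numeral n"
  by (simp add: Const_def)
lemma Const_power: "Const (a ^ n) = (Const a :: ('v, 'a::comm_semiring_1) mpoly) ^ n"
  by (induction n) (simp_all add: Const_mult)

lemmas Const_ring = Const_add Const_diff Const_uminus Const_mult Const_power Const_numeral Const_0 Const_1

lemma mp_eval_hom: "mp_eval x = mp_hom (\<lambda>c. c) x"
  by (rule ext) (simp add: mp_eval_def mp_hom_def mon_val_def)

lemma mp_subst_hom: "mp_subst s = mp_hom Const s"
  by (rule ext) (simp add: mp_subst_def mp_hom_def mon_val_def)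

lemma coeff_hom_id: "coeff_hom (\<lambda>c. c)" by (simp add: coeff_hom_def)
lemma coeff_hom_Const: "coeff_hom Const" by (simp add: coeff_hom_def Const_add Const_mult)

lemma mp_eval_simps [simp]:
  "mp_eval x (p + q) = mp_eval x p + mp_eval x q"
  "mp_eval x (p * q) = mp_eval x p * mp_eval x q"
  "mp_eval x (Const c) = c"
  "mp_eval x (Var i) = x i"
  unfolding mp_eval_hom Const_def Var_def
  by (simp_all add: mp_hom_add mp_hom_mult mp_hom_single coeff_hom_id)

lemma mp_eval_0 [simp]: "mp_eval x 0 = 0"
  using mp_eval_simps(3)[of x 0] by simp
lemma mp_eval_1 [simp]: "mp_eval x 1 = 1"
  using mp_eval_simps(3)[of x 1] by simp
lemma mp_eval_numeral [simp]: "mp_eval x (numeral n) = numeral n"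
  using mp_eval_simps(3)[of x "numeral n"] by (simp add: Const_numeral)
lemma mp_eval_power [simp]: "mp_eval x (p ^ n) = mp_eval x p ^ n"
  by (induction n) simp_all
lemma mp_eval_uminus [simp]: "mp_eval x (- p) = - mp_eval x (p :: ('v, 'a::comm_ring_1) mpoly)"
proof -
  have "- p = Const (- 1) * p" by (simp add: Const_uminus)
  then show ?thesis by simp
qed
lemma mp_eval_diff [simp]: "mp_eval x (p - q) = mp_eval x p - mp_eval x (q :: ('v, 'a::comm_ring_1) mpoly)"
  using mp_eval_simps(1)[of x p "- q"] by simp
lemma mp_eval_sum [simp]: "mp_eval x (sum f A) = (\<Sum>i\<in>A. mp_eval x (f i))"
  by (induction A rule: infinite_finite_induct) simp_all

lemma mp_subst_simps [simp]:
  "mp_subst s (p + q) = mp_subst s p + mp_subst s q"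
  "mp_subst s (p * q) = mp_subst s p * mp_subst s q"
  "mp_subst s (Const c) = Const c"
  "mp_subst s (Var i) = s i"
proof -
  show "mp_subst s (p + q) = mp_subst s p + mp_subst s q" "mp_subst s (p * q) = mp_subst s p * mp_subst s q"
    by (simp_all add: mp_subst_hom mp_hom_add mp_hom_mult coeff_hom_Const)
  show "mp_subst s (Const c) = Const c"
    unfolding mp_subst_hom Const_def[of c] mp_hom_single[OF coeff_hom_Const] by (simp add: Const_def)
  show "mp_subst s (Var i) = s i"
    unfolding mp_subst_hom Var_def mp_hom_single[OF coeff_hom_Const] by simp
qed

text \<open>Fits maps that respect sums and products: identities between them reduce to constants
  and variables.\<close>

lemma mpoly_induct [case_names Const Var add mult]:
  fixes p :: "('v, 'a::comm_semiring_1) mpoly"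
  assumes "\<And>c. P (Const c)" "\<And>i. P (Var i)" "\<And>p q. P p \<Longrightarrow> P q \<Longrightarrow> P (p + q)"
    "\<And>p q. P p \<Longrightarrow> P q \<Longrightarrow> P (p * q)"
  shows "P p"
proof (induction p rule: mpoly_single_induct)
  case (add p q)
  then show ?case by (rule assms(3))
next
  case (single m c)
  have pow: "P (Poly_Mapping.single (Poly_Mapping.single i k) 1)" for i :: 'v and k :: nat
  proof (induction k)
    case 0
    show ?case using assms(1)[of 1] by (simp add: Const_def)
  next
    case (Suc k)
    have "Poly_Mapping.single (Poly_Mapping.single i (Suc k)) 1 =
        Var i * Poly_Mapping.single (Poly_Mapping.single i k) (1::'a)"
      by (simp add: Var_def mult_single flip: single_add)
    then show ?case using assms(2,4) Suc by simp
  qed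
  have mon: "P (Poly_Mapping.single (\<Sum>i\<in>K. Poly_Mapping.single i (expo m i)) 1)" if "finite K" for K
    using that
  proof (induction K)
    case empty
    show ?case using assms(1)[of 1] by (simp add: Const_def)
  next
    case (insert i K)
    have "Poly_Mapping.single (\<Sum>i\<in>insert i K. Poly_Mapping.single i (expo m i)) 1 =
        Poly_Mapping.single (Poly_Mapping.single i (expo m i)) (1::'a) *
        Poly_Mapping.single (\<Sum>i\<in>K. Poly_Mapping.single i (expo m i)) 1"
      using insert by (simp add: mult_single)
    then show ?case using assms(4) pow insert by simp
  qed
  have "m = (\<Sum>i\<in>Poly_Mapping.keys m. Poly_Mapping.single i (expo m i))"
    by (rule poly_mapping_eqI) (auto simp: lookup_sum lookup_single when_def in_keys_iff)
  with mon have "P (Poly_Mapping.single m 1)" using finite_keys by metis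
  then have "P (Const c * Poly_Mapping.single m 1)" using assms(1,4) by blast
  then show ?case by (simp add: Const_def mult_single)
qed

lemma mp_subst_0 [simp]: "mp_subst s 0 = 0"
  using mp_subst_simps(3)[of s 0] by simp
lemma mp_subst_1 [simp]: "mp_subst s 1 = 1"
  using mp_subst_simps(3)[of s 1] by simp
lemma mp_subst_numeral [simp]: "mp_subst s (numeral n) = numeral n"
  using mp_subst_simps(3)[of s "numeral n"] by (simp add: Const_numeral)
lemma mp_subst_power [simp]: "mp_subst s (p ^ n) = mp_subst s p ^ n"
  by (induction n) simp_all
lemma mp_subst_uminus [simp]: "mp_subst s (- p) = - mp_subst s (p :: ('v, 'a::comm_ring_1) mpoly)"
proof -
  have "mp_subst s (- p) + mp_subst s p = 0" by (simp flip: mp_subst_simps(1))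
  then show ?thesis by (simp add: eq_neg_iff_add_eq_0)
qed
lemma mp_subst_diff [simp]:
  "mp_subst s (p - q) = mp_subst s p - mp_subst s (q :: ('v, 'a::comm_ring_1) mpoly)"
  using mp_subst_simps(1)[of s p "- q"] by simp
lemma mp_subst_sum [simp]: "mp_subst s (sum f A) = (\<Sum>i\<in>A. mp_subst s (f i))"
  by (induction A rule: infinite_finite_induct) simp_all

lemma mp_subst_Var: "mp_subst Var p = p"
  by (induction p rule: mpoly_induct) simp_all

lemma mp_subst_subst: "mp_subst t (mp_subst s p) = mp_subst (\<lambda>i. mp_subst t (s i)) p"
  by (induction p rule: mpoly_induct) simp_all

lemma mp_eval_subst: "mp_eval x (mp_subst s p) = mp_eval (\<lambda>i. mp_eval x (s i)) p"
  by (induction p rule: mpoly_induct) simp_all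

lemma mp_diff_superset:
  assumes "finite K" "Poly_Mapping.keys p \<subseteq> K"
  shows "mp_diff i p = (\<Sum>m\<in>K. Poly_Mapping.single (m - Poly_Mapping.single i 1) (of_nat (expo m i) * cf p m))"
  unfolding mp_diff_def
  by (rule sum.mono_neutral_left) (use assms in \<open>auto simp: in_keys_iff\<close>)

lemma mp_diff_add [simp]: "mp_diff i (p + q) = mp_diff i p + mp_diff i q"
proof -
  let ?K = "Poly_Mapping.keys p \<union> Poly_Mapping.keys q"
  have "Poly_Mapping.keys (p + q) \<subseteq> ?K" by (rule keys_add)
  then show ?thesis
    by (simp add: mp_diff_superset[of ?K] lookup_add distrib_left single_add sum.distrib)
qed

lemma mp_diff_single:
  "mp_diff i (Poly_Mapping.single m c) =
     Poly_Mapping.single (m - Poly_Mapping.single i 1) (of_nat (expo m i) * c)"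
  by (simp add: mp_diff_def)

lemma mp_diff_Const [simp]: "mp_diff i (Const c) = 0"
  by (simp add: Const_def mp_diff_single)

lemma mp_diff_Var: "mp_diff i (Var j) = (if i = j then 1 else 0)"
  by (simp add: Var_def mp_diff_single lookup_single when_def)

lemma mp_diff_mult [simp]:
  "mp_diff i (p * q) = mp_diff i p * q + p * mp_diff i (q :: ('v, 'a::comm_semiring_1) mpoly)"
proof (induction p rule: mpoly_single_induct)
  case (add p p')
  then show ?case by (simp add: algebra_simps)
next
  case (single m c)
  show ?case
  proof (induction q rule: mpoly_single_induct)
    case (add q q')
    then show ?case by (simp add: algebra_simps)
  next
    case (single n d)
    let ?e = "Poly_Mapping.single i (1::nat)"
    have "m + n - ?e = (m - ?e) + n" if "expo m i \<noteq> 0"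
      by (rule poly_mapping_eqI) (use that in \<open>auto simp: lookup_add lookup_minus lookup_single when_def\<close>)
    then have 1: "Poly_Mapping.single ((m - ?e) + n) (of_nat (expo m i) * c * d) =
        Poly_Mapping.single (m + n - ?e) (of_nat (expo m i) * c * d)"
      by (cases "expo m i = 0") simp_all
    have "m + n - ?e = m + (n - ?e)" if "expo n i \<noteq> 0"
      by (rule poly_mapping_eqI) (use that in \<open>auto simp: lookup_add lookup_minus lookup_single when_def\<close>)
    then have 2: "Poly_Mapping.single (m + (n - ?e)) (c * (of_nat (expo n i) * d)) =
        Poly_Mapping.single (m + n - ?e) (c * (of_nat (expo n i) * d))"
      by (cases "expo n i = 0") simp_all
    have "of_nat (expo (m + n) i) * (c * d) = of_nat (expo m i) * c * d + c * (of_nat (expo n i) * d)"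
      by (simp add: lookup_add algebra_simps)
    then show ?case
      unfolding mult_single mp_diff_single 1 2 single_add[symmetric] by simp
  qed
qed

lemma mp_diff_0 [simp]: "mp_diff i 0 = 0"
  using mp_diff_Const[of i 0] by simp
lemma mp_diff_uminus [simp]: "mp_diff i (- p) = - mp_diff i (p :: ('v, 'a::comm_ring_1) mpoly)"
proof -
  have "mp_diff i (- p) + mp_diff i p = 0" by (simp flip: mp_diff_add)
  then show ?thesis by (simp add: eq_neg_iff_add_eq_0)
qed
lemma mp_diff_diff [simp]:
  "mp_diff i (p - q) = mp_diff i p - mp_diff i (q :: ('v, 'a::comm_ring_1) mpoly)"
  using mp_diff_add[of i p "- q"] by simp
lemma mp_diff_sum [simp]: "mp_diff i (sum f A) = (\<Sum>j\<in>A. mp_diff i (f j))"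
  by (induction A rule: infinite_finite_induct) simp_all

text \<open>The chain rule. It makes \<open>J\<close> compatible with linear substitutions.\<close>

lemma mp_diff_subst:
  fixes p :: "('v::finite, 'a::comm_ring_1) mpoly"
  shows "mp_diff i (mp_subst s p) = (\<Sum>j\<in>UNIV. mp_diff i (s j) * mp_subst s (mp_diff j p))"
proof (induction p rule: mpoly_induct)
  case (Const c)
  show ?case by simp
next
  case (Var k)
  have "(\<Sum>j\<in>UNIV. mp_diff i (s j) * mp_subst s (mp_diff j (Var k))) =
      (\<Sum>j\<in>UNIV. if j = k then mp_diff i (s j) else 0)"
    by (rule sum.cong) (auto simp: mp_diff_Var)
  then show ?case by simp
next
  case (add p q)
  then show ?case by (simp add: distrib_left sum.distrib)
next
  case (mult p q)
  have "(\<Sum>j\<in>UNIV. mp_diff i (s j) * mp_subst s (mp_diff j (p * q))) =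
      (\<Sum>j\<in>UNIV. mp_diff i (s j) * mp_subst s (mp_diff j p) * mp_subst s q +
        mp_subst s p * (mp_diff i (s j) * mp_subst s (mp_diff j q)))"
    by (rule sum.cong) (simp_all add: algebra_simps)
  then show ?case by (simp add: mult sum.distrib sum_distrib_left sum_distrib_right)
qed

lemma lookup_Const_mult [simp]:
  "cf (Const c * p) m = c * cf (p :: ('v, 'a::comm_semiring_1) mpoly) m"
proof (induction p rule: mpoly_single_induct)
  case (add p q)
  then show ?case by (simp add: distrib_left lookup_add)
next
  case (single n d)
  show ?case by (simp add: Const_def mult_single lookup_single when_def)
qed

section \<open>Homogeneous polynomials\<close>

definition tdeg :: "('v \<Rightarrow>\<^sub>0 nat) \<Rightarrow> nat" where
  "tdeg m = (\<Sum>i\<in>Poly_Mapping.keys m. expo m i)"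

lemma tdeg_superset:
  assumes "finite I" "Poly_Mapping.keys m \<subseteq> I"
  shows "tdeg m = (\<Sum>i\<in>I. expo m i)"
  unfolding tdeg_def
  by (rule sum.mono_neutral_left) (use assms in \<open>auto simp: in_keys_iff\<close>)

lemma tdeg_add: "tdeg (m + n) = tdeg m + tdeg n"
proof -
  let ?I = "Poly_Mapping.keys m \<union> Poly_Mapping.keys n"
  have "Poly_Mapping.keys (m + n) \<subseteq> ?I" by (rule keys_add)
  then show ?thesis by (simp add: tdeg_superset[of ?I] lookup_add sum.distrib)
qed

lemma tdeg_single [simp]: "tdeg (Poly_Mapping.single i k) = k"
  by (simp add: tdeg_def)

lemma tdeg_0 [simp]: "tdeg 0 = 0" by (simp add: tdeg_def)

lemma homogeneous_iff: "p \<in> homogeneous d \<longleftrightarrow> (\<forall>m. cf p m \<noteq> 0 \<longrightarrow> tdeg m = d)"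
  by (auto simp: homogeneous_def tdeg_def in_keys_iff)

lemma homogeneous_0 [simp]: "0 \<in> homogeneous d" by (simp add: homogeneous_iff)

lemma homogeneous_add: "p \<in> homogeneous d \<Longrightarrow> q \<in> homogeneous d \<Longrightarrow> p + q \<in> homogeneous d"
  using keys_add[of p q] by (auto simp: homogeneous_def)

lemma homogeneous_mult:
  assumes "p \<in> homogeneous d" "q \<in> homogeneous e"
  shows "p * q \<in> homogeneous (d + e)"
  unfolding homogeneous_iff
proof (intro allI impI)
  fix m assume "cf (p * q) m \<noteq> 0"
  then obtain a b where "m = a + b" "a \<in> Poly_Mapping.keys p" "b \<in> Poly_Mapping.keys q"
    using keys_mult[of p q] by (auto simp flip: in_keys_iff)
  with assms show "tdeg m = d + e" by (simp add: homogeneous_iff tdeg_add in_keys_iff)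
qed

lemma homogeneous_Const [simp]: "Const c \<in> homogeneous 0"
  by (auto simp: homogeneous_iff Const_def lookup_single when_def)

lemma homogeneous_1 [simp]: "1 \<in> homogeneous 0"
  by (auto simp: homogeneous_iff lookup_one when_def)

lemma homogeneous_Var [simp]: "Var i \<in> homogeneous (Suc 0)"
  by (auto simp: homogeneous_iff Var_def lookup_single when_def)

lemma homogeneous_Const_mult: "p \<in> homogeneous d \<Longrightarrow> Const c * p \<in> homogeneous d"
  using homogeneous_mult[OF homogeneous_Const, of p d c] by simp

lemma homogeneous_sum: "(\<And>i. i \<in> A \<Longrightarrow> f i \<in> homogeneous d) \<Longrightarrow> sum f A \<in> homogeneous d"
  by (induction A rule: infinite_finite_induct) (auto intro: homogeneous_add)

lemma homogeneous_power: "p \<in> homogeneous d \<Longrightarrow> p ^ n \<in> homogeneous (n * d)"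
proof (induction n)
  case 0
  show ?case by simp
next
  case (Suc n)
  then show ?case using homogeneous_mult by simp
qed

lemma homogeneous_prod:
  "finite A \<Longrightarrow> (\<And>i. i \<in> A \<Longrightarrow> f i \<in> homogeneous (e i)) \<Longrightarrow> prod f A \<in> homogeneous (sum e A)"
proof (induction A rule: finite_induct)
  case empty
  show ?case by simp
next
  case (insert a A)
  then show ?case using homogeneous_mult[of "f a" "e a" "prod f A" "sum e A"] by simp
qed

lemma mon_val_homogeneous:
  assumes "\<And>i. s i \<in> homogeneous 1"
  shows "mon_val s m \<in> homogeneous (tdeg m)"
proof -
  have "s i ^ expo m i \<in> homogeneous (expo m i)" for i
    using homogeneous_power[OF assms] by simp
  then show ?thesis
    unfolding mon_val_def tdeg_def by (rule homogeneous_prod[OF finite_keys])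
qed

lemma mp_subst_homogeneous:
  assumes "\<And>i. s i \<in> homogeneous 1" "p \<in> homogeneous d"
  shows "mp_subst s p \<in> homogeneous d"
  unfolding mp_subst_hom mp_hom_def
proof (intro homogeneous_sum homogeneous_Const_mult)
  fix m assume "m \<in> Poly_Mapping.keys p"
  with assms(2) have "tdeg m = d" by (simp add: homogeneous_iff in_keys_iff)
  then show "mon_val s m \<in> homogeneous d" using mon_val_homogeneous[of s m, OF assms(1)] by simp
qed

lemma mp_diff_homogeneous:
  assumes "p \<in> homogeneous (Suc d)"
  shows "mp_diff i p \<in> homogeneous d"
proof -
  have "Poly_Mapping.single (m - Poly_Mapping.single i 1) (of_nat (expo m i) * cf p m) \<in> homogeneous d"
    if "m \<in> Poly_Mapping.keys p" for m
  proof (cases "expo m i")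
    case (Suc k)
    let ?n = "m - Poly_Mapping.single i 1"
    have "m = ?n + Poly_Mapping.single i 1"
      by (rule poly_mapping_eqI) (use Suc in \<open>auto simp: lookup_add lookup_minus lookup_single when_def\<close>)
    then have "tdeg m = tdeg ?n + 1" by (metis tdeg_add tdeg_single)
    moreover have "tdeg m = Suc d" using assms that by (auto simp: homogeneous_iff in_keys_iff)
    ultimately show ?thesis by (auto simp: homogeneous_iff lookup_single when_def)
  qed simp
  then show ?thesis unfolding mp_diff_def by (intro homogeneous_sum) auto
qed

text \<open>\<open>mp.scale_scale\<close> merges scalars, against \<open>Const_mult\<close>, which
  splits them.\<close>

declare mp.scale_scale [simp del] mp.scale_minus_left [simp del] mp.scale_minus_right [simp del]

section \<open>Three-dimensional spaces of forms\<close>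

text \<open>Stated for a triple and not for the set \<open>{p, q, r}\<close>: in a set, a repeated
  vector would not count as a dependence.\<close>

definition indep3 :: "('v, 'a::field) mpoly \<Rightarrow> ('v, 'a) mpoly \<Rightarrow> ('v, 'a) mpoly \<Rightarrow> bool" where
  "indep3 p q r \<longleftrightarrow> (\<forall>a b c. Const a * p + Const b * q + Const c * r = 0 \<longrightarrow> a = 0 \<and> b = 0 \<and> c = 0)"

lemma in_span3:
  "x \<in> mp.span {p, q, r} \<longleftrightarrow> (\<exists>a b c. x = Const a * p + Const b * q + Const c * r)"
proof -
  have "x - Const a * p - Const b * q = Const c * r \<longleftrightarrow> x = Const a * p + Const b * q + Const c * r" for a b c
    by (auto simp: algebra_simps)
  then show ?thesis by (auto simp: mp.span_insert mp.span_singleton)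
qed

lemma indep3_imp:
  assumes "indep3 p q r"
  shows "mp.independent {p, q, r}" "p \<noteq> q" "p \<noteq> r" "q \<noteq> r"
proof -
  have *: "a = 0 \<and> b = 0 \<and> c = 0" if "Const a * p + Const b * q + Const c * r = 0" for a b c
    using assms that unfolding indep3_def by blast
  show ne: "p \<noteq> q" "p \<noteq> r" "q \<noteq> r"
    using *[of 1 "-1" 0] *[of 1 0 "-1"] *[of 0 1 "-1"] by (auto simp: Const_uminus)
  have 1: "r \<noteq> 0" using *[of 0 0 1] by auto
  have 2: "q \<notin> mp.span {r}"
  proof
    assume "q \<in> mp.span {r}"
    then obtain k where "q = Const k * r" by (auto simp: mp.span_singleton)
    then show False using *[of 0 1 "-k"] by (simp add: Const_uminus)
  qed
  have 3: "p \<notin> mp.span {q, r}"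
  proof
    assume "p \<in> mp.span {q, r}"
    then obtain k l where "p - Const k * q = Const l * r" by (auto simp: mp.span_insert mp.span_singleton)
    then have "p = Const k * q + Const l * r" by (simp add: algebra_simps)
    then show False using *[of 1 "-k" "-l"] by (simp add: Const_uminus)
  qed
  show "mp.independent {p, q, r}"
    using 1 2 3 ne by (simp add: mp.independent_insert)
qed

lemma indep3_iff_independent:
  assumes "p \<noteq> q" "p \<noteq> r" "q \<noteq> r"
  shows "indep3 p q r \<longleftrightarrow> mp.independent {p, q, r}"
proof
  assume "mp.independent {p, q, r}"
  then have ind: "\<And>u v. (\<Sum>v\<in>{p, q, r}. Const (u v) * v) = 0 \<Longrightarrow> v \<in> {p, q, r} \<Longrightarrow> u v = 0"
    using mp.independentD[of "{p, q, r}" "{p, q, r}"] by blast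
  show "indep3 p q r"
    unfolding indep3_def
  proof (intro allI impI)
    fix a b c assume eq: "Const a * p + Const b * q + Const c * r = 0"
    let ?u = "\<lambda>v. if v = p then a else if v = q then b else c"
    have s: "(\<Sum>v\<in>{p, q, r}. Const (?u v) * v) = 0"
      using assms eq by (auto simp: add.assoc)
    show "a = 0 \<and> b = 0 \<and> c = 0"
      using ind[OF s, of p] ind[OF s, of q] ind[OF s, of r] assms by auto
  qed
qed (rule indep3_imp)

text \<open>Steinitz exchange: an independent set inside the span of at most as many vectors already
  spans, and a redundant vector in \<open>T\<close> would leave too few.\<close>

lemma mp_span_eq_of_card_le:
  assumes S: "mp.independent S" "S \<subseteq> mp.span T" and T: "finite T" "card T \<le> card S"
  shows "mp.span T = mp.span S" "mp.independent T" "card T = card S"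
proof -
  have fS: "finite S" and "card S \<le> card T" using mp.independent_span_bound[OF T(1) S] by auto
  with T show c: "card T = card S" by simp
  show "mp.independent T"
  proof
    assume "mp.dependent T"
    then obtain a where a: "a \<in> T" "a \<in> mp.span (T - {a})" unfolding mp.dependent_def by blast
    have "T \<subseteq> mp.span (T - {a})"
    proof
      fix y assume "y \<in> T"
      then show "y \<in> mp.span (T - {a})" using a(2) by (cases "y = a") (auto intro: mp.span_base)
    qed
    then have "mp.span T \<subseteq> mp.span (T - {a})" by (rule mp.span_minimal) (rule mp.subspace_span)
    then have "S \<subseteq> mp.span (T - {a})" using S(2) by (rule order_trans[rotated])
    then have "card S \<le> card (T - {a})" using mp.independent_span_bound[of "T - {a}" S] T(1) S(1) by blast
    also have "\<dots> < card T" using T(1) a(1) by (rule card_Diff1_less)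
    finally show False using c by simp
  qed
  show "mp.span T = mp.span S"
  proof
    show "mp.span S \<subseteq> mp.span T" using S(2) mp.subspace_span by (rule mp.span_minimal)
    show "mp.span T \<subseteq> mp.span S"
    proof
      fix x assume x: "x \<in> mp.span T"
      show "x \<in> mp.span S"
      proof (rule ccontr)
        assume nx: "x \<notin> mp.span S"
        then have ind: "mp.independent (insert x S)" using S(1) by (rule mp.independent_insertI)
        have "insert x S \<subseteq> mp.span T" using x S(2) by blast
        then have "card (insert x S) \<le> card T" using mp.independent_span_bound[OF T(1) ind] by blast
        moreover have "x \<notin> S" using nx mp.span_base by blast
        ultimately show False using c fS by simp
      qed
    qed
  qed
qed

lemma span3_eq_of_indep3:
  assumes "indep3 p q r" "p \<in> mp.span {u, v, w}" "q \<in> mp.span {u, v, w}" "r \<in> mp.span {u, v, w}"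
  shows "mp.span {u, v, w} = mp.span {p, q, r}" "indep3 u v w"
proof -
  note i = indep3_imp[OF assms(1)]
  have c3: "card {p, q, r} = 3" using i(2-4) by simp
  have sub: "{p, q, r} \<subseteq> mp.span {u, v, w}" using assms(2-4) by blast
  have le: "card {u, v, w} \<le> card {p, q, r}" unfolding c3 by (simp add: card_insert_if)
  note * = mp_span_eq_of_card_le[OF i(1) sub _ le]
  show "mp.span {u, v, w} = mp.span {p, q, r}" by (rule *) simp
  have ind: "mp.independent {u, v, w}" by (rule *) simp
  have c: "card {u, v, w} = 3" using *(3) c3 by simp
  have ne: "u \<noteq> v" "u \<noteq> w" "v \<noteq> w"
  proof -
    show "u \<noteq> v" "u \<noteq> w" "v \<noteq> w" using c by (auto simp: card_insert_if split: if_splits)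
  qed
  show "indep3 u v w" using ind indep3_iff_independent[OF ne] by blast
qed

definition triple :: "'b \<Rightarrow> 'b \<Rightarrow> 'b \<Rightarrow> 3 \<Rightarrow> 'b" where
  "triple p q r i = (if i = 1 then p else if i = 2 then q else r)"

lemma triple_simps [simp]: "triple p q r 1 = p" "triple p q r 2 = q" "triple p q r 3 = r"
  by (simp_all add: triple_def)

lemma is_basis_iff: "is_basis b V \<longleftrightarrow> indep3 (b 1) (b 2) (b 3) \<and> V = mp.span {b 1, b 2, b 3}"
proof -
  have r: "range b = {b 1, b 2, b 3}" unfolding UNIV_3 image_insert image_empty ..
  have i: "inj b \<longleftrightarrow> b 1 \<noteq> b 2 \<and> b 1 \<noteq> b 3 \<and> b 2 \<noteq> b 3"
    unfolding inj_def forall_3 by auto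
  show ?thesis
    unfolding is_basis_def r i
    using indep3_iff_independent[of "b 1" "b 2" "b 3"] indep3_imp[of "b 1" "b 2" "b 3"] by blast
qed

lemma nets_iff:
  "V \<in> nets \<longleftrightarrow> (\<exists>p q r. p \<in> R 2 \<and> q \<in> R 2 \<and> r \<in> R 2 \<and> indep3 p q r \<and> V = mp.span {p, q, r})"
proof
  assume V: "V \<in> nets"
  obtain b where b: "is_basis b V" using is_basis_exists[OF V] by blast
  then have b': "indep3 (b 1) (b 2) (b 3)" "V = mp.span {b 1, b 2, b 3}" unfolding is_basis_iff by blast+
  have "V \<subseteq> R 2" using V unfolding nets_def by blast
  then have "{b 1, b 2, b 3} \<subseteq> R 2" using mp.span_superset[of "{b 1, b 2, b 3}"] b'(2) by blast
  then show "\<exists>p q r. p \<in> R 2 \<and> q \<in> R 2 \<and> r \<in> R 2 \<and> indep3 p q r \<and> V = mp.span {p, q, r}"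
    using b' by blast
next
  assume "\<exists>p q r. p \<in> R 2 \<and> q \<in> R 2 \<and> r \<in> R 2 \<and> indep3 p q r \<and> V = mp.span {p, q, r}"
  then obtain p q r where *: "p \<in> R 2" "q \<in> R 2" "r \<in> R 2" "indep3 p q r" "V = mp.span {p, q, r}" by blast
  have "V \<subseteq> R 2"
  proof
    fix x assume "x \<in> V"
    then obtain a b c where "x = Const a * p + Const b * q + Const c * r" unfolding *(5) in_span3 by blast
    then show "x \<in> R 2" using * by (simp add: homogeneous_add homogeneous_Const_mult)
  qed
  moreover have "mp.dim V = 3"
    unfolding *(5) using indep3_imp[OF *(4)] by (simp add: mp.dim_eq_card_independent)
  moreover have "mp.subspace V" unfolding *(5) by (rule mp.subspace_span)
  ultimately show "V \<in> nets" unfolding nets_def by blast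
qed

lemma is_basis_triple: "indep3 p q r \<Longrightarrow> is_basis (triple p q r) (mp.span {p, q, r})"
  unfolding is_basis_iff triple_simps by blast

lemma nets_span3:
  assumes "V \<in> nets" "V \<subseteq> mp.span {p, q, r}"
  shows "V = mp.span {p, q, r}" "indep3 p q r"
proof -
  obtain u v w where *: "indep3 u v w" "V = mp.span {u, v, w}" using assms(1) nets_iff by blast
  then have "u \<in> mp.span {p, q, r}" "v \<in> mp.span {p, q, r}" "w \<in> mp.span {p, q, r}"
    using assms(2) mp.span_superset[of "{u, v, w}"] by blast+
  from span3_eq_of_indep3[OF *(1) this] show "V = mp.span {p, q, r}" "indep3 p q r"
    unfolding *(2) by blast+
qed

lemma nets_subset_eq: "V \<in> nets \<Longrightarrow> W \<in> nets \<Longrightarrow> V \<subseteq> W \<Longrightarrow> V = W"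
  using nets_span3(1)[of V] unfolding nets_iff[of W] by blast

section \<open>Linear substitutions\<close>

lemma lin_subst_simps [simp]:
  "lin_subst A (p + q) = lin_subst A p + lin_subst A q"
  "lin_subst A (p * q) = lin_subst A p * lin_subst A q"
  "lin_subst A (Const c) = Const c"
  "lin_subst A 0 = 0" "lin_subst A 1 = 1" "lin_subst A (numeral n) = numeral n"
  "lin_subst A (p ^ k) = lin_subst A p ^ k"
  "lin_subst A (sum f S) = (\<Sum>i\<in>S. lin_subst A (f i))"
  by (simp_all add: lin_subst_def)

lemma lin_subst_diff [simp]: "lin_subst A (p - q) = lin_subst A p - lin_subst A (q :: 'a::comm_ring_1 form)"
  by (simp add: lin_subst_def)

lemma lin_subst_Var: "lin_subst A (Var i) = Const (A $ i $ 1) * X + Const (A $ i $ 2) * Y + Const (A $ i $ 3) * Z"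
  by (simp add: lin_subst_def sum_3)

text \<open>The factors are reversed because \<open>lin_subst A\<close> is composition with the map
  x to A x.\<close>

lemma lin_subst_lin_subst:
  fixes p :: "'a::comm_ring_1 form"
  shows "lin_subst A (lin_subst B p) = lin_subst (B ** A) p"
  unfolding lin_subst_def mp_subst_subst
  by (rule arg_cong[where f = "\<lambda>s. mp_subst s p"])
    (simp add: fun_eq_iff sum_3 matrix_matrix_mult_def Const_add Const_mult algebra_simps)

lemma lin_subst_mat_1 [simp]: "lin_subst (mat 1) (p :: 'a::comm_ring_1 form) = p"
proof -
  have "(\<lambda>i. \<Sum>j\<in>UNIV. Const ((mat 1 :: 'a^3^3) $ i $ j) * Var j) = (Var :: 3 \<Rightarrow> 'a form)"
  proof
    fix i :: 3
    have "(\<Sum>j\<in>UNIV. Const ((mat 1 :: 'a^3^3) $ i $ j) * Var j) = (\<Sum>j\<in>UNIV. if i = j then Var j else 0)"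
      by (rule sum.cong) (auto simp: mat_def)
    then show "(\<Sum>j\<in>UNIV. Const ((mat 1 :: 'a^3^3) $ i $ j) * Var j) = (Var i :: 'a form)" by simp
  qed
  then show ?thesis by (simp add: lin_subst_def mp_subst_Var)
qed

lemma lin_subst_homogeneous: "p \<in> R d \<Longrightarrow> lin_subst A p \<in> R d"
  unfolding lin_subst_def
  by (rule mp_subst_homogeneous) (auto intro!: homogeneous_sum homogeneous_Const_mult)

lemma mp_eval_lin_subst: "mp_eval (($) x) (lin_subst A p) = mp_eval (($) (A *v x)) p"
  unfolding lin_subst_def mp_eval_subst
  by (rule arg_cong[where f = "\<lambda>s. mp_eval s p"]) (simp add: fun_eq_iff matrix_vector_mult_def)

lemma mp_diff_lin_subst:
  fixes p :: "'a::comm_ring_1 form"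
  shows "mp_diff i (lin_subst A p) = (\<Sum>j\<in>UNIV. Const (A $ j $ i) * lin_subst A (mp_diff j p))"
proof -
  have "mp_diff i (\<Sum>k\<in>UNIV. Const (A $ j $ k) * Var k) = (Const (A $ j $ i) :: 'a form)" for j
  proof -
    have "(\<Sum>k\<in>UNIV. Const (A $ j $ k) * mp_diff i (Var k)) = (\<Sum>k\<in>UNIV. if i = k then Const (A $ j $ k) else (0 :: 'a form))"
      by (rule sum.cong) (auto simp: mp_diff_Var)
    then show ?thesis by simp
  qed
  then show ?thesis unfolding lin_subst_def mp_diff_subst by simp
qed

lemma invertible_inverse:
  fixes A :: "'a::field^3^3"
  assumes "invertible A"
  obtains B where "invertible B" "A ** B = mat 1" "B ** A = mat 1"
  using assms unfolding invertible_def by metis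

lemma lin_subst_inverse:
  fixes A B :: "'a::field^3^3"
  assumes "A ** B = mat 1"
  shows "lin_subst B (lin_subst A p) = p"
  by (simp add: lin_subst_lin_subst assms)

lemma module_hom_lin_subst:
  "module_hom (\<lambda>(c::'a::field) (p::'a form). Const c * p) (\<lambda>c p. Const c * p) (lin_subst A)"
  by unfold_locales (simp_all add: algebra_simps Const_add Const_mult)

lemma lin_subst_span: "lin_subst A ` mp.span S = mp.span (lin_subst A ` S)"
  by (rule module_hom.span_image[OF module_hom_lin_subst, symmetric])

lemma lin_subst_indep3:
  assumes "invertible A" "indep3 p q r"
  shows "indep3 (lin_subst A p) (lin_subst A q) (lin_subst A r)"
  unfolding indep3_def
proof (intro allI impI)
  fix a b c assume *: "Const a * lin_subst A p + Const b * lin_subst A q + Const c * lin_subst A r = 0"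
  obtain B where "A ** B = mat 1" using invertible_inverse[OF assms(1)] by blast
  from lin_subst_inverse[OF this] arg_cong[OF *, of "lin_subst B"]
  have "Const a * p + Const b * q + Const c * r = 0" by simp
  then show "a = 0 \<and> b = 0 \<and> c = 0" using assms(2) by (simp add: indep3_def)
qed

lemma lin_subst_nets: "invertible A \<Longrightarrow> V \<in> nets \<Longrightarrow> lin_subst A ` V \<in> nets"
proof -
  assume A: "invertible A" and "V \<in> nets"
  then obtain p q r where *: "p \<in> R 2" "q \<in> R 2" "r \<in> R 2" "indep3 p q r" "V = mp.span {p, q, r}"
    unfolding nets_iff by blast
  have "lin_subst A ` V = mp.span {lin_subst A p, lin_subst A q, lin_subst A r}"
    unfolding *(5) lin_subst_span image_insert image_empty ..
  then show ?thesis
    unfolding nets_iff using * lin_subst_indep3[OF A *(4)] lin_subst_homogeneous by blast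
qed

lemma orbit_refl: "V \<in> orbit V"
proof -
  have "lin_subst (mat 1) ` V = V" by simp
  moreover have "invertible (mat 1 :: 'a::field^3^3)" unfolding invertible_def by (intro exI[of _ "mat 1"]) simp
  ultimately show ?thesis unfolding orbit_def by blast
qed

lemma orbit_trans: "U \<in> orbit W \<Longrightarrow> W \<in> orbit V \<Longrightarrow> U \<in> orbit V"
proof -
  assume "U \<in> orbit W" "W \<in> orbit V"
  then obtain A B where "invertible A" "invertible B" "U = lin_subst A ` lin_subst B ` V"
    by (auto simp: orbit_def)
  moreover from this have "U = lin_subst (B ** A) ` V" by (simp add: image_image lin_subst_lin_subst)
  ultimately show ?thesis unfolding orbit_def using invertible_mult by blast
qed

lemma orbit_sym: "W \<in> orbit V \<Longrightarrow> V \<in> orbit W"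
proof -
  assume "W \<in> orbit V"
  then obtain A where A: "invertible A" "W = lin_subst A ` V" by (auto simp: orbit_def)
  obtain B where B: "invertible B" "A ** B = mat 1" using invertible_inverse[OF A(1)] by blast
  have "V = lin_subst B ` W" using A lin_subst_inverse[OF B(2)] by (simp add: image_image)
  then show ?thesis unfolding orbit_def using B by blast
qed

lemma orbit_eq: "W \<in> orbit V \<longleftrightarrow> orbit W = orbit V"
  using orbit_refl orbit_sym orbit_trans by blast

lemma orbit_nets: "V \<in> nets \<Longrightarrow> W \<in> orbit V \<Longrightarrow> W \<in> nets"
  unfolding orbit_def using lin_subst_nets by blast

definition rows :: "'a \<Rightarrow> 'a \<Rightarrow> 'a \<Rightarrow> 'a \<Rightarrow> 'a \<Rightarrow> 'a \<Rightarrow> 'a \<Rightarrow> 'a \<Rightarrow> 'a \<Rightarrow> 'a^3^3" where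
  "rows a11 a12 a13 a21 a22 a23 a31 a32 a33 =
     (\<chi> i. triple (\<chi> j. triple a11 a12 a13 j) (\<chi> j. triple a21 a22 a23 j) (\<chi> j. triple a31 a32 a33 j) i)"

lemma rows_nth [simp]:
  "rows a11 a12 a13 a21 a22 a23 a31 a32 a33 $ 1 $ 1 = a11"
  "rows a11 a12 a13 a21 a22 a23 a31 a32 a33 $ 1 $ 2 = a12"
  "rows a11 a12 a13 a21 a22 a23 a31 a32 a33 $ 1 $ 3 = a13"
  "rows a11 a12 a13 a21 a22 a23 a31 a32 a33 $ 2 $ 1 = a21"
  "rows a11 a12 a13 a21 a22 a23 a31 a32 a33 $ 2 $ 2 = a22"
  "rows a11 a12 a13 a21 a22 a23 a31 a32 a33 $ 2 $ 3 = a23"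
  "rows a11 a12 a13 a21 a22 a23 a31 a32 a33 $ 3 $ 1 = a31"
  "rows a11 a12 a13 a21 a22 a23 a31 a32 a33 $ 3 $ 2 = a32"
  "rows a11 a12 a13 a21 a22 a23 a31 a32 a33 $ 3 $ 3 = a33"
  by (simp_all add: rows_def)

lemma det_rows: "det (rows a11 a12 a13 a21 a22 a23 a31 a32 a33) =
   a11 * (a22 * a33 - a23 * a32) - a12 * (a21 * a33 - a23 * a31) + a13 * (a21 * a32 - a22 * (a31::'a::comm_ring_1))"
  by (simp add: det_3 algebra_simps)

lemma invertible_rows:
  "invertible (rows a11 a12 a13 a21 a22 a23 a31 a32 a33) \<longleftrightarrow>
   a11 * (a22 * a33 - a23 * a32) - a12 * (a21 * a33 - a23 * a31) + a13 * (a21 * a32 - a22 * (a31::'a::field)) \<noteq> 0"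
  by (simp add: invertible_det_nz det_rows)

text \<open>Membership of the three images is enough: they are independent, so by dimension they
  span the target, and no inclusion in the other direction has to be computed.\<close>

lemma orbit_span3I:
  assumes "V \<in> nets" "V \<subseteq> mp.span {p, q, r}" "invertible A"
    "lin_subst A p \<in> mp.span {u, v, w}" "lin_subst A q \<in> mp.span {u, v, w}" "lin_subst A r \<in> mp.span {u, v, w}"
  shows "mp.span {u, v, w} \<in> orbit V"
proof -
  have V: "V = mp.span {p, q, r}" "indep3 p q r" using nets_span3[OF assms(1,2)] .
  have "mp.span {u, v, w} = mp.span {lin_subst A p, lin_subst A q, lin_subst A r}"
    using span3_eq_of_indep3(1)[OF lin_subst_indep3[OF assms(3) V(2)] assms(4-6)] .
  also have "\<dots> = lin_subst A ` V" unfolding V(1) lin_subst_span by simp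
  finally show ?thesis unfolding orbit_def using assms(3) by blast
qed

section \<open>Conics and cubics by coefficients\<close>

definition mon :: "nat \<Rightarrow> nat \<Rightarrow> nat \<Rightarrow> 3 \<Rightarrow>\<^sub>0 nat" where
  "mon i j k = Poly_Mapping.single 1 i + Poly_Mapping.single 2 j + Poly_Mapping.single 3 k"

lemma expo_mon [simp]: "expo (mon i j k) 1 = i" "expo (mon i j k) 2 = j" "expo (mon i j k) 3 = k"
  by (simp_all add: mon_def lookup_add lookup_single)

lemma mon_eq_iff [simp]: "mon i j k = mon i' j' k' \<longleftrightarrow> i = i' \<and> j = j' \<and> k = k'"
  by (metis expo_mon)

lemma mon_expo: "m = mon (expo m 1) (expo m 2) (expo m 3)"
proof (rule poly_mapping_eqI)
  fix v :: 3
  show "expo m v = expo (mon (expo m 1) (expo m 2) (expo m 3)) v"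
    using exhaust_3[of v] by auto
qed

lemma tdeg_mon [simp]: "tdeg (mon i j k) = i + j + k"
  by (simp add: mon_def tdeg_add)

lemma single_power: "(Poly_Mapping.single m c :: ('v, 'a::comm_semiring_1) mpoly) ^ n =
    Poly_Mapping.single (((+) m ^^ n) 0) (c ^ n)"
  by (induction n) (simp_all add: mult_single)

lemma single_mon:
  "Poly_Mapping.single (mon i j k) c = Const c * X ^ i * Y ^ j * (Z :: 'a::comm_semiring_1 form) ^ k"
proof -
  have *: "((+) (Poly_Mapping.single v (Suc 0)) ^^ n) 0 = (Poly_Mapping.single v n :: 3 \<Rightarrow>\<^sub>0 nat)" for v n
    by (induction n) (simp_all flip: single_add)
  show ?thesis
    by (simp add: Var_def single_power * mult_single mon_def Const_def)
qed

definition qf :: "'a \<Rightarrow> 'a \<Rightarrow> 'a \<Rightarrow> 'a \<Rightarrow> 'a \<Rightarrow> 'a \<Rightarrow> 'a::comm_semiring_1 form" where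
  "qf a b c d e f = Const a * X\<^sup>2 + Const b * Y\<^sup>2 + Const c * Z\<^sup>2 + Const d * (Y * Z) + Const e * (X * Z) + Const f * (X * Y)"

definition cub :: "'a \<Rightarrow> 'a \<Rightarrow> 'a \<Rightarrow> 'a \<Rightarrow> 'a \<Rightarrow> 'a \<Rightarrow> 'a \<Rightarrow> 'a \<Rightarrow> 'a \<Rightarrow> 'a \<Rightarrow> 'a::comm_semiring_1 form" where
  "cub a b c d e f g h i j = Const a * X ^ 3 + Const b * Y ^ 3 + Const c * Z ^ 3 +
     Const d * (X\<^sup>2 * Y) + Const e * (X\<^sup>2 * Z) + Const f * (X * Y\<^sup>2) + Const g * (Y\<^sup>2 * Z) +
     Const h * (X * Z\<^sup>2) + Const i * (Y * Z\<^sup>2) + Const j * (X * Y * Z)"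

lemma qf_single:
  "qf a b c d e f = Poly_Mapping.single (mon 2 0 0) a + Poly_Mapping.single (mon 0 2 0) b +
     Poly_Mapping.single (mon 0 0 2) c + Poly_Mapping.single (mon 0 1 1) d +
     Poly_Mapping.single (mon 1 0 1) e + Poly_Mapping.single (mon 1 1 0) f"
  by (simp add: qf_def single_mon mult.assoc)

lemma cub_single:
  "cub a b c d e f g h i j = Poly_Mapping.single (mon 3 0 0) a + Poly_Mapping.single (mon 0 3 0) b +
     Poly_Mapping.single (mon 0 0 3) c + Poly_Mapping.single (mon 2 1 0) d +
     Poly_Mapping.single (mon 2 0 1) e + Poly_Mapping.single (mon 1 2 0) f +
     Poly_Mapping.single (mon 0 2 1) g + Poly_Mapping.single (mon 1 0 2) h +
     Poly_Mapping.single (mon 0 1 2) i + Poly_Mapping.single (mon 1 1 1) j"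
  by (simp add: cub_def single_mon mult.assoc)

lemma cf_qf [simp]:
  "cf (qf a b c d e f) (mon 2 0 0) = a" "cf (qf a b c d e f) (mon 0 2 0) = b"
  "cf (qf a b c d e f) (mon 0 0 2) = c" "cf (qf a b c d e f) (mon 0 (Suc 0) (Suc 0)) = d"
  "cf (qf a b c d e f) (mon (Suc 0) 0 (Suc 0)) = e" "cf (qf a b c d e f) (mon (Suc 0) (Suc 0) 0) = f"
  by (simp_all add: qf_single lookup_add lookup_single)

lemma cf_cub [simp]:
  "cf (cub a b c d e f g h i j) (mon 3 0 0) = a" "cf (cub a b c d e f g h i j) (mon 0 3 0) = b"
  "cf (cub a b c d e f g h i j) (mon 0 0 3) = c" "cf (cub a b c d e f g h i j) (mon 2 (Suc 0) 0) = d"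
  "cf (cub a b c d e f g h i j) (mon 2 0 (Suc 0)) = e" "cf (cub a b c d e f g h i j) (mon (Suc 0) 2 0) = f"
  "cf (cub a b c d e f g h i j) (mon 0 2 (Suc 0)) = g" "cf (cub a b c d e f g h i j) (mon (Suc 0) 0 2) = h"
  "cf (cub a b c d e f g h i j) (mon 0 (Suc 0) 2) = i"
  "cf (cub a b c d e f g h i j) (mon (Suc 0) (Suc 0) (Suc 0)) = j"
  by (simp_all add: cub_single lookup_add lookup_single)

lemma homogeneous_cf_0: "p \<in> homogeneous d \<Longrightarrow> tdeg m \<noteq> d \<Longrightarrow> cf p m = 0"
  by (auto simp: homogeneous_iff)

lemma homogeneous_single: "tdeg m = d \<Longrightarrow> Poly_Mapping.single m c \<in> homogeneous d"
  by (simp add: homogeneous_iff lookup_single when_def)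

lemma qf_in_R2 [simp]: "qf a b c d e f \<in> R 2"
  unfolding qf_single by (intro homogeneous_add homogeneous_single) simp_all

lemma cub_in_R3 [simp]: "cub a b c d e f g h i j \<in> R 3"
  unfolding cub_single by (intro homogeneous_add homogeneous_single) simp_all

lemma R2_qf:
  assumes "p \<in> R 2"
  obtains a b c d e f where "p = qf a b c d e f"
proof
  show "p = qf (cf p (mon 2 0 0)) (cf p (mon 0 2 0)) (cf p (mon 0 0 2))
    (cf p (mon 0 1 1)) (cf p (mon 1 0 1)) (cf p (mon 1 1 0))" (is "_ = ?q")
  proof (rule poly_mapping_eqI)
    fix m
    obtain i j k where m: "m = mon i j k" using mon_expo by blast
    show "cf p m = cf ?q m"
    proof (cases "i + j + k = 2")
      case True
      then have "i = 0 \<or> i = 1 \<or> i = 2" "j = 0 \<or> j = 1 \<or> j = 2" by arith+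
      with True show ?thesis unfolding m by (elim disjE) simp_all
    next
      case False
      then have "cf p m = 0"
        using assms by (simp add: homogeneous_cf_0 m)
      moreover have "cf ?q m = 0"
        using False by (simp add: homogeneous_cf_0[OF qf_in_R2] m)
      ultimately show ?thesis by simp
    qed
  qed
qed

lemma R3_cub:
  assumes "p \<in> R 3"
  obtains a b c d e f g h i j where "p = cub a b c d e f g h i j"
proof
  show "p = cub (cf p (mon 3 0 0)) (cf p (mon 0 3 0)) (cf p (mon 0 0 3)) (cf p (mon 2 1 0)) (cf p (mon 2 0 1))
    (cf p (mon 1 2 0)) (cf p (mon 0 2 1)) (cf p (mon 1 0 2)) (cf p (mon 0 1 2)) (cf p (mon 1 1 1))" (is "_ = ?q")
  proof (rule poly_mapping_eqI)
    fix m
    obtain i j k where m: "m = mon i j k" using mon_expo by blast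
    show "cf p m = cf ?q m"
    proof (cases "i + j + k = 3")
      case True
      then have "i = 0 \<or> i = 1 \<or> i = 2 \<or> i = 3" "j = 0 \<or> j = 1 \<or> j = 2 \<or> j = 3" by arith+
      with True show ?thesis unfolding m by (elim disjE) simp_all
    next
      case False
      then have "cf p m = 0"
        using assms by (simp add: homogeneous_cf_0 m)
      moreover have "cf ?q m = 0"
        using False by (simp add: homogeneous_cf_0[OF cub_in_R3] m)
      ultimately show ?thesis by simp
    qed
  qed
qed

lemma qf_eq_iff:
  "qf a b c d e f = qf a' b' c' d' e' f' \<longleftrightarrow> a = a' \<and> b = b' \<and> c = c' \<and> d = d' \<and> e = e' \<and> f = f'"
  by (metis cf_qf)

lemma qf_0: "qf 0 0 0 0 0 0 = 0"
  by (simp add: qf_def)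

lemma qf_eq_0_iff: "qf a b c d e f = 0 \<longleftrightarrow> a = 0 \<and> b = 0 \<and> c = 0 \<and> d = 0 \<and> e = 0 \<and> f = 0"
  using qf_eq_iff[of a b c d e f 0 0 0 0 0 0] by (simp add: qf_0)

lemma cub_eq_iff:
  "cub a b c d e f g h i j = cub a' b' c' d' e' f' g' h' i' j' \<longleftrightarrow>
   a = a' \<and> b = b' \<and> c = c' \<and> d = d' \<and> e = e' \<and> f = f' \<and> g = g' \<and> h = h' \<and> i = i' \<and> j = j'"
  by (metis cf_cub)

lemma cub_0: "cub 0 0 0 0 0 0 0 0 0 0 = 0"
  by (simp add: cub_def)

lemma qf_add: "qf a b c d e f + qf a' b' c' d' e' f' = qf (a + a') (b + b') (c + c') (d + d') (e + e') (f + f')"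
  by (simp add: qf_def Const_add algebra_simps)

lemma qf_scale: "Const k * qf a b c d e f = qf (k * a) (k * b) (k * c) (k * d) (k * e) (k * f)"
  by (simp add: qf_def Const_mult algebra_simps)

lemma qf_comb:
  "Const k * qf a b c d e f + Const k' * qf a' b' c' d' e' f' + Const k'' * qf a'' b'' c'' d'' e'' f'' =
   qf (k * a + k' * a' + k'' * a'') (k * b + k' * b' + k'' * b'') (k * c + k' * c' + k'' * c'')
     (k * d + k' * d' + k'' * d'') (k * e + k' * e' + k'' * e'') (k * f + k' * f' + k'' * f'')"
  by (simp add: qf_add qf_scale)

lemma mp_eval_qf [simp]: "mp_eval (($) x) (qf a b c d e f) =
    a * (x $ 1)\<^sup>2 + b * (x $ 2)\<^sup>2 + c * (x $ 3)\<^sup>2 + d * (x $ 2 * x $ 3) + e * (x $ 1 * x $ 3) + f * (x $ 1 * x $ 2)"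
  by (simp add: qf_def)

lemma mp_eval_cub [simp]: "mp_eval (($) x) (cub a b c d e f g h i j) =
    a * (x $ 1) ^ 3 + b * (x $ 2) ^ 3 + c * (x $ 3) ^ 3 + d * ((x $ 1)\<^sup>2 * x $ 2) + e * ((x $ 1)\<^sup>2 * x $ 3) +
    f * (x $ 1 * (x $ 2)\<^sup>2) + g * ((x $ 2)\<^sup>2 * x $ 3) + h * (x $ 1 * (x $ 3)\<^sup>2) + i * (x $ 2 * (x $ 3)\<^sup>2) +
    j * (x $ 1 * x $ 2 * x $ 3)"
  by (simp add: cub_def)

lemma mp_diff_cub:
  "mp_diff 1 (cub a b c d e f g h i j) = qf (3 * a) f h j (2 * e) (2 * d)"
  "mp_diff 2 (cub a b c d e f g h i j) = qf d (3 * b) i (2 * g) j (2 * f)"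
  "mp_diff 3 (cub a b c d e f g h i j) = qf e g (3 * c) (2 * i) (2 * h) (j :: 'a::comm_ring_1)"
  by (simp_all add: cub_def qf_def mp_diff_Var Const_mult Const_numeral power2_eq_square power3_eq_cube algebra_simps)

lemma mp_diff_qf:
  "mp_diff 1 (qf u v w x y z) = Const (2 * u) * X + Const z * Y + Const y * (Z :: 'a::comm_ring_1 form)"
  "mp_diff 2 (qf u v w x y z) = Const z * X + Const (2 * v) * Y + Const x * (Z :: 'a form)"
  "mp_diff 3 (qf u v w x y z) = Const y * X + Const x * Y + Const (2 * w) * (Z :: 'a form)"
  by (simp_all add: qf_def mp_diff_Var power2_eq_square Const_mult Const_numeral algebra_simps)

lemma lin_subst_qf:
  fixes A :: "'a::comm_ring_1^3^3"
  shows "lin_subst A (qf a b c d e f) = qf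
    (a * (A$1$1)\<^sup>2 + b * (A$2$1)\<^sup>2 + c * (A$3$1)\<^sup>2 + d * (A$2$1 * A$3$1) + e * (A$1$1 * A$3$1) + f * (A$1$1 * A$2$1))
    (a * (A$1$2)\<^sup>2 + b * (A$2$2)\<^sup>2 + c * (A$3$2)\<^sup>2 + d * (A$2$2 * A$3$2) + e * (A$1$2 * A$3$2) + f * (A$1$2 * A$2$2))
    (a * (A$1$3)\<^sup>2 + b * (A$2$3)\<^sup>2 + c * (A$3$3)\<^sup>2 + d * (A$2$3 * A$3$3) + e * (A$1$3 * A$3$3) + f * (A$1$3 * A$2$3))
    (2 * (a * A$1$2 * A$1$3 + b * A$2$2 * A$2$3 + c * A$3$2 * A$3$3) + d * (A$2$2 * A$3$3 + A$2$3 * A$3$2) +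
      e * (A$1$2 * A$3$3 + A$1$3 * A$3$2) + f * (A$1$2 * A$2$3 + A$1$3 * A$2$2))
    (2 * (a * A$1$1 * A$1$3 + b * A$2$1 * A$2$3 + c * A$3$1 * A$3$3) + d * (A$2$1 * A$3$3 + A$2$3 * A$3$1) +
      e * (A$1$1 * A$3$3 + A$1$3 * A$3$1) + f * (A$1$1 * A$2$3 + A$1$3 * A$2$1))
    (2 * (a * A$1$1 * A$1$2 + b * A$2$1 * A$2$2 + c * A$3$1 * A$3$2) + d * (A$2$1 * A$3$2 + A$2$2 * A$3$1) +
      e * (A$1$1 * A$3$2 + A$1$2 * A$3$1) + f * (A$1$1 * A$2$2 + A$1$2 * A$2$1))"
  unfolding qf_def lin_subst_simps lin_subst_Var Const_ring power2_eq_square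
  by (simp add: algebra_simps)

lemma conic_matrix_qf:
  "conic_matrix (qf a b c d e f) = rows a (f / 2) (e / 2) (f / 2) b (d / 2) (e / 2) (d / 2) (c :: 'a::field_char_0)"
proof -
  have m: "Poly_Mapping.single 1 (Suc 0) + Poly_Mapping.single 1 (Suc 0) = mon 2 0 0"
    "Poly_Mapping.single 2 (Suc 0) + Poly_Mapping.single 2 (Suc 0) = mon 0 2 0"
    "Poly_Mapping.single 3 (Suc 0) + Poly_Mapping.single 3 (Suc 0) = mon 0 0 2"
    "Poly_Mapping.single 2 (Suc 0) + Poly_Mapping.single 3 (Suc 0) = mon 0 (Suc 0) (Suc 0)"
    "Poly_Mapping.single 1 (Suc 0) + Poly_Mapping.single 3 (Suc 0) = mon (Suc 0) 0 (Suc 0)"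
    "Poly_Mapping.single 1 (Suc 0) + Poly_Mapping.single 2 (Suc 0) = mon (Suc 0) (Suc 0) 0"
    "Poly_Mapping.single 3 (Suc 0) + Poly_Mapping.single 2 (Suc 0) = mon 0 (Suc 0) (Suc 0)"
    "Poly_Mapping.single 3 (Suc 0) + Poly_Mapping.single 1 (Suc 0) = mon (Suc 0) 0 (Suc 0)"
    "Poly_Mapping.single 2 (Suc 0) + Poly_Mapping.single 1 (Suc 0) = mon (Suc 0) (Suc 0) 0"
    by (simp_all add: mon_def add_ac numeral_2_eq_2 flip: single_add)
  show ?thesis
    by (simp add: conic_matrix_def vec_eq_iff forall_3 m)
qed

lemma indep3_qf:
  assumes "\<And>a b c. a * p1 + b * q1 + c * r1 = 0 \<Longrightarrow> a * p2 + b * q2 + c * r2 = 0 \<Longrightarrow>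
    a * p3 + b * q3 + c * r3 = 0 \<Longrightarrow> a * p4 + b * q4 + c * r4 = 0 \<Longrightarrow> a * p5 + b * q5 + c * r5 = 0 \<Longrightarrow>
    a * p6 + b * q6 + c * r6 = 0 \<Longrightarrow> a = 0 \<and> b = 0 \<and> c = 0"
  shows "indep3 (qf p1 p2 p3 p4 p5 p6) (qf q1 q2 q3 q4 q5 q6) (qf r1 r2 r3 r4 r5 (r6 :: 'a::field))"
  unfolding indep3_def qf_comb qf_eq_0_iff using assms by blast

lemma span3_nets: "indep3 p q r \<Longrightarrow> p \<in> R 2 \<Longrightarrow> q \<in> R 2 \<Longrightarrow> r \<in> R 2 \<Longrightarrow> mp.span {p, q, r} \<in> nets"
  unfolding nets_iff by blast

lemma qf_monomials:
  "X\<^sup>2 = qf 1 0 0 0 0 0" "Y\<^sup>2 = qf 0 1 0 0 0 0" "Z\<^sup>2 = qf 0 0 1 0 0 0"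
  "Y * Z = qf 0 0 0 1 0 0" "X * Z = qf 0 0 0 0 1 0" "X * Y = qf 0 0 0 0 0 (1 :: 'a::comm_ring_1)"
  by (simp_all add: qf_def)

lemma qf_diff: "qf a b c d e f - qf a' b' c' d' e' f' = qf (a - a') (b - b') (c - c') (d - d') (e - e') (f - (f' :: 'a::comm_ring_1))"
  by (simp add: qf_def Const_diff algebra_simps)

lemma qf_products:
  "(Y + Z) * Z = qf 0 0 1 1 0 (0 :: 'a::comm_ring_1)" "(X + Y)\<^sup>2 = qf 1 1 0 0 0 (2 :: 'a)"
  by (simp_all add: qf_def Const_numeral power2_eq_square algebra_simps)

lemma named_nets_qf:
  "net_8a = mp.span {qf 0 0 0 0 0 1, qf 1 0 0 1 0 0, qf 0 1 0 0 1 (0 :: 'a::field)}"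
  "net_8c = mp.span {qf 0 0 1 0 0 0, qf 1 0 0 (-1) 0 0, qf 0 1 0 0 (-1) (0 :: 'a::field)}"
  "net_7a = mp.span {qf 1 0 0 1 0 0, qf 0 0 0 0 0 1, qf 0 0 0 0 1 (0 :: 'a::field)}"
  "net_7b = mp.span {qf 1 0 0 1 0 0, qf 0 0 0 0 0 1, qf 0 0 1 0 0 (0 :: 'a::field)}"
  "net_7c = mp.span {qf 1 0 0 1 0 0, qf 0 1 0 0 0 0, qf 0 0 1 0 0 (0 :: 'a::field)}"
  "net_6a = mp.span {qf 0 0 0 0 0 1, qf 0 0 0 1 0 0, qf 0 0 0 0 1 (0 :: 'a::field)}"
  "net_6b = mp.span {qf 1 0 0 0 0 0, qf 0 0 1 1 0 0, qf 0 0 0 0 0 (1 :: 'a::field)}"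
  "net_6c = mp.span {qf 0 0 0 0 1 0, qf 1 0 1 0 0 0, qf 0 0 0 1 0 (0 :: 'a::field)}"
  "net_6d = mp.span {qf 1 0 0 0 0 0, qf 0 1 0 0 0 0, qf 0 0 1 0 0 (0 :: 'a::field)}"
  "net_5a = mp.span {qf 0 0 0 0 0 1, qf 0 0 0 0 1 0, qf 0 0 1 0 0 (0 :: 'a::field)}"
  "net_5b = mp.span {qf 0 1 0 0 0 0, qf 0 0 1 0 0 0, qf 0 0 0 0 0 (1 :: 'a::field)}"
  "net_4 = mp.span {qf 1 0 0 1 0 0, qf 0 0 0 0 0 1, qf 0 1 0 0 0 (0 :: 'a::field)}"
  "net_2a = mp.span {qf 1 0 0 0 0 0, qf 0 0 0 0 0 1, qf 0 0 0 0 1 (0 :: 'a::field)}"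
  "net_2b = mp.span {qf 1 0 0 0 0 0, qf 0 1 0 0 0 0, qf 1 1 0 0 0 (2 :: 'a::field)}"
  unfolding net_8a_def net_8c_def net_7a_def net_7b_def net_7c_def net_6a_def net_6b_def net_6c_def
      net_6d_def net_5a_def net_5b_def net_4_def net_2a_def net_2b_def qf_products
  unfolding qf_monomials qf_add qf_diff by simp_all

lemma named_nets [simp]:
  "net_8a \<in> nets" "net_8c \<in> nets" "net_7a \<in> nets" "net_7b \<in> nets" "net_7c \<in> nets" "net_6a \<in> nets"
  "net_6b \<in> nets" "net_6c \<in> nets" "net_6d \<in> nets" "net_5a \<in> nets" "net_5b \<in> nets" "net_4 \<in> nets"
  "net_2a \<in> nets" "(net_2b :: 'a::field_char_0 form set) \<in> nets"
  unfolding named_nets_qf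
  by (auto intro!: span3_nets indep3_qf)

section \<open>Closures of orbits\<close>

definition poly_fun :: "('a::comm_semiring_1 \<Rightarrow> 'a) \<Rightarrow> bool" where
  "poly_fun f \<longleftrightarrow> (\<exists>p. \<forall>t. f t = poly p t)"

lemma poly_funI: "(\<And>t. f t = poly p t) \<Longrightarrow> poly_fun f"
  unfolding poly_fun_def by blast

lemma poly_fun_const: "poly_fun (\<lambda>t. c)"
  by (rule poly_funI[of _ "[:c:]"]) simp

lemma poly_fun_id: "poly_fun (\<lambda>t. t)"
  by (rule poly_funI[of _ "[:0, 1:]"]) simp

lemma poly_fun_add: "poly_fun f \<Longrightarrow> poly_fun g \<Longrightarrow> poly_fun (\<lambda>t. f t + g t)"
  unfolding poly_fun_def by (metis poly_add)

lemma poly_fun_mult: "poly_fun f \<Longrightarrow> poly_fun g \<Longrightarrow> poly_fun (\<lambda>t. f t * g t)"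
  unfolding poly_fun_def by (metis poly_mult)

lemma poly_fun_diff: "poly_fun f \<Longrightarrow> poly_fun g \<Longrightarrow> poly_fun (\<lambda>t. f t - (g t :: 'a::comm_ring_1))"
  unfolding poly_fun_def by (metis poly_diff)

lemma poly_fun_power: "poly_fun f \<Longrightarrow> poly_fun (\<lambda>t. f t ^ n)"
  by (induction n) (auto intro: poly_fun_const poly_fun_mult)

lemma poly_fun_sum: "(\<And>i. i \<in> A \<Longrightarrow> poly_fun (f i)) \<Longrightarrow> poly_fun (\<lambda>t. \<Sum>i\<in>A. f i t)"
  by (induction A rule: infinite_finite_induct) (auto intro: poly_fun_const poly_fun_add)

lemma poly_fun_prod: "(\<And>i. i \<in> A \<Longrightarrow> poly_fun (f i)) \<Longrightarrow> poly_fun (\<lambda>t. \<Prod>i\<in>A. f i t)"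
  by (induction A rule: infinite_finite_induct) (auto intro: poly_fun_const poly_fun_mult)

lemma poly_fun_zeros:
  fixes f :: "'a::idom \<Rightarrow> 'a"
  assumes "poly_fun f" "f a \<noteq> 0"
  shows "finite {t. f t = 0}"
proof -
  obtain p where p: "\<And>t. f t = poly p t" using assms(1) unfolding poly_fun_def by blast
  then have "p \<noteq> 0" using assms(2) by auto
  then show ?thesis unfolding p by (rule poly_roots_finite)
qed

lemma poly_fun_eqI:
  fixes f g :: "'a::{idom, ring_char_0} \<Rightarrow> 'a"
  assumes "poly_fun f" "poly_fun g" "\<And>t. t \<noteq> 0 \<Longrightarrow> f t = g t"
  shows "f t = g t"
proof (rule ccontr)
  assume "f t \<noteq> g t"
  then have "finite {t. f t - g t = 0}"
    by (intro poly_fun_zeros[of "\<lambda>t. f t - g t" t] poly_fun_diff assms) simp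
  moreover have "UNIV - {0} \<subseteq> {t. f t - g t = 0}" using assms(3) by auto
  ultimately have "finite (UNIV - {0} :: 'a set)" by (rule finite_subset[rotated])
  then show False by (simp add: infinite_UNIV_char_0)
qed

lemma mp_eval_scale:
  assumes "F \<in> homogeneous d"
  shows "mp_eval (\<lambda>i. c * x i) F = c ^ d * mp_eval x (F :: ('v, 'a::comm_semiring_1) mpoly)"
proof -
  have "mon_val (\<lambda>i. c * x i) m = c ^ tdeg m * mon_val x m" for m :: "'v \<Rightarrow>\<^sub>0 nat"
    by (simp add: mon_val_def tdeg_def power_mult_distrib prod.distrib power_sum)
  moreover have "tdeg m = d" if "m \<in> Poly_Mapping.keys F" for m
    using assms that by (simp add: homogeneous_iff in_keys_iff)
  ultimately show ?thesis
    unfolding mp_eval_hom mp_hom_def sum_distrib_left by (intro sum.cong) (simp_all add: mult_ac)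
qed

lemma poly_fun_mp_eval:
  assumes "\<And>i. poly_fun (\<lambda>t. x t i)"
  shows "poly_fun (\<lambda>t. mp_eval (x t) F)"
  unfolding mp_eval_def
  by (intro poly_fun_sum poly_fun_mult poly_fun_const poly_fun_prod poly_fun_power assms)

lemma pluecker_basis_change:
  assumes "is_basis b V" "is_basis b' V"
  obtains c where "pluecker b' = (\<lambda>\<mu>. c * pluecker b \<mu>)"
proof -
  have V: "V = mp.span {b 1, b 2, b 3}" using assms(1) is_basis_iff by blast
  have "\<exists>M :: 'a^3. b' i = Const (M $ 1) * b 1 + Const (M $ 2) * b 2 + Const (M $ 3) * b 3" for i
  proof -
    have "b' i \<in> V" using assms(2) unfolding is_basis_def by (metis mp.span_base rangeI)
    then obtain x y z where xyz: "b' i = Const x * b 1 + Const y * b 2 + Const z * b 3"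
      unfolding V in_span3 by blast
    show ?thesis by (rule exI[of _ "\<chi> j. triple x y z j"]) (simp add: xyz)
  qed
  then obtain M :: "3 \<Rightarrow> 'a^3" where M: "\<And>i. b' i = Const (M i $ 1) * b 1 + Const (M i $ 2) * b 2 + Const (M i $ 3) * b 3"
    by (metis (no_types))
  have "pluecker b' \<mu> = det (\<chi> i. M i) * pluecker b \<mu>" for \<mu>
  proof -
    have "(\<chi> i j. cf (b' i) (\<mu> j)) = (\<chi> i. M i) ** (\<chi> i j. cf (b i) (\<mu> j))"
      by (simp add: vec_eq_iff matrix_matrix_mult_def M lookup_add sum_3)
    then show ?thesis unfolding pluecker_def by (simp add: det_mul)
  qed
  then show thesis using that by blast
qed

lemma mp_eval_pluecker_basis_change:
  assumes "is_basis b V" "is_basis b' V" "F \<in> homogeneous d" "mp_eval (pluecker b) F = 0"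
  shows "mp_eval (pluecker b') F = 0"
proof -
  obtain c where "pluecker b' = (\<lambda>\<mu>. c * pluecker b \<mu>)" using pluecker_basis_change[OF assms(1,2)] .
  then show ?thesis using mp_eval_scale[OF assms(3), of c "pluecker b"] assms(4) by simp
qed

text \<open>A basic open neighbourhood of the limit pulls back to the set where a polynomial in
  \<open>t\<close> is nonzero, hence to a cofinite set. Finite intersections and unions preserve
  this, so every neighbourhood of \<open>V0\<close> contains \<open>V t\<close> for almost all
  \<open>t\<close>, and the field is infinite.\<close>

lemma closure_of_curve:
  fixes b :: "'a::field_char_0 \<Rightarrow> 3 \<Rightarrow> 'a form"
  assumes poly: "\<And>i m. poly_fun (\<lambda>t. cf (b t i) m)"
    and gen: "\<And>t. t \<noteq> 0 \<Longrightarrow> is_basis (b t) (V t)" "\<And>t. t \<noteq> 0 \<Longrightarrow> V t \<in> A" "A \<subseteq> nets"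
    and lim: "is_basis (b 0) V0" "V0 \<in> nets"
  shows "V0 \<in> zariski closure_of A"
proof -
  have fin: "finite {t. t \<noteq> 0 \<and> V t \<notin> T}"
    if "openin zariski T" "V0 \<in> T" for T
  proof -
    have "generate_topology_on {principal_open F | F d. F \<in> homogeneous d} T"
      using that(1) unfolding zariski_def openin_topology_generated_by_iff .
    then show ?thesis using that(2)
    proof induction
      case (Int S T)
      have "{t. t \<noteq> 0 \<and> V t \<notin> S \<inter> T} = {t. t \<noteq> 0 \<and> V t \<notin> S} \<union> {t. t \<noteq> 0 \<and> V t \<notin> T}" by auto
      then show ?case using Int by simp
    next
      case (UN K)
      then obtain T where T: "T \<in> K" "V0 \<in> T" by blast
      then have "finite {t. t \<noteq> 0 \<and> V t \<notin> T}" using UN by blast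
      then show ?case by (rule rev_finite_subset) (use T in blast)
    next
      case (Basis T)
      then obtain F d where F: "T = principal_open F" "F \<in> homogeneous d" by blast
      obtain b' where b': "is_basis b' V0" "mp_eval (pluecker b') F \<noteq> 0"
        using Basis(2) unfolding F(1) principal_open_def by blast
      have nz: "mp_eval (pluecker (b 0)) F \<noteq> 0"
        using mp_eval_pluecker_basis_change[OF lim(1) b'(1) F(2)] b'(2) by blast
      have "poly_fun (\<lambda>t. mp_eval (pluecker (b t)) F)"
        unfolding pluecker_def det_3
        by (intro poly_fun_mp_eval) (auto intro!: poly_fun_add poly_fun_diff poly_fun_mult poly)
      then have "finite {t. mp_eval (pluecker (b t)) F = 0}" using nz by (rule poly_fun_zeros)
      moreover have "{t. t \<noteq> 0 \<and> V t \<notin> T} \<subseteq> {t. mp_eval (pluecker (b t)) F = 0}"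
        using gen unfolding F(1) principal_open_def by blast
      ultimately show ?case by (rule finite_subset[rotated])
    qed simp
  qed
  have "\<exists>y. y \<in> A \<and> y \<in> T" if "openin zariski T" "V0 \<in> T" for T
  proof (rule ccontr)
    assume no: "\<nexists>y. y \<in> A \<and> y \<in> T"
    have "UNIV - {0} \<subseteq> {t. t \<noteq> 0 \<and> V t \<notin> T}" using gen(2) no by blast
    then have "finite (UNIV - {0 :: 'a})" using fin[OF that] by (rule finite_subset)
    then show False by (simp add: infinite_UNIV_char_0)
  qed
  then show ?thesis using lim(2) unfolding in_closure_of topspace_zariski by blast
qed

lemma orbit_subset_nets: "V \<in> nets \<Longrightarrow> orbit V \<subseteq> nets"
  using orbit_nets by blast

text \<open>Moving the curve by \<open>A\<close> moves its limit by \<open>A\<close>, so one curve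
  reaches the whole orbit of the limit.\<close>

lemma specialization_of_curve:
  fixes u v :: "3 \<Rightarrow> 'a::field_char_0 form"
  assumes V: "V \<in> nets"
    and gen: "\<And>t. t \<noteq> 0 \<Longrightarrow>
      mp.span {u 1 + Const t * v 1, u 2 + Const t * v 2, u 3 + Const t * v 3} \<in> orbit V"
    and lim: "mp.span {u 1, u 2, u 3} \<in> nets"
  shows "specialization (orbit V) (orbit (mp.span {u 1, u 2, u 3}))"
  unfolding specialization_def
proof
  fix W assume "W \<in> orbit (mp.span {u 1, u 2, u 3})"
  then obtain A where A: "invertible A" "W = lin_subst A ` mp.span {u 1, u 2, u 3}"
    by (auto simp: orbit_def)
  let ?b = "\<lambda>t i. lin_subst A (u i) + Const t * lin_subst A (v i)"
  have b: "lin_subst A (u i + Const t * v i) = ?b t i" for t i by simp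
  have im: "lin_subst A ` mp.span {u 1 + Const t * v 1, u 2 + Const t * v 2, u 3 + Const t * v 3} =
      mp.span {?b t 1, ?b t 2, ?b t 3}" for t
    unfolding lin_subst_span image_insert image_empty b ..
  have im0: "W = mp.span {?b 0 1, ?b 0 2, ?b 0 3}" using im[of 0] A(2) by simp
  show "W \<in> zariski closure_of orbit V"
  proof (rule closure_of_curve[where b = ?b and V = "\<lambda>t. mp.span {?b t 1, ?b t 2, ?b t 3}"])
    show "poly_fun (\<lambda>t. cf (?b t i) m)" for i m
      unfolding lookup_add lookup_Const_mult by (intro poly_fun_add poly_fun_const poly_fun_mult poly_fun_id)
    show mem: "mp.span {?b t 1, ?b t 2, ?b t 3} \<in> orbit V" if "t \<noteq> 0" for t
    proof -
      have "lin_subst A ` U \<in> orbit U" for U using A(1) unfolding orbit_def by blast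
      then show ?thesis unfolding im[symmetric] using gen[OF that] orbit_trans by blast
    qed
    show "is_basis (?b t) (mp.span {?b t 1, ?b t 2, ?b t 3})" if "t \<noteq> 0" for t
      unfolding is_basis_iff using nets_span3(2)[OF orbit_nets[OF V mem[OF that]] subset_refl] by blast
    show "W \<in> nets" unfolding A(2) by (rule lin_subst_nets[OF A(1) lim])
    then show "is_basis (?b 0) W" unfolding is_basis_iff im0 using nets_span3(2) by blast
    show "orbit V \<subseteq> nets" by (rule orbit_subset_nets[OF V])
  qed
qed

lemma specialization_trans:
  "specialization A B \<Longrightarrow> specialization B C \<Longrightarrow> specialization A C"
  unfolding specialization_def by (metis closure_of_closure_of closure_of_mono subset_trans)

text \<open>Homogeneous polynomials in the coordinates are handled as functions, so that invariants
  can be given by formulas instead of explicit elements of \<open>mpoly\<close>.\<close>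

definition hom_fun :: "nat \<Rightarrow> (('v \<Rightarrow> 'a) \<Rightarrow> 'a::comm_semiring_1) \<Rightarrow> bool" where
  "hom_fun d f \<longleftrightarrow> (\<exists>F\<in>homogeneous d. \<forall>x. f x = mp_eval x F)"

lemma hom_fun_coord: "hom_fun 1 (\<lambda>x. x i)"
  unfolding hom_fun_def by (rule bexI[of _ "Var i"]) simp_all

lemma hom_fun_add: "hom_fun d f \<Longrightarrow> hom_fun d g \<Longrightarrow> hom_fun d (\<lambda>x. f x + g x)"
  unfolding hom_fun_def by (metis homogeneous_add mp_eval_simps(1))

lemma hom_fun_scale: "hom_fun d f \<Longrightarrow> hom_fun d (\<lambda>x. c * f x)"
  unfolding hom_fun_def by (metis homogeneous_Const_mult mp_eval_simps(2,3))

lemma hom_fun_uminus: "hom_fun d f \<Longrightarrow> hom_fun d (\<lambda>x. - f x :: 'a::comm_ring_1)"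
  using hom_fun_scale[of d f "-1"] by simp

lemma hom_fun_diff: "hom_fun d f \<Longrightarrow> hom_fun d g \<Longrightarrow> hom_fun d (\<lambda>x. f x - g x :: 'a::comm_ring_1)"
  using hom_fun_add[of d f "\<lambda>x. - g x"] hom_fun_uminus[of d g] by simp

lemma hom_fun_mult: "hom_fun d f \<Longrightarrow> hom_fun e g \<Longrightarrow> hom_fun (d + e) (\<lambda>x. f x * g x)"
  unfolding hom_fun_def by (metis homogeneous_mult mp_eval_simps(2))

text \<open>A homogeneous condition on Pluecker coordinates that holds on \<open>A\<close> holds on
  its closure. By homogeneity one basis of each net is enough to test it.\<close>

lemma not_specialization:
  assumes "hom_fun d P" "\<And>W. W \<in> A \<Longrightarrow> \<exists>b. is_basis b W \<and> P (pluecker b) = 0"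
    and "V \<in> B" "V \<in> nets" "is_basis b V" "P (pluecker b) \<noteq> 0"
  shows "\<not> specialization A B"
proof
  assume "specialization A B"
  then have V: "V \<in> zariski closure_of A" using assms(3) unfolding specialization_def by blast
  obtain F where F: "F \<in> homogeneous d" "\<And>x. P x = mp_eval x F" using assms(1) unfolding hom_fun_def by blast
  have "openin zariski (principal_open F)"
    unfolding zariski_def openin_topology_generated_by_iff
    by (rule generate_topology_on.Basis) (use F in blast)
  moreover have "V \<in> principal_open F" using assms(4-6) F(2) unfolding principal_open_def by auto
  ultimately obtain W where W: "W \<in> A" "W \<in> principal_open F" using V unfolding in_closure_of by blast
  then obtain b' where b': "is_basis b' W" "mp_eval (pluecker b') F \<noteq> 0" unfolding principal_open_def by blast
  obtain b'' where "is_basis b'' W" "mp_eval (pluecker b'') F = 0" using assms(2)[OF W(1)] F(2) by auto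
  then show False using mp_eval_pluecker_basis_change[of b'' W b' F d] b' F(1) by blast
qed

section \<open>Two invariants of nets\<close>

lemma rows_eta: "A = rows (A$1$1) (A$1$2) (A$1$3) (A$2$1) (A$2$2) (A$2$3) (A$3$1) (A$3$2) (A$3$3)"
  by (simp add: vec_eq_iff forall_3)

lemma rows_mult:
  "rows a b c d e f g h i ** rows a' b' c' d' e' f' g' h' i' = rows
     (a * a' + b * d' + c * g') (a * b' + b * e' + c * h') (a * c' + b * f' + c * i')
     (d * a' + e * d' + f * g') (d * b' + e * e' + f * h') (d * c' + e * f' + f * i')
     (g * a' + h * d' + i * g') (g * b' + h * e' + i * h') (g * c' + h * f' + i * (i' :: 'a::comm_semiring_1))"
  by (simp add: vec_eq_iff forall_3 matrix_matrix_mult_def sum_3)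

text \<open>Gaussian elimination. Only one shear is assumed, since the other elementary matrices are
  its conjugates under the two transpositions; every case saved here is a large polynomial identity
  saved in the invariance proofs.\<close>

lemma invertible_induct3 [consumes 1, case_names mult diag swap12 swap23 shear]:
  fixes A :: "'a::field^3^3"
  assumes inv: "invertible A"
    and mult: "\<And>A B. P A \<Longrightarrow> P B \<Longrightarrow> P (A ** B)"
    and diag: "\<And>a b c. a \<noteq> 0 \<Longrightarrow> b \<noteq> 0 \<Longrightarrow> c \<noteq> 0 \<Longrightarrow> P (rows a 0 0 0 b 0 0 0 c)"
    and swap12: "P (rows 0 1 0 1 0 0 0 0 1)" and swap23: "P (rows 1 0 0 0 0 1 0 1 0)"
    and shear: "\<And>s. P (rows 1 s 0 0 1 0 0 0 1)"
  shows "P A"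
proof -
  note r = rows_mult
  have e12: "P (rows 1 s 0 0 1 0 0 0 1)" for s by (rule shear)
  have e21: "P (rows 1 0 0 s 1 0 0 0 1)" for s
    using mult[OF mult[OF swap12 e12[of s]] swap12] by (simp add: r)
  have e13: "P (rows 1 0 s 0 1 0 0 0 1)" for s
    using mult[OF mult[OF swap23 e12[of s]] swap23] by (simp add: r)
  have e31: "P (rows 1 0 0 0 1 0 s 0 1)" for s
    using mult[OF mult[OF swap23 e21[of s]] swap23] by (simp add: r)
  have e23: "P (rows 1 0 0 0 1 s 0 0 1)" for s
    using mult[OF mult[OF swap12 e13[of s]] swap12] by (simp add: r)
  have e32: "P (rows 1 0 0 0 1 0 0 s 1)" for s
    using mult[OF mult[OF swap12 e31[of s]] swap12] by (simp add: r)
  have r21: "P (rows a b c d e f g h i)" if "P (rows a b c (d + s * a) (e + s * b) (f + s * c) g h i)"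
    for s a b c d e f g h i using mult[OF e21[of "-s"] that] by (simp add: r algebra_simps)
  have r31: "P (rows a b c d e f g h i)" if "P (rows a b c d e f (g + s * a) (h + s * b) (i + s * c))"
    for s a b c d e f g h i using mult[OF e31[of "-s"] that] by (simp add: r algebra_simps)
  have r12: "P (rows a b c d e f g h i)" if "P (rows (a + s * d) (b + s * e) (c + s * f) d e f g h i)"
    for s a b c d e f g h i using mult[OF e12[of "-s"] that] by (simp add: r algebra_simps)
  have r13: "P (rows a b c d e f g h i)" if "P (rows (a + s * g) (b + s * h) (c + s * i) d e f g h i)"
    for s a b c d e f g h i using mult[OF e13[of "-s"] that] by (simp add: r algebra_simps)
  have r23: "P (rows a b c d e f g h i)" if "P (rows a b c (d + s * g) (e + s * h) (f + s * i) g h i)"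
    for s a b c d e f g h i using mult[OF e23[of "-s"] that] by (simp add: r algebra_simps)
  have r32: "P (rows a b c d e f g h i)" if "P (rows a b c d e f (g + s * d) (h + s * e) (i + s * f))"
    for s a b c d e f g h i using mult[OF e32[of "-s"] that] by (simp add: r algebra_simps)
  \<comment> \<open>Elimination read backwards: \<open>s1\<close> treats upper triangular matrices,
    \<open>s2\<close> and \<open>s3\<close> a cleared first column, \<open>s4\<close> a nonzero
    corner, \<open>s5\<close> the general case. A zero pivot is repaired by adding a lower
    row.\<close>
  have s1: "P (rows a b c 0 e f 0 0 i)" if "a \<noteq> 0" "e \<noteq> 0" "i \<noteq> 0" for a b c e f i
  proof -
    have "P (rows a 0 0 0 e 0 0 0 i)" using diag that by blast
    then have "P (rows a b 0 0 e 0 0 0 i)" using that by - (rule r12[where s = "- b / e"], simp)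
    then have "P (rows a b 0 0 e f 0 0 i)" using that by - (rule r23[where s = "- f / i"], simp)
    then show ?thesis using that by - (rule r13[where s = "- c / i"], simp)
  qed
  have s2: "P (rows a b c 0 e f 0 h i)" if "a \<noteq> 0" "e \<noteq> 0" "e * i - f * h \<noteq> 0" for a b c e f h i
  proof -
    define p where "p = - h / e"
    have p: "h + p * e = 0" using that(2) by (simp add: p_def)
    then have h: "h = - p * e" by (simp add: eq_neg_iff_add_eq_0)
    have "e * (i + p * f) = e * i - f * h" unfolding h by (simp add: algebra_simps)
    then have "i + p * f \<noteq> 0" using that(3) by auto
    then have "P (rows a b c 0 e f (0 + p * 0) (h + p * e) (i + p * f))"
      using s1[OF that(1,2)] p by simp
    from r32[OF this] show ?thesis .
  qed
  have s3: "P (rows a b c 0 e f 0 h i)" if "a \<noteq> 0" "e * i - f * h \<noteq> 0" for a b c e f h i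
  \<comment> \<open>Adding the third row to the second turns the pivot 0 into \<open>h\<close>,
    which is nonzero because the 2x2 minor is.\<close>
  proof (cases "e = 0")
    case True
    then have "P (rows a b c 0 h (f + i) 0 h i)" using that by (intro s2) (auto simp: algebra_simps)
    then show ?thesis using True by - (rule r23[where s = 1], simp)
  qed (use that s2 in blast)
  have s4: "P (rows a b c d e f g h i)"
    if "a \<noteq> 0" "a * (e * i - f * h) - b * (d * i - f * g) + c * (d * h - e * g) \<noteq> 0" for a b c d e f g h i
  proof -
    define p q where "p = - d / a" and "q = - g / a"
    have p: "d + p * a = 0" and q: "g + q * a = 0" using that(1) by (simp_all add: p_def q_def)
    then have d: "d = - p * a" and g: "g = - q * a" by (simp_all add: eq_neg_iff_add_eq_0)
    have "a * ((e + p * b) * (i + q * c) - (f + p * c) * (h + q * b)) =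
        a * (e * i - f * h) - b * (d * i - f * g) + c * (d * h - e * g)"
      unfolding d g by (simp add: algebra_simps)
    then have "(e + p * b) * (i + q * c) - (f + p * c) * (h + q * b) \<noteq> 0" using that(2) by auto
    then have "P (rows a b c 0 (e + p * b) (f + p * c) 0 (h + q * b) (i + q * c))"
      using that(1) by (intro s3)
    then have "P (rows a b c (d + p * a) (e + p * b) (f + p * c) (g + q * a) (h + q * b) (i + q * c))"
      unfolding p q .
    from r21[OF r31[OF this]] show ?thesis .
  qed
  have s5: "P (rows a b c d e f g h i)"
    if dt: "a * (e * i - f * h) - b * (d * i - f * g) + c * (d * h - e * g) \<noteq> 0" for a b c d e f g h i
  proof -
    consider "a \<noteq> 0" | "a = 0" "d \<noteq> 0" | "a = 0" "g \<noteq> 0"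
      using dt by (cases "a = 0"; cases "d = 0"; cases "g = 0") simp_all
    then show ?thesis
    proof cases
      case 1
      then show ?thesis using dt by (rule s4)
    next
      case case2: 2
      have "P (rows (a + 1 * d) (b + 1 * e) (c + 1 * f) d e f g h i)"
        by (rule s4) (use case2 dt in \<open>simp_all add: algebra_simps\<close>)
      then show ?thesis by (rule r12)
    next
      case case3: 3
      have "P (rows (a + 1 * g) (b + 1 * h) (c + 1 * i) d e f g h i)"
        by (rule s4) (use case3 dt in \<open>simp_all add: algebra_simps\<close>)
      then show ?thesis by (rule r13)
    qed
  qed
  have "P (rows (A$1$1) (A$1$2) (A$1$3) (A$2$1) (A$2$2) (A$2$3) (A$3$1) (A$3$2) (A$3$3))"
  proof (rule s5)
    have "det A \<noteq> 0" using inv by (simp add: invertible_det_nz)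
    then show "A$1$1 * (A$2$2 * A$3$3 - A$2$3 * A$3$2) - A$1$2 * (A$2$1 * A$3$3 - A$2$3 * A$3$1) +
        A$1$3 * (A$2$1 * A$3$2 - A$2$2 * A$3$1) \<noteq> 0"
      by (simp add: det_3 algebra_simps)
  qed
  then show ?thesis using rows_eta[of A] by simp
qed

text \<open>
  The components of the Pluecker coordinates in \<open>Sym\<^sup>3 \<oplus> Sym\<^sup>3*\<close> are \<open>jac\<close>, the Jacobian cubic
  of the net (divided by 2), and \<open>con\<close>, the cubic of lines on which the net restricts to a dependent system.
  The invariant \<open>inv2\<close> is their apolar pairing, and \<open>inv4\<close> is the Aronhold invariant \<open>S\<close> of the
  Jacobian cubic (times 1296).
\<close>

definition bracket :: "((3 \<Rightarrow> (3 \<Rightarrow>\<^sub>0 nat)) \<Rightarrow> 'a) \<Rightarrow> (3 \<Rightarrow>\<^sub>0 nat) \<Rightarrow> (3 \<Rightarrow>\<^sub>0 nat) \<Rightarrow> (3 \<Rightarrow>\<^sub>0 nat) \<Rightarrow> 'a" where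
  "bracket w m n k = w (triple m n k)"

abbreviation "cA \<equiv> mon 2 0 0"
abbreviation "cB \<equiv> mon 0 2 0"
abbreviation "cC \<equiv> mon 0 0 2"
abbreviation "cD \<equiv> mon 0 (Suc 0) (Suc 0)"
abbreviation "cE \<equiv> mon (Suc 0) 0 (Suc 0)"
abbreviation "cF \<equiv> mon (Suc 0) (Suc 0) 0"

text \<open>The ten coefficients are listed in the order used by \<^const>\<open>cub\<close>.\<close>

definition jac :: "((3 \<Rightarrow> (3 \<Rightarrow>\<^sub>0 nat)) \<Rightarrow> 'a) \<Rightarrow> nat \<Rightarrow> 'a::comm_ring_1" where
  "jac w n = [- bracket w cA cE cF,
     bracket w cB cD cF,
     - bracket w cC cD cE,
     - bracket w cA cD cF + 2 * bracket w cA cB cE,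
     - 2 * bracket w cA cC cF + bracket w cA cD cE,
     2 * bracket w cA cB cD + bracket w cB cE cF,
     2 * bracket w cB cC cF + bracket w cB cD cE,
     - 2 * bracket w cA cC cD + bracket w cC cE cF,
     - bracket w cC cD cF + 2 * bracket w cB cC cE,
     4 * bracket w cA cB cC + bracket w cD cE cF] ! n"

definition con :: "((3 \<Rightarrow> (3 \<Rightarrow>\<^sub>0 nat)) \<Rightarrow> 'a) \<Rightarrow> nat \<Rightarrow> 'a::comm_ring_1" where
  "con w n = [- bracket w cB cC cD,
     bracket w cA cC cE,
     - bracket w cA cB cF,
     bracket w cB cC cE + bracket w cC cD cF,
     - bracket w cB cD cE + bracket w cB cC cF,
     - bracket w cA cC cD - bracket w cC cE cF,
     - bracket w cA cD cE - bracket w cA cC cF,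
     bracket w cA cB cD - bracket w cB cE cF,
     bracket w cA cB cE + bracket w cA cD cF,
     - 2 * bracket w cA cB cC + bracket w cD cE cF] ! n"

text \<open>The weights 6, 2, 1 are the products of the factorials of the exponents in X^3, X^2 Y
  and XYZ: one cubic acts on the other as a differential operator.\<close>

definition apolar :: "(nat \<Rightarrow> 'a) \<Rightarrow> (nat \<Rightarrow> 'a) \<Rightarrow> 'a::comm_ring_1" where
  "apolar F G = 6 * (F 0 * G 0 + F 1 * G 1 + F 2 * G 2) +
     2 * (F 3 * G 3 + F 4 * G 4 + F 5 * G 5 + F 6 * G 6 + F 7 * G 7 + F 8 * G 8) + F 9 * G 9"

text \<open>Salmon's formula for S, which refers to a cubic with the multinomial coefficients 3 and
  6 split off; 1296 = 6^4 clears the denominators.\<close>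

definition aronhold :: "(nat \<Rightarrow> 'a) \<Rightarrow> 'a::comm_ring_1" where
  "aronhold F = 216 * (F 0 * F 1 * F 2 * F 9)
     - 144 * (F 1 * F 2 * F 3 * F 4 + F 2 * F 0 * F 5 * F 6 + F 0 * F 1 * F 7 * F 8)
     - 24 * F 9 * (F 0 * F 6 * F 8 + F 1 * F 7 * F 4 + F 2 * F 3 * F 5)
     + 48 * (F 0 * F 5 * (F 8)\<^sup>2 + F 0 * F 7 * (F 6)\<^sup>2 + F 1 * F 3 * (F 7)\<^sup>2 + F 1 * F 8 * (F 4)\<^sup>2 + F 2 * F 6 * (F 3)\<^sup>2 + F 2 * F 4 * (F 5)\<^sup>2)
     - (F 9) ^ 4 + 8 * (F 9)\<^sup>2 * (F 5 * F 7 + F 8 * F 3 + F 4 * F 6)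
     - 24 * F 9 * (F 3 * F 6 * F 7 + F 4 * F 5 * F 8)
     - 16 * ((F 5)\<^sup>2 * (F 7)\<^sup>2 + (F 8)\<^sup>2 * (F 3)\<^sup>2 + (F 4)\<^sup>2 * (F 6)\<^sup>2)
     + 16 * (F 8 * F 3 * F 4 * F 6 + F 4 * F 6 * F 5 * F 7 + F 5 * F 7 * F 8 * F 3)"

definition inv2 :: "((3 \<Rightarrow> (3 \<Rightarrow>\<^sub>0 nat)) \<Rightarrow> 'a) \<Rightarrow> 'a::comm_ring_1" where
  "inv2 w = apolar (jac w) (con w)"

definition inv4 :: "((3 \<Rightarrow> (3 \<Rightarrow>\<^sub>0 nat)) \<Rightarrow> 'a) \<Rightarrow> 'a::comm_ring_1" where
  "inv4 w = aronhold (jac w)"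

lemma bracket_pluecker:
  "bracket (pluecker (triple p q r)) m n k =
     cf p m * (cf q n * cf r k - cf q k * cf r n) - cf p n * (cf q m * cf r k - cf q k * cf r m) +
     cf p k * (cf q m * cf r n - cf q n * cf (r :: 'a::field form) m)"
  by (simp add: bracket_def pluecker_def det_3 algebra_simps)

text \<open>
  The coefficients of the two cubics of a net and of its images under generators of \<open>GL(3)\<close>.
  The actions are twisted by the determinant, and the second cubic transforms contragrediently.
\<close>

definition cub_shear :: "'a \<Rightarrow> (nat \<Rightarrow> 'a) \<Rightarrow> (nat \<Rightarrow> 'a::comm_ring_1) \<Rightarrow> bool" where
  "cub_shear s F F' \<longleftrightarrow> F' 0 = F 0 \<and> F' 1 = F 1 + s * F 5 + s\<^sup>2 * F 3 + s ^ 3 * F 0 \<and> F' 2 = F 2 \<and>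
     F' 3 = F 3 + 3 * s * F 0 \<and> F' 4 = F 4 \<and> F' 5 = F 5 + 2 * s * F 3 + 3 * s\<^sup>2 * F 0 \<and>
     F' 6 = F 6 + s * F 9 + s\<^sup>2 * F 4 \<and> F' 7 = F 7 \<and> F' 8 = F 8 + s * F 7 \<and> F' 9 = F 9 + 2 * s * F 4"

definition dual_shear :: "'a \<Rightarrow> (nat \<Rightarrow> 'a) \<Rightarrow> (nat \<Rightarrow> 'a::comm_ring_1) \<Rightarrow> bool" where
  "dual_shear s G G' \<longleftrightarrow> G' 0 = G 0 - s * G 3 + s\<^sup>2 * G 5 - s ^ 3 * G 1 \<and> G' 1 = G 1 \<and> G' 2 = G 2 \<and>
     G' 3 = G 3 - 2 * s * G 5 + 3 * s\<^sup>2 * G 1 \<and> G' 4 = G 4 - s * G 9 + s\<^sup>2 * G 6 \<and>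
     G' 5 = G 5 - 3 * s * G 1 \<and> G' 6 = G 6 \<and> G' 7 = G 7 - s * G 8 \<and> G' 8 = G 8 \<and> G' 9 = G 9 - 2 * s * G 6"

definition cub_swap12 :: "(nat \<Rightarrow> 'a) \<Rightarrow> (nat \<Rightarrow> 'a::comm_ring_1) \<Rightarrow> bool" where
  "cub_swap12 F F' \<longleftrightarrow> F' 0 = - F 1 \<and> F' 1 = - F 0 \<and> F' 2 = - F 2 \<and> F' 3 = - F 5 \<and> F' 4 = - F 6 \<and>
     F' 5 = - F 3 \<and> F' 6 = - F 4 \<and> F' 7 = - F 8 \<and> F' 8 = - F 7 \<and> F' 9 = - F 9"

definition cub_swap23 :: "(nat \<Rightarrow> 'a) \<Rightarrow> (nat \<Rightarrow> 'a::comm_ring_1) \<Rightarrow> bool" where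
  "cub_swap23 F F' \<longleftrightarrow> F' 0 = - F 0 \<and> F' 1 = - F 2 \<and> F' 2 = - F 1 \<and> F' 3 = - F 4 \<and> F' 4 = - F 3 \<and>
     F' 5 = - F 7 \<and> F' 6 = - F 8 \<and> F' 7 = - F 5 \<and> F' 8 = - F 6 \<and> F' 9 = - F 9"

definition cub_diag :: "'a \<Rightarrow> 'a \<Rightarrow> 'a \<Rightarrow> (nat \<Rightarrow> 'a) \<Rightarrow> (nat \<Rightarrow> 'a::comm_ring_1) \<Rightarrow> bool" where
  "cub_diag p q r F F' \<longleftrightarrow> F' 0 = p ^ 4 * q * r * F 0 \<and> F' 1 = p * q ^ 4 * r * F 1 \<and> F' 2 = p * q * r ^ 4 * F 2 \<and>
     F' 3 = p ^ 3 * q\<^sup>2 * r * F 3 \<and> F' 4 = p ^ 3 * q * r\<^sup>2 * F 4 \<and> F' 5 = p\<^sup>2 * q ^ 3 * r * F 5 \<and>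
     F' 6 = p * q ^ 3 * r\<^sup>2 * F 6 \<and> F' 7 = p\<^sup>2 * q * r ^ 3 * F 7 \<and> F' 8 = p * q\<^sup>2 * r ^ 3 * F 8 \<and>
     F' 9 = p\<^sup>2 * q\<^sup>2 * r\<^sup>2 * F 9"

definition dual_diag :: "'a \<Rightarrow> 'a \<Rightarrow> 'a \<Rightarrow> (nat \<Rightarrow> 'a) \<Rightarrow> (nat \<Rightarrow> 'a::comm_ring_1) \<Rightarrow> bool" where
  "dual_diag p q r G G' \<longleftrightarrow> G' 0 = q ^ 3 * r ^ 3 * G 0 \<and> G' 1 = p ^ 3 * r ^ 3 * G 1 \<and> G' 2 = p ^ 3 * q ^ 3 * G 2 \<and>
     G' 3 = p * q\<^sup>2 * r ^ 3 * G 3 \<and> G' 4 = p * q ^ 3 * r\<^sup>2 * G 4 \<and> G' 5 = p\<^sup>2 * q * r ^ 3 * G 5 \<and>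
     G' 6 = p ^ 3 * q * r\<^sup>2 * G 6 \<and> G' 7 = p\<^sup>2 * q ^ 3 * r * G 7 \<and> G' 8 = p ^ 3 * q\<^sup>2 * r * G 8 \<and>
     G' 9 = p\<^sup>2 * q\<^sup>2 * r\<^sup>2 * G 9"

abbreviation net_coords :: "'a^3^3 \<Rightarrow> 'a form \<Rightarrow> 'a form \<Rightarrow> 'a form \<Rightarrow> (3 \<Rightarrow> (3 \<Rightarrow>\<^sub>0 nat)) \<Rightarrow> 'a::field" where
  "net_coords A p q r \<equiv> pluecker (triple (lin_subst A p) (lin_subst A q) (lin_subst A r))"

lemmas inv_expand = bracket_pluecker algebra_simps power2_eq_square power3_eq_cube power4_eq_xxxx

lemma shear_lin_subst:
  fixes p q r :: "'a::field form"
  assumes "p \<in> R 2" "q \<in> R 2" "r \<in> R 2"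
  shows "cub_shear s (jac (pluecker (triple p q r))) (jac (net_coords (rows 1 s 0 0 1 0 0 0 1) p q r))"
    and "dual_shear s (con (pluecker (triple p q r))) (con (net_coords (rows 1 s 0 0 1 0 0 0 1) p q r))"
proof -
  have l: "lin_subst (rows 1 s 0 0 1 0 0 0 1) (qf u v w x y z) =
      qf u (v + s\<^sup>2 * u + s * z) w (x + s * y) y (z + 2 * s * u)" for u v w x y z :: 'a
    by (simp add: lin_subst_qf algebra_simps)
  show "cub_shear s (jac (pluecker (triple p q r))) (jac (net_coords (rows 1 s 0 0 1 0 0 0 1) p q r))"
    using assms by (elim R2_qf, unfold cub_shear_def, intro conjI; simp add: l jac_def inv_expand)
  show "dual_shear s (con (pluecker (triple p q r))) (con (net_coords (rows 1 s 0 0 1 0 0 0 1) p q r))"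
    using assms by (elim R2_qf, unfold dual_shear_def, intro conjI; simp add: l con_def inv_expand)
qed

lemma swap12_lin_subst:
  fixes p q r :: "'a::field form"
  assumes "p \<in> R 2" "q \<in> R 2" "r \<in> R 2"
  shows "cub_swap12 (jac (pluecker (triple p q r))) (jac (net_coords (rows 0 1 0 1 0 0 0 0 1) p q r))"
    and "cub_swap12 (con (pluecker (triple p q r))) (con (net_coords (rows 0 1 0 1 0 0 0 0 1) p q r))"
proof -
  have l: "lin_subst (rows 0 1 0 1 0 0 0 0 1) (qf u v w x y z) = qf v u w y x z" for u v w x y z :: 'a
    by (simp add: lin_subst_qf)
  show "cub_swap12 (jac (pluecker (triple p q r))) (jac (net_coords (rows 0 1 0 1 0 0 0 0 1) p q r))"
    using assms by (elim R2_qf, unfold cub_swap12_def, intro conjI; simp add: l jac_def inv_expand)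
  show "cub_swap12 (con (pluecker (triple p q r))) (con (net_coords (rows 0 1 0 1 0 0 0 0 1) p q r))"
    using assms by (elim R2_qf, unfold cub_swap12_def, intro conjI; simp add: l con_def inv_expand)
qed

lemma swap23_lin_subst:
  fixes p q r :: "'a::field form"
  assumes "p \<in> R 2" "q \<in> R 2" "r \<in> R 2"
  shows "cub_swap23 (jac (pluecker (triple p q r))) (jac (net_coords (rows 1 0 0 0 0 1 0 1 0) p q r))"
    and "cub_swap23 (con (pluecker (triple p q r))) (con (net_coords (rows 1 0 0 0 0 1 0 1 0) p q r))"
proof -
  have l: "lin_subst (rows 1 0 0 0 0 1 0 1 0) (qf u v w x y z) = qf u w v x z y" for u v w x y z :: 'a
    by (simp add: lin_subst_qf)
  show "cub_swap23 (jac (pluecker (triple p q r))) (jac (net_coords (rows 1 0 0 0 0 1 0 1 0) p q r))"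
    using assms by (elim R2_qf, unfold cub_swap23_def, intro conjI; simp add: l jac_def inv_expand)
  show "cub_swap23 (con (pluecker (triple p q r))) (con (net_coords (rows 1 0 0 0 0 1 0 1 0) p q r))"
    using assms by (elim R2_qf, unfold cub_swap23_def, intro conjI; simp add: l con_def inv_expand)
qed

lemma diag_lin_subst:
  fixes p q r :: "'a::field form"
  assumes "p \<in> R 2" "q \<in> R 2" "r \<in> R 2"
  shows "cub_diag a b c (jac (pluecker (triple p q r))) (jac (net_coords (rows a 0 0 0 b 0 0 0 c) p q r))"
    and "dual_diag a b c (con (pluecker (triple p q r))) (con (net_coords (rows a 0 0 0 b 0 0 0 c) p q r))"
proof -
  have l: "lin_subst (rows a 0 0 0 b 0 0 0 c) (qf u v w x y z) =
      qf (a\<^sup>2 * u) (b\<^sup>2 * v) (c\<^sup>2 * w) (b * c * x) (a * c * y) (a * b * z)" for u v w x y z :: 'a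
    by (simp add: lin_subst_qf algebra_simps)
  show "cub_diag a b c (jac (pluecker (triple p q r))) (jac (net_coords (rows a 0 0 0 b 0 0 0 c) p q r))"
    using assms by (elim R2_qf, unfold cub_diag_def, intro conjI; simp add: l jac_def inv_expand)
  show "dual_diag a b c (con (pluecker (triple p q r))) (con (net_coords (rows a 0 0 0 b 0 0 0 c) p q r))"
    using assms by (elim R2_qf, unfold dual_diag_def, intro conjI; simp add: l con_def inv_expand)
qed

lemma aronhold_substs:
  fixes F F' :: "nat \<Rightarrow> 'a::field"
  shows "cub_shear s F F' \<Longrightarrow> aronhold F' = aronhold F" "cub_swap12 F F' \<Longrightarrow> aronhold F' = aronhold F"
    "cub_swap23 F F' \<Longrightarrow> aronhold F' = aronhold F" "cub_diag p q r F F' \<Longrightarrow> aronhold F' = (p * q * r) ^ 8 * aronhold F"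
proof -
  assume "cub_shear s F F'"
  note * = this[unfolded cub_shear_def]
  show "aronhold F' = aronhold F" by (simp only: aronhold_def *) algebra
next
  assume "cub_swap12 F F'"
  note * = this[unfolded cub_swap12_def]
  show "aronhold F' = aronhold F" by (simp only: aronhold_def *) algebra
next
  assume "cub_swap23 F F'"
  note * = this[unfolded cub_swap23_def]
  show "aronhold F' = aronhold F" by (simp only: aronhold_def *) algebra
next
  assume "cub_diag p q r F F'"
  note * = this[unfolded cub_diag_def]
  show "aronhold F' = (p * q * r) ^ 8 * aronhold F" by (simp only: aronhold_def *) algebra
qed

lemma apolar_substs:
  fixes F F' G G' :: "nat \<Rightarrow> 'a::field"
  shows "cub_shear s F F' \<Longrightarrow> dual_shear s G G' \<Longrightarrow> apolar F' G' = apolar F G"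
    "cub_swap12 F F' \<Longrightarrow> cub_swap12 G G' \<Longrightarrow> apolar F' G' = apolar F G"
    "cub_swap23 F F' \<Longrightarrow> cub_swap23 G G' \<Longrightarrow> apolar F' G' = apolar F G"
    "cub_diag p q r F F' \<Longrightarrow> dual_diag p q r G G' \<Longrightarrow> apolar F' G' = (p * q * r) ^ 4 * apolar F G"
proof -
  assume "cub_shear s F F'" "dual_shear s G G'"
  note * = this[unfolded cub_shear_def dual_shear_def]
  show "apolar F' G' = apolar F G" by (simp only: apolar_def *) algebra
next
  assume "cub_swap12 F F'" "cub_swap12 G G'"
  note * = this[unfolded cub_swap12_def]
  show "apolar F' G' = apolar F G" by (simp only: apolar_def *) algebra
next
  assume "cub_swap23 F F'" "cub_swap23 G G'"
  note * = this[unfolded cub_swap23_def]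
  show "apolar F' G' = apolar F G" by (simp only: apolar_def *) algebra
next
  assume "cub_diag p q r F F'" "dual_diag p q r G G'"
  note * = this[unfolded cub_diag_def dual_diag_def]
  show "apolar F' G' = (p * q * r) ^ 4 * apolar F G" by (simp only: apolar_def *) algebra
qed

text \<open>Origin of the exponents: \<open>jac\<close> is twisted by det, and S has degree 4 and
  weight 4, which gives 4 + 4 = 8; \<open>con\<close> is twisted by det^3, which gives 1 + 3 = 4 for
  the pairing.\<close>

lemma inv_lin_subst:
  fixes p q r :: "'a::field form"
  assumes "invertible A" "p \<in> R 2" "q \<in> R 2" "r \<in> R 2"
  shows "inv2 (net_coords A p q r) = det A ^ 4 * inv2 (pluecker (triple p q r)) \<and>
    inv4 (net_coords A p q r) = det A ^ 8 * inv4 (pluecker (triple p q r))"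
  using assms
proof (induction A arbitrary: p q r rule: invertible_induct3)
  case (mult A B)
  then show ?case
    using lin_subst_homogeneous[of _ 2 A]
    by (simp add: det_mul power_mult_distrib flip: lin_subst_lin_subst)
next
  case (diag a b c)
  note * = diag_lin_subst[OF diag.prems, of a b c]
  show ?case by (simp add: inv2_def inv4_def apolar_substs(4)[OF *] aronhold_substs(4)[OF *(1)] det_rows mult.assoc)
next
  case swap12
  note * = swap12_lin_subst[OF swap12.prems]
  show ?case by (simp add: inv2_def inv4_def apolar_substs(2)[OF *] aronhold_substs(2)[OF *(1)] det_rows)
next
  case swap23
  note * = swap23_lin_subst[OF swap23.prems]
  show ?case by (simp add: inv2_def inv4_def apolar_substs(3)[OF *] aronhold_substs(3)[OF *(1)] det_rows)
next
  case (shear s)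
  note * = shear_lin_subst[OF shear.prems, of s]
  show ?case by (simp add: inv2_def inv4_def apolar_substs(1)[OF *] aronhold_substs(1)[OF *(1)] det_rows)
qed

text \<open>Comparing \<open>kinv c\<close> for all \<open>c\<close> compares \<open>inv4\<close>
  and the square of \<open>inv2\<close> up to one common factor, without dividing by either. Both
  terms have degree 4 and weight 8.\<close>

definition kinv :: "'a \<Rightarrow> ((3 \<Rightarrow> (3 \<Rightarrow>\<^sub>0 nat)) \<Rightarrow> 'a) \<Rightarrow> 'a::comm_ring_1" where
  "kinv c w = inv4 w + c * (inv2 w)\<^sup>2"

lemma basis_of_orbit:
  assumes "indep3 p q r" "W \<in> orbit (mp.span {p, q, r})"
  obtains A where "invertible A" "is_basis (triple (lin_subst A p) (lin_subst A q) (lin_subst A r)) W"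
proof -
  obtain A where A: "invertible A" "W = lin_subst A ` mp.span {p, q, r}"
    using assms(2) by (auto simp: orbit_def)
  have "W = mp.span {lin_subst A p, lin_subst A q, lin_subst A r}"
    unfolding A(2) lin_subst_span image_insert image_empty ..
  with lin_subst_indep3[OF A(1) assms(1)]
  have "is_basis (triple (lin_subst A p) (lin_subst A q) (lin_subst A r)) W"
    unfolding is_basis_iff triple_simps by blast
  with A(1) that show thesis by blast
qed

lemma kinv_orbit:
  assumes "indep3 p q r" "p \<in> R 2" "q \<in> R 2" "r \<in> R 2" "W \<in> orbit (mp.span {p, q, r})"
  obtains b d where "d \<noteq> 0" "is_basis b W" "\<And>c. kinv c (pluecker b) = d ^ 8 * kinv c (pluecker (triple p q r))"
proof -
  obtain A where A: "invertible A" "is_basis (triple (lin_subst A p) (lin_subst A q) (lin_subst A r)) W"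
    using basis_of_orbit[OF assms(1,5)] .
  have "kinv c (pluecker (triple (lin_subst A p) (lin_subst A q) (lin_subst A r))) =
      det A ^ 8 * kinv c (pluecker (triple p q r))" for c
    unfolding kinv_def using inv_lin_subst[OF A(1) assms(2-4)]
    by (simp add: power_mult_distrib algebra_simps flip: power_mult)
  then show thesis using that[of "det A"] A by (simp add: invertible_det_nz)
qed

lemma hom_fun_bracket: "hom_fun (Suc 0) (\<lambda>w. bracket w m n k)"
  unfolding bracket_def using hom_fun_coord by simp

lemma hom_fun_jac:
  assumes "n < 10"
  shows "hom_fun (Suc 0) (\<lambda>w. jac w n)"
proof -
  have "n = 0 \<or> n = 1 \<or> n = 2 \<or> n = 3 \<or> n = 4 \<or> n = 5 \<or> n = 6 \<or> n = 7 \<or> n = 8 \<or> n = 9"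
    using assms by arith
  then show ?thesis
    unfolding jac_def
    by (elim disjE; simp)
      (intro hom_fun_add hom_fun_diff hom_fun_uminus hom_fun_scale hom_fun_bracket)+
qed

lemma hom_fun_con:
  assumes "n < 10"
  shows "hom_fun (Suc 0) (\<lambda>w. con w n)"
proof -
  have "n = 0 \<or> n = 1 \<or> n = 2 \<or> n = 3 \<or> n = 4 \<or> n = 5 \<or> n = 6 \<or> n = 7 \<or> n = 8 \<or> n = 9"
    using assms by arith
  then show ?thesis
    unfolding con_def
    by (elim disjE; simp)
      (intro hom_fun_add hom_fun_diff hom_fun_uminus hom_fun_scale hom_fun_bracket)+
qed

lemma hom_fun_mult': "hom_fun d f \<Longrightarrow> hom_fun e g \<Longrightarrow> n = d + e \<Longrightarrow> hom_fun n (\<lambda>x. f x * g x)"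
  using hom_fun_mult by blast

lemma hom_fun_inv2: "hom_fun 2 inv2"
proof -
  have j: "n < 10 \<Longrightarrow> hom_fun (Suc 0) (\<lambda>w. jac w n)" and c: "n < 10 \<Longrightarrow> hom_fun (Suc 0) (\<lambda>w. con w n)" for n
    by (rule hom_fun_jac, assumption) (rule hom_fun_con, assumption)
  have jc: "n < 10 \<Longrightarrow> hom_fun 2 (\<lambda>w. jac w n * con w n)" for n
    by (rule hom_fun_mult'[OF j c]) simp_all
  show ?thesis
    unfolding inv2_def[abs_def] apolar_def
    by (intro hom_fun_add hom_fun_scale jc) simp_all
qed

lemma hom_fun_inv4: "hom_fun 4 inv4"
proof -
  have j: "n < 10 \<Longrightarrow> hom_fun (Suc 0) (\<lambda>w. jac w n)" for n by (rule hom_fun_jac)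
  have j2: "n < 10 \<Longrightarrow> m < 10 \<Longrightarrow> hom_fun 2 (\<lambda>w. jac w n * jac w m)" for n m
    by (rule hom_fun_mult'[OF j j]) simp_all
  have j3: "n < 10 \<Longrightarrow> m < 10 \<Longrightarrow> k < 10 \<Longrightarrow> hom_fun 3 (\<lambda>w. jac w n * jac w m * jac w k)" for n m k
    by (rule hom_fun_mult'[OF j2 j]) simp_all
  have j4: "n < 10 \<Longrightarrow> m < 10 \<Longrightarrow> k < 10 \<Longrightarrow> l < 10 \<Longrightarrow> hom_fun 4 (\<lambda>w. jac w n * jac w m * jac w k * jac w l)" for n m k l
    by (rule hom_fun_mult'[OF j3 j]) simp_all
  show ?thesis
    unfolding inv4_def[abs_def] aronhold_def power2_eq_square power4_eq_xxxx distrib_left distrib_right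
      right_diff_distrib left_diff_distrib mult.assoc[symmetric]
    by (intro hom_fun_add hom_fun_diff hom_fun_uminus)
      (rule j4 hom_fun_scale[OF j4, unfolded mult.assoc[symmetric]]; simp)+
qed

lemma hom_fun_kinv: "hom_fun 4 (kinv c)"
  unfolding kinv_def[abs_def] power2_eq_square
  by (intro hom_fun_add hom_fun_inv4 hom_fun_scale hom_fun_mult'[OF hom_fun_inv2 hom_fun_inv2]) simp

text \<open>The derivative of the cubic with coefficients \<open>F\<close> in some direction \<open>u\<close> vanishes.\<close>

definition cone :: "(nat \<Rightarrow> 'a::field) \<Rightarrow> bool" where
  "cone F \<longleftrightarrow> (\<exists>u1 u2 u3. (u1 \<noteq> 0 \<or> u2 \<noteq> 0 \<or> u3 \<noteq> 0) \<and>
     3 * F 0 * u1 + F 3 * u2 + F 4 * u3 = 0 \<and> F 5 * u1 + 3 * F 1 * u2 + F 6 * u3 = 0 \<and>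
     F 7 * u1 + F 8 * u2 + 3 * F 2 * u3 = 0 \<and> F 9 * u1 + 2 * F 6 * u2 + 2 * F 8 * u3 = 0 \<and>
     2 * F 4 * u1 + F 9 * u2 + 2 * F 7 * u3 = 0 \<and> 2 * F 3 * u1 + 2 * F 5 * u2 + F 9 * u3 = 0)"

lemma coneI:
  assumes "u1 \<noteq> 0 \<or> u2 \<noteq> 0 \<or> u3 \<noteq> 0"
    "3 * F 0 * u1 + F 3 * u2 + F 4 * u3 = 0" "F 5 * u1 + 3 * F 1 * u2 + F 6 * u3 = 0"
    "F 7 * u1 + F 8 * u2 + 3 * F 2 * u3 = 0" "F 9 * u1 + 2 * F 6 * u2 + 2 * F 8 * u3 = 0"
    "2 * F 4 * u1 + F 9 * u2 + 2 * F 7 * u3 = 0" "2 * F 3 * u1 + 2 * F 5 * u2 + F 9 * u3 = 0"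
  shows "cone F"
  unfolding cone_def using assms by blast

text \<open>The determinant of the Hessian matrix at the point \<open>(0, 0, 1)\<close>.\<close>

definition hess :: "(nat \<Rightarrow> 'a) \<Rightarrow> 'a::comm_ring_1" where
  "hess F = 2 * F 4 * (12 * F 6 * F 2 - 4 * (F 8)\<^sup>2) - F 9 * (6 * F 9 * F 2 - 4 * F 8 * F 7) +
     2 * F 7 * (2 * F 9 * F 8 - 4 * F 6 * F 7)"

text \<open>Three of the equations say that \<open>u\<close> lies in the kernel of the Hessian
  matrix at (0, 0, 1), so by Cramer's rule the determinant annihilates each \<open>u\<close>
  coordinate.\<close>

lemma cone_imp_hess:
  assumes "cone F"
  shows "hess F = 0"
proof -
  obtain u1 u2 u3 where u: "u1 \<noteq> 0 \<or> u2 \<noteq> 0 \<or> u3 \<noteq> 0"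
    and e: "F 7 * u1 + F 8 * u2 + 3 * F 2 * u3 = 0" "F 9 * u1 + 2 * F 6 * u2 + 2 * F 8 * u3 = 0"
      "2 * F 4 * u1 + F 9 * u2 + 2 * F 7 * u3 = 0"
    using assms unfolding cone_def by blast
  have "u1 * hess F = 0" "u2 * hess F = 0" "u3 * hess F = 0"
    unfolding hess_def using e by algebra+
  then show ?thesis using u by auto
qed

lemma cone_substs:
  fixes F F' :: "nat \<Rightarrow> 'a::field"
  assumes "cone F"
  shows "cub_shear s F F' \<Longrightarrow> cone F'" "cub_swap12 F F' \<Longrightarrow> cone F'" "cub_swap23 F F' \<Longrightarrow> cone F'"
    "p \<noteq> 0 \<Longrightarrow> q \<noteq> 0 \<Longrightarrow> r \<noteq> 0 \<Longrightarrow> cub_diag p q r F F' \<Longrightarrow> cone F'"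
proof -
  obtain u1 u2 u3 where u: "u1 \<noteq> 0 \<or> u2 \<noteq> 0 \<or> u3 \<noteq> 0"
    and e: "3 * F 0 * u1 + F 3 * u2 + F 4 * u3 = 0" "F 5 * u1 + 3 * F 1 * u2 + F 6 * u3 = 0"
     "F 7 * u1 + F 8 * u2 + 3 * F 2 * u3 = 0" "F 9 * u1 + 2 * F 6 * u2 + 2 * F 8 * u3 = 0"
     "2 * F 4 * u1 + F 9 * u2 + 2 * F 7 * u3 = 0" "2 * F 3 * u1 + 2 * F 5 * u2 + F 9 * u3 = 0"
    using assms unfolding cone_def by blast
  {
    assume "cub_shear s F F'"
    note * = this[unfolded cub_shear_def]
    \<comment> \<open>In each case the witness is \<open>u\<close> moved by the inverse
      substitution; for diagonal matrices it is multiplied by p q r to clear denominators.\<close>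
    have "u1 - s * u2 \<noteq> 0 \<or> u2 \<noteq> 0 \<or> u3 \<noteq> 0" using u by auto
    then show "cone F'" by (rule coneI; simp only: *; use e in algebra)
  next
    assume "cub_swap12 F F'"
    note * = this[unfolded cub_swap12_def]
    have "u2 \<noteq> 0 \<or> u1 \<noteq> 0 \<or> u3 \<noteq> 0" using u by auto
    then show "cone F'" by (rule coneI; simp only: *; use e in algebra)
  next
    assume "cub_swap23 F F'"
    note * = this[unfolded cub_swap23_def]
    have "u1 \<noteq> 0 \<or> u3 \<noteq> 0 \<or> u2 \<noteq> 0" using u by auto
    then show "cone F'" by (rule coneI; simp only: *; use e in algebra)
  next
    assume pqr: "p \<noteq> 0" "q \<noteq> 0" "r \<noteq> 0" and "cub_diag p q r F F'"
    note * = this(4)[unfolded cub_diag_def]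
    have "u1 * (q * r) \<noteq> 0 \<or> u2 * (p * r) \<noteq> 0 \<or> u3 * (p * q) \<noteq> 0" using u pqr by auto
    then show "cone F'" by (rule coneI; simp only: *; use e in algebra)
  }
qed

lemma cone_lin_subst:
  fixes p q r :: "'a::field form"
  assumes "invertible A" "p \<in> R 2" "q \<in> R 2" "r \<in> R 2" "cone (jac (pluecker (triple p q r)))"
  shows "cone (jac (net_coords A p q r))"
  using assms
proof (induction A arbitrary: p q r rule: invertible_induct3)
  case (mult A B)
  then show ?case
    using lin_subst_homogeneous[of _ 2 A] by (simp flip: lin_subst_lin_subst)
next
  case (diag a b c)
  show ?case by (rule cone_substs(4)[OF diag.prems(4) diag.hyps diag_lin_subst(1)[OF diag.prems(1-3)]])
next
  case swap12
  show ?case by (rule cone_substs(2)[OF swap12.prems(4) swap12_lin_subst(1)[OF swap12.prems(1-3)]])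
next
  case swap23
  show ?case by (rule cone_substs(3)[OF swap23.prems(4) swap23_lin_subst(1)[OF swap23.prems(1-3)]])
next
  case (shear s)
  show ?case by (rule cone_substs(1)[OF shear.prems(4) shear_lin_subst(1)[OF shear.prems(1-3)]])
qed

lemma hom_fun_hess: "hom_fun 3 (\<lambda>w. hess (jac w))"
proof -
  have j: "n < 10 \<Longrightarrow> hom_fun (Suc 0) (\<lambda>w. jac w n)" for n by (rule hom_fun_jac)
  have j2: "n < 10 \<Longrightarrow> m < 10 \<Longrightarrow> hom_fun 2 (\<lambda>w. jac w n * jac w m)" for n m
    by (rule hom_fun_mult'[OF j j]) simp_all
  have j3: "n < 10 \<Longrightarrow> m < 10 \<Longrightarrow> k < 10 \<Longrightarrow> hom_fun 3 (\<lambda>w. jac w n * jac w m * jac w k)" for n m k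
    by (rule hom_fun_mult'[OF j2 j]) simp_all
  have eq: "hess F = 24 * (F 4 * F 6 * F 2) + (-8) * (F 4 * F 8 * F 8) + (-6) * (F 9 * F 9 * F 2) +
      8 * (F 9 * F 8 * F 7) + (-8) * (F 6 * F 7 * F 7)" for F :: "nat \<Rightarrow> 'a"
    by (simp add: hess_def algebra_simps power2_eq_square)
  show ?thesis unfolding eq by (intro hom_fun_add hom_fun_scale j3) simp_all
qed

text \<open>Being a cone is invariant under GL(3), although \<open>hess\<close> looks at one fixed
  point only. So \<open>hess\<close> vanishes on the whole orbit of a cone, and this cubic condition
  passes to the closure.\<close>

lemma not_specialization_cone:
  assumes "indep3 p q r" "p \<in> R 2" "q \<in> R 2" "r \<in> R 2" "cone (jac (pluecker (triple p q r)))"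
    and "indep3 p' q' r'" "p' \<in> R 2" "q' \<in> R 2" "r' \<in> R 2" "hess (jac (pluecker (triple p' q' r'))) \<noteq> 0"
  shows "\<not> specialization (orbit (mp.span {p, q, r})) (orbit (mp.span {p', q', r'}))"
proof (rule not_specialization[OF hom_fun_hess])
  show "\<exists>b. is_basis b W \<and> hess (jac (pluecker b)) = 0" if W: "W \<in> orbit (mp.span {p, q, r})" for W
  proof -
    obtain A where "invertible A" "is_basis (triple (lin_subst A p) (lin_subst A q) (lin_subst A r)) W"
      using basis_of_orbit[OF assms(1) W] .
    then show ?thesis using cone_imp_hess[OF cone_lin_subst[OF _ assms(2-5)]] by blast
  qed
  show "mp.span {p', q', r'} \<in> nets" by (rule span3_nets[OF assms(6-9)])
  show "is_basis (triple p' q' r') (mp.span {p', q', r'})" by (rule is_basis_triple[OF assms(6)])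
  show "hess (jac (pluecker (triple p' q' r'))) \<noteq> 0" by fact
qed (rule orbit_refl)

text \<open>The order is #8a, #7a, #6a (j = infinity), #8c, #7c, #6d (j = 0), then #7b and the
  orbits below it; \<open>indep3_named\<close> and \<open>kinv_net_named\<close> follow the same
  order.\<close>

lemma kinv_named:
  fixes c :: "'a::field_char_0"
  shows
    "kinv c (pluecker (triple (qf 0 0 0 0 0 1) (qf 1 0 0 1 0 0) (qf 0 1 0 0 1 0))) = c - 1"
    "kinv c (pluecker (triple (qf 1 0 0 1 0 0) (qf 0 0 0 0 0 1) (qf 0 0 0 0 1 0))) = c - 1"
    "kinv c (pluecker (triple (qf 0 0 0 0 0 1) (qf 0 0 0 1 0 0) (qf 0 0 0 0 1 0))) = c - 1"
    "kinv c (pluecker (triple (qf 0 0 1 0 0 0) (qf 1 0 0 (-1) 0 0) (qf 0 1 0 0 (-1) 0))) = 64 * c - 256"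
    "kinv c (pluecker (triple (qf 1 0 0 1 0 0) (qf 0 1 0 0 0 0) (qf 0 0 1 0 0 0))) = 64 * c - 256"
    "kinv c (pluecker (triple (qf 1 0 0 0 0 0) (qf 0 1 0 0 0 0) (qf 0 0 1 0 0 0))) = 64 * c - 256"
    "kinv c (pluecker (triple (qf 1 0 0 1 0 0) (qf 0 0 0 0 0 1) (qf 0 0 1 0 0 0))) = 0"
    "kinv c (pluecker (triple (qf 1 0 0 0 0 0) (qf 0 0 1 1 0 0) (qf 0 0 0 0 0 1))) = 0"
    "kinv c (pluecker (triple (qf 0 0 0 0 1 0) (qf 1 0 1 0 0 0) (qf 0 0 0 1 0 0))) = 0"
    "kinv c (pluecker (triple (qf 0 0 0 0 0 1) (qf 0 0 0 0 1 0) (qf 0 0 1 0 0 0))) = 0"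
    "kinv c (pluecker (triple (qf 0 1 0 0 0 0) (qf 0 0 1 0 0 0) (qf 0 0 0 0 0 1))) = 0"
    "kinv c (pluecker (triple (qf 1 0 0 1 0 0) (qf 0 0 0 0 0 1) (qf 0 1 0 0 0 0))) = 0"
    "kinv c (pluecker (triple (qf 1 0 0 0 0 0) (qf 0 0 0 0 0 1) (qf 0 0 0 0 1 0))) = 0"
    "kinv c (pluecker (triple (qf 1 0 0 0 0 0) (qf 0 1 0 0 0 0) (qf 1 1 0 0 0 2))) = 0"
  by (simp_all add: kinv_def inv2_def inv4_def apolar_def aronhold_def jac_def con_def bracket_pluecker algebra_simps power2_eq_square power4_eq_xxxx)

lemma indep3_named:
  shows
    "indep3 (qf (0 :: 'a::field_char_0) 0 0 0 0 1) (qf (1 :: 'a::field_char_0) 0 0 1 0 0) (qf 0 1 0 0 1 0)"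
    "indep3 (qf (1 :: 'a::field_char_0) 0 0 1 0 0) (qf (0 :: 'a::field_char_0) 0 0 0 0 1) (qf 0 0 0 0 1 0)"
    "indep3 (qf (0 :: 'a::field_char_0) 0 0 0 0 1) (qf 0 0 0 1 0 0) (qf 0 0 0 0 1 0)"
    "indep3 (qf (0 :: 'a::field_char_0) 0 1 0 0 0) (qf (1 :: 'a::field_char_0) 0 0 (-1) 0 0) (qf 0 1 0 0 (-1) 0)"
    "indep3 (qf (1 :: 'a::field_char_0) 0 0 1 0 0) (qf (0 :: 'a::field_char_0) 1 0 0 0 0) (qf 0 0 1 0 0 0)"
    "indep3 (qf (1 :: 'a::field_char_0) 0 0 0 0 0) (qf (0 :: 'a::field_char_0) 1 0 0 0 0) (qf 0 0 1 0 0 0)"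
    "indep3 (qf (1 :: 'a::field_char_0) 0 0 1 0 0) (qf (0 :: 'a::field_char_0) 0 0 0 0 1) (qf 0 0 1 0 0 0)"
    "indep3 (qf (1 :: 'a::field_char_0) 0 0 0 0 0) (qf (0 :: 'a::field_char_0) 0 1 1 0 0) (qf 0 0 0 0 0 1)"
    "indep3 (qf (0 :: 'a::field_char_0) 0 0 0 1 0) (qf (1 :: 'a::field_char_0) 0 1 0 0 0) (qf 0 0 0 1 0 0)"
    "indep3 (qf (0 :: 'a::field_char_0) 0 0 0 0 1) (qf 0 0 0 0 1 0) (qf 0 0 1 0 0 0)"
    "indep3 (qf (0 :: 'a::field_char_0) 1 0 0 0 0) (qf 0 0 1 0 0 0) (qf 0 0 0 0 0 1)"
    "indep3 (qf (1 :: 'a::field_char_0) 0 0 1 0 0) (qf (0 :: 'a::field_char_0) 0 0 0 0 1) (qf 0 1 0 0 0 0)"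
    "indep3 (qf (1 :: 'a::field_char_0) 0 0 0 0 0) (qf (0 :: 'a::field_char_0) 0 0 0 0 1) (qf 0 0 0 0 1 0)"
    "indep3 (qf (1 :: 'a::field_char_0) 0 0 0 0 0) (qf (0 :: 'a::field_char_0) 1 0 0 0 0) (qf 1 1 0 0 0 2)"
  by (auto intro!: indep3_qf)

section \<open>Degenerations\<close>

text \<open>The form in which explicit substitutions are supplied. In the instances the first nine
  entries are the matrix; the next ones, leaving out the underscores for \<open>u\<close>,
  \<open>v\<close>, \<open>w\<close>, are the coordinates of the three images in the basis
  \<open>u\<close>, \<open>v\<close>, \<open>w\<close>.\<close>

lemma orbit_rowsI:
  fixes a :: "'a::field"
  assumes "N = mp.span {p, q, r}" "N \<in> nets"
    and "lin_subst (rows a b c d e f g h i) p = Const k * u + Const k' * v + Const k'' * w"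
    and "lin_subst (rows a b c d e f g h i) q = Const l * u + Const l' * v + Const l'' * w"
    and "lin_subst (rows a b c d e f g h i) r = Const m * u + Const m' * v + Const m'' * w"
    and "a * (e * i - f * h) - b * (d * i - f * g) + c * (d * h - e * g) \<noteq> 0"
  shows "mp.span {u, v, w} \<in> orbit N"
  unfolding assms(1)
  by (rule orbit_span3I[OF assms(2)[unfolded assms(1)] subset_refl, of "rows a b c d e f g h i"])
    (use assms(3-6) in \<open>auto simp: invertible_rows in_span3\<close>)

lemma nth_root_exists':
  fixes a :: "'a::alg_closed_field"
  assumes "n > 0"
  obtains b where "b ^ n = a"
  using nth_root_exists[of n a] assms by auto

lemmas qf_subst = lin_subst_qf rows_nth qf_scale qf_add qf_eq_iff

text \<open>This and the following spans are models of named nets in coordinates shared by the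
  source and the limit of a degeneration, so that the latter becomes a diagonal or triangular
  substitution.\<close>

lemma span_7b_orbit: "mp.span {qf 1 0 0 0 0 0, qf 0 1 0 0 1 0, qf 0 0 0 1 0 (0 :: 'a::field_char_0)} \<in> orbit net_7b"
  by (rule orbit_rowsI[OF named_nets_qf(4) named_nets(4), of 0 1 0 0 0 1 1 0 0 0 _ 1 _ 0 _ 0 0 1 1 0 0],
      unfold qf_subst) (simp_all add: field_simps power2_eq_square power3_eq_cube)

lemma span_7b_nets: "mp.span {qf 1 0 0 0 0 0, qf 0 1 0 0 1 0, qf 0 0 0 1 0 (0 :: 'a::field_char_0)} \<in> nets"
  by (rule orbit_nets[OF named_nets(4) span_7b_orbit])

lemma span_8a_orbit:
  fixes i :: "'a::field_char_0"
  assumes i: "i * i = - 1"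
  shows "mp.span {qf 1 0 0 0 1 0, qf 0 0 0 1 0 0, qf 0 1 1 0 1 (0 :: 'a)} \<in> orbit net_8a"
proof -
  have "i \<noteq> 0" using i by auto
  \<comment> \<open>X and Y go to X + iY + Z and X - iY + Z, whose product (X + Z)^2 + Y^2 is the
    sum of the first and third generator of the model.\<close>
  with i show ?thesis
    by - (rule orbit_rowsI[OF named_nets_qf(1) named_nets(1), of 1 i 1 1 "-i" 1 2 0 "-2" 1 _ 0 _ 1 _ 3 "4*i" "-1" 3 "-4*i" "-1"],
      unfold qf_subst, simp_all add: field_simps power2_eq_square power3_eq_cube)
qed

lemma span_8c_orbit: "mp.span {qf 1 0 0 0 0 0, qf 0 0 0 1 0 0, qf 0 1 1 0 1 (0 :: 'a::field_char_0)} \<in> orbit net_8c"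
  by (rule orbit_rowsI[OF named_nets_qf(2) named_nets(2), of 1 4 4 1 "-4" 4 "-2" 0 0 4 _ 0 _ 0 _ 3 32 16 3 "-32" 16],
      unfold qf_subst) (simp_all add: field_simps power2_eq_square power3_eq_cube)

lemma span_6b_orbit: "mp.span {qf 1 0 0 0 0 0, qf 0 0 0 0 1 2, qf 0 (-1) 0 1 0 (0 :: 'a::field_char_0)} \<in> orbit net_6b"
  by (rule orbit_rowsI[OF named_nets_qf(7) named_nets(7), of 1 0 0 0 2 1 0 "-3" 0 1 _ 0 _ 0 _ 0 0 "-3" 0 1 0],
      unfold qf_subst) (simp_all add: field_simps power2_eq_square power3_eq_cube)

lemma span_6c_orbit: "mp.span {qf 1 0 0 0 0 0, qf 0 1 0 0 0 0, qf 0 0 0 1 1 (0 :: 'a::field_char_0)} \<in> orbit net_6c"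
  by (rule orbit_rowsI[OF named_nets_qf(8) named_nets(8), of 1 "-1" 0 0 0 1 1 1 0 1 _ "-1" _ 0 _ 2 2 0 0 0 1],
      unfold qf_subst) (simp_all add: field_simps power2_eq_square power3_eq_cube)

lemma span_5a_orbit: "mp.span {qf 1 0 0 0 0 0, qf 0 0 0 0 1 0, qf 0 0 0 1 0 (0 :: 'a::field_char_0)} \<in> orbit net_5a"
  by (rule orbit_rowsI[OF named_nets_qf(10) named_nets(10), of 0 0 1 0 1 0 1 0 0 0 _ 0 _ 1 _ 0 1 0 1 0 0],
      unfold qf_subst) (simp_all add: field_simps power2_eq_square power3_eq_cube)

lemma span_5b_orbit: "mp.span {qf 1 0 0 0 0 0, qf 0 1 0 0 0 0, qf 0 0 0 1 0 (0 :: 'a::field_char_0)} \<in> orbit net_5b"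
  by (rule orbit_rowsI[OF named_nets_qf(11) named_nets(11), of 0 0 1 0 1 0 1 0 0 0 _ 1 _ 0 _ 1 0 0 0 0 1],
      unfold qf_subst) (simp_all add: field_simps power2_eq_square power3_eq_cube)

lemma span_4_orbit: "mp.span {qf 1 0 0 0 0 0, qf 0 1 0 0 1 0, qf 0 0 0 0 0 (1 :: 'a::field_char_0)} \<in> orbit net_4"
  by (rule orbit_rowsI[OF named_nets_qf(12) named_nets(12), of 0 1 0 1 0 0 0 0 1 0 _ 1 _ 0 _ 0 0 1 1 0 0],
      unfold qf_subst) (simp_all add: field_simps power2_eq_square power3_eq_cube)

lemma specialization_of_qf_curve:
  fixes u1 u2 u3 v1 v2 v3 :: "'a::field_char_0 form"
  assumes "U = mp.span {u1, u2, u3}" "U \<in> orbit W" "V \<in> nets" "W \<in> nets"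
    and "\<And>t. t \<noteq> 0 \<Longrightarrow> mp.span {u1 + Const t * v1, u2 + Const t * v2, u3 + Const t * v3} \<in> orbit V"
  shows "specialization (orbit V) (orbit W)"
proof -
  have "U \<in> nets" by (rule orbit_nets[OF assms(4,2)])
  then have "specialization (orbit V) (orbit U)"
    using specialization_of_curve[of V "triple u1 u2 u3" "triple v1 v2 v3"] assms(1,3,5) by simp
  then show ?thesis using assms(2) unfolding orbit_eq by simp
qed

section \<open>Explicit one-parameter degenerations\<close>

lemma spec_8a_7a: "specialization (orbit (net_8a :: 'a::{alg_closed_field, field_char_0} form set)) (orbit net_7a)"
proof (rule specialization_of_qf_curve[OF named_nets_qf(3) orbit_refl named_nets(1) named_nets(3),
      of "qf 0 0 0 0 0 0" "qf 0 0 0 0 0 0" "qf 0 1 0 0 0 0"],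
    goal_cases)
  case (1 t)
  \<comment> \<open>Scaling X, Y, Z by 1, x, 1/x preserves the first two generators up to factors
    and turns Y^2 + XZ into a multiple of XZ + x^3 Y^2. Taking a root of \<open>t\<close> makes the
    curve a line; the same device is used below.\<close>
  obtain x where x: "x ^ 3 = t" using nth_root_exists'[of 3 t] by auto
  then have x0: "x \<noteq> 0" using 1 by auto
  show ?case
    by (rule orbit_rowsI[OF named_nets_qf(1) named_nets(1), of 1 0 0 0 x 0 0 0 "1/x" 0 _ x _ 0 _ 1 0 0 0 0 "1/x"],
      unfold qf_subst) (use 1 x[symmetric] x0 in \<open>simp_all add: field_simps power2_eq_square power3_eq_cube\<close>)
qed

lemma spec_8a_6a: "specialization (orbit (net_8a :: 'a::field_char_0 form set)) (orbit net_6a)"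
proof (rule specialization_of_qf_curve[OF named_nets_qf(6) orbit_refl named_nets(1) named_nets(6),
      of "qf 0 0 0 0 0 0" "qf 1 0 0 0 0 0" "qf 0 1 0 0 0 0"],
    goal_cases)
  case (1 t)
  show ?case
    by (rule orbit_rowsI[OF named_nets_qf(1) named_nets(1), of t 0 0 0 t 0 0 0 1 "t*t" _ 0 _ 0 _ 0 t 0 0 0 t],
      unfold qf_subst) (use 1 in \<open>simp_all add: field_simps power2_eq_square power3_eq_cube\<close>)
qed

text \<open>Give X, Y, Z the weights 0, 1, 2. The model of #7b is spanned by the weighted
  homogeneous forms X^2, Y^2 + XZ, YZ, and the additional terms XZ and Z^2 of #8a have higher weight
  than the forms they are added to.\<close>

lemma spec_8a_7b: "specialization (orbit (net_8a :: 'a::{alg_closed_field, field_char_0} form set)) (orbit net_7b)"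
proof -
  obtain i :: 'a where "i ^ 2 = - 1" using nth_root_exists'[of 2 "- 1"] by auto
  then have "i * i = - 1" by (simp add: power2_eq_square)
  note src = span_8a_orbit[OF this]
  show ?thesis
  proof (rule specialization_of_qf_curve[OF refl span_7b_orbit named_nets(1) named_nets(4),
        of "qf 0 0 0 0 1 0" "qf 0 0 1 0 0 0" "qf 0 0 0 0 0 0"],
      goal_cases)
    case (1 t)
    obtain x where x: "x ^ 2 = t" using nth_root_exists'[of 2 t] by auto
    then have x0: "x \<noteq> 0" using 1 by auto
    show ?case
      by (rule orbit_trans[OF orbit_rowsI[OF refl orbit_nets[OF named_nets(1) src],
            of 1 0 0 0 x 0 0 0 "x*x" 1 _ 0 _ 0 _ 0 0 "x*x*x" 0 "x*x" 0] src],
        unfold qf_subst) (use 1 x[symmetric] x0 in \<open>simp_all add: field_simps power2_eq_square power3_eq_cube\<close>)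
  qed
qed

lemma spec_8c_7b: "specialization (orbit (net_8c :: 'a::{alg_closed_field, field_char_0} form set)) (orbit net_7b)"
proof (rule specialization_of_qf_curve[OF refl span_7b_orbit named_nets(2) named_nets(4),
      of "qf 0 0 0 0 0 0" "qf 0 0 1 0 0 0" "qf 0 0 0 0 0 0"],
    goal_cases)
  case (1 t)
  obtain x where x: "x ^ 2 = t" using nth_root_exists'[of 2 t] by auto
  then have x0: "x \<noteq> 0" using 1 by auto
  show ?case
    by (rule orbit_trans[OF orbit_rowsI[OF refl orbit_nets[OF named_nets(2) span_8c_orbit],
          of 1 0 0 0 x 0 0 0 "x*x" 1 _ 0 _ 0 _ 0 0 "x*x*x" 0 "x*x" 0] span_8c_orbit],
      unfold qf_subst) (use 1 x[symmetric] x0 in \<open>simp_all add: field_simps power2_eq_square power3_eq_cube\<close>)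
qed

lemma spec_8c_7c: "specialization (orbit (net_8c :: 'a::{alg_closed_field, field_char_0} form set)) (orbit net_7c)"
proof (rule specialization_of_qf_curve[OF named_nets_qf(5) orbit_refl named_nets(2) named_nets(5),
      of "qf 0 0 0 0 0 0" "qf 0 0 0 0 1 0" "qf 0 0 0 0 0 0"],
    goal_cases)
  case (1 t)
  obtain x where x: "x ^ 3 = t" using nth_root_exists'[of 3 t] by auto
  then have x0: "x \<noteq> 0" using 1 by auto
  show ?case
    by (rule orbit_rowsI[OF named_nets_qf(2) named_nets(2), of x 0 0 0 1 0 0 0 "-x*x" 0 _ 0 _ "x*x*x*x" _ "x*x" 0 0 0 1 0],
      unfold qf_subst) (use 1 x[symmetric] x0 in \<open>simp_all add: field_simps power2_eq_square power3_eq_cube\<close>)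
qed

lemma spec_8c_6d: "specialization (orbit (net_8c :: 'a::field_char_0 form set)) (orbit net_6d)"
proof (rule specialization_of_qf_curve[OF named_nets_qf(9) orbit_refl named_nets(2) named_nets(9),
      of "qf 0 0 0 1 0 0" "qf 0 0 0 0 1 0" "qf 0 0 0 0 0 0"],
    goal_cases)
  case (1 t)
  show ?case
    by (rule orbit_rowsI[OF named_nets_qf(2) named_nets(2), of 1 0 0 0 1 0 0 0 "-t" 0 _ 0 _ "t*t" _ 1 0 0 0 1 0],
      unfold qf_subst) (use 1 in \<open>simp_all add: field_simps power2_eq_square power3_eq_cube\<close>)
qed

lemma spec_7b_6b: "specialization (orbit (net_7b :: 'a::field_char_0 form set)) (orbit net_6b)"
proof (rule specialization_of_qf_curve[OF refl span_6b_orbit named_nets(4) named_nets(7),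
      of "qf 0 0 0 0 0 0" "qf 0 1 0 0 0 0" "qf 0 0 0 0 0 0"],
    goal_cases)
  case (1 t)
  \<comment> \<open>Y and Z are translated by multiples of X that blow up as \<open>t\<close> tends
    to 0. Modulo X^2, t (Y^2 + XZ) and t^2 YZ then both start with XZ + 2XY, and their difference
    leaves a multiple of YZ - Y^2.\<close>
  show ?case
    by (rule orbit_trans[OF orbit_rowsI[OF refl span_7b_nets,
          of 1 0 0 "1/t" 1 0 "2/(t*t)" 0 "1/t" 1 _ 0 _ 0 _ "3/(t*t)" "1/t" 0 "2/(t*t*t)" "1/(t*t)" "1/t"] span_7b_orbit],
      unfold qf_subst) (use 1 in \<open>simp_all add: field_simps power2_eq_square power3_eq_cube\<close>)
qed

lemma spec_7b_6c: "specialization (orbit (net_7b :: 'a::field_char_0 form set)) (orbit net_6c)"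
proof (rule specialization_of_qf_curve[OF refl span_6c_orbit named_nets(4) named_nets(8),
      of "qf 0 0 0 0 0 0" "qf 0 0 0 0 1 0" "qf 0 0 0 0 0 0"],
    goal_cases)
  case (1 t)
  \<comment> \<open>The constants 1/3, 2/9, -2/3 are determined by the conditions that XY cancels in
    the images of Y^2 + XZ and YZ and that the third form is YZ + XZ.\<close>
  show ?case
    by (rule orbit_trans[OF orbit_rowsI[OF refl span_7b_nets,
          of 1 0 0 "1/3" 1 0 "2/9" "-2/3" t 1 _ 0 _ 0 _ "1/3" 1 0 "2/27" "-2/3" t] span_7b_orbit],
      unfold qf_subst) (use 1 in \<open>simp_all add: field_simps power2_eq_square power3_eq_cube\<close>)
qed

lemma spec_7b_5a: "specialization (orbit (net_7b :: 'a::field_char_0 form set)) (orbit net_5a)"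
proof (rule specialization_of_qf_curve[OF refl span_5a_orbit named_nets(4) named_nets(10),
      of "qf 0 0 0 0 0 0" "qf 0 1 0 0 0 0" "qf 0 0 0 0 0 0"],
    goal_cases)
  case (1 t)
  show ?case
    by (rule orbit_trans[OF orbit_rowsI[OF refl span_7b_nets,
          of 1 0 0 0 1 0 0 0 "1/t" 1 _ 0 _ 0 _ 0 "1/t" 0 0 0 "1/t"] span_7b_orbit],
      unfold qf_subst) (use 1 in \<open>simp_all add: field_simps power2_eq_square power3_eq_cube\<close>)
qed

lemma spec_7b_5b: "specialization (orbit (net_7b :: 'a::field_char_0 form set)) (orbit net_5b)"
proof (rule specialization_of_qf_curve[OF refl span_5b_orbit named_nets(4) named_nets(11),
      of "qf 0 0 0 0 0 0" "qf 0 0 0 0 1 0" "qf 0 0 0 0 0 0"],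
    goal_cases)
  case (1 t)
  show ?case
    by (rule orbit_trans[OF orbit_rowsI[OF refl span_7b_nets, of 1 0 0 0 1 0 0 0 t 1 _ 0 _ 0 _ 0 1 0 0 0 t] span_7b_orbit],
      unfold qf_subst) (use 1 in \<open>simp_all add: field_simps power2_eq_square power3_eq_cube\<close>)
qed

lemma spec_7b_4: "specialization (orbit (net_7b :: 'a::field_char_0 form set)) (orbit net_4)"
proof (rule specialization_of_qf_curve[OF refl span_4_orbit named_nets(4) named_nets(12),
      of "qf 0 0 0 0 0 0" "qf 0 0 0 0 0 0" "qf 0 0 0 1 0 0"],
    goal_cases)
  case (1 t)
  show ?case
    by (rule orbit_trans[OF orbit_rowsI[OF refl span_7b_nets,
          of 1 0 0 0 1 0 "1/t" 0 1 1 _ 0 _ 0 _ "1/t" 1 0 0 0 "1/t"] span_7b_orbit],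
      unfold qf_subst) (use 1 in \<open>simp_all add: field_simps power2_eq_square power3_eq_cube\<close>)
qed

lemma spec_4_2a: "specialization (orbit (net_4 :: 'a::field_char_0 form set)) (orbit net_2a)"
proof (rule specialization_of_qf_curve[OF named_nets_qf(13) orbit_refl named_nets(12) named_nets(13),
      of "qf 0 0 0 0 0 0" "qf 0 0 0 0 0 0" "qf 0 1 0 0 0 0"],
    goal_cases)
  case (1 t)
  show ?case
    by (rule orbit_rowsI[OF named_nets_qf(12) named_nets(12), of 0 1 0 1 0 0 0 0 "1/t" 0 _ 0 _ "1/t" _ 0 1 0 1 0 0],
      unfold qf_subst) (use 1 in \<open>simp_all add: field_simps power2_eq_square power3_eq_cube\<close>)
qed

lemma spec_4_2b: "specialization (orbit (net_4 :: 'a::field_char_0 form set)) (orbit net_2b)"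
proof (rule specialization_of_qf_curve[OF named_nets_qf(14) orbit_refl named_nets(12) named_nets(14),
      of "qf 0 0 0 0 0 0" "qf 0 0 0 0 1 0" "qf 0 0 0 0 1 0"],
    goal_cases)
  case (1 t)
  show ?case
    by (rule orbit_rowsI[OF named_nets_qf(12) named_nets(12), of 0 1 0 1 0 0 0 0 t 0 _ 1 _ 0 _ "-1/2" "-1/2" "1/2" 1 0 0],
      unfold qf_subst) (use 1 in \<open>simp_all add: field_simps power2_eq_square power3_eq_cube\<close>)
qed

section \<open>Nets containing the square of a linear form\<close>

lemma indep3_swap:
  assumes "indep3 p q r"
  shows "indep3 q p r" "indep3 p r q"
proof -
  have *: "a = 0 \<and> b = 0 \<and> c = 0" if "Const a * p + Const b * q + Const c * r = 0" for a b c
    using assms that unfolding indep3_def by blast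
  show "indep3 q p r" unfolding indep3_def
  proof (intro allI impI)
    fix a b c assume "Const a * q + Const b * p + Const c * r = 0"
    then show "a = 0 \<and> b = 0 \<and> c = 0" using *[of b a c] by (simp add: add.commute)
  qed
  show "indep3 p r q" unfolding indep3_def
  proof (intro allI impI)
    fix a b c assume "Const a * p + Const b * r + Const c * q = 0"
    then show "a = 0 \<and> b = 0 \<and> c = 0" using *[of a c b] by (simp add: add_ac)
  qed
qed

lemma nets_R2: "V \<in> nets \<Longrightarrow> p \<in> V \<Longrightarrow> p \<in> R 2"
  unfolding nets_def by blast

lemma in_span3_generators: "x \<in> mp.span {x, y, z}" "y \<in> mp.span {x, y, z}" "z \<in> mp.span {x, y, z}"
  by (auto intro: mp.span_base)

lemma in_span3I: "x = Const a * p + Const b * q + Const c * r \<Longrightarrow> x \<in> mp.span {p, q, r}"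
  unfolding in_span3 by blast

lemma nets_extend1:
  assumes V: "V \<in> nets" and x: "x \<in> V" "x \<noteq> 0"
  obtains q r where "V = mp.span {x, q, r}" "indep3 x q r" "q \<in> V" "r \<in> V"
proof -
  obtain p q r where *: "indep3 p q r" "V = mp.span {p, q, r}" using V nets_iff by blast
  have mem: "p \<in> V" "q \<in> V" "r \<in> V" unfolding *(2) using mp.span_superset[of "{p, q, r}"] by blast+
  obtain a b c where abc: "x = Const a * p + Const b * q + Const c * r" using x(1) unfolding *(2) in_span3 by blast
  have key: "\<exists>q r. V = mp.span {x, q, r} \<and> indep3 x q r \<and> q \<in> V \<and> r \<in> V"
    if "indep3 p q r" "V = mp.span {p, q, r}" "q \<in> V" "r \<in> V" "x = Const a * p + Const b * q + Const c * r" "a \<noteq> 0"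
    for p q r a b c
  proof -
    have i: "Const (1 / a) * Const a = 1" "Const (1 / a) * Const b = Const (b / a)" "Const (1 / a) * Const c = Const (c / a)"
      using that(6) by (simp_all flip: Const_mult)
    have "p = Const (1 / a) * x + Const (- (b / a)) * q + Const (- (c / a)) * r"
      unfolding that(5) distrib_left mult.assoc[symmetric] i Const_uminus by simp
    then have "p \<in> mp.span {x, q, r}" by (rule in_span3I)
    note this in_span3_generators(2)[of q x r] in_span3_generators(3)[of r x q]
    from span3_eq_of_indep3[OF that(1) this] have "mp.span {x, q, r} = V" "indep3 x q r" unfolding that(2) .
    then show ?thesis using that(3,4) by blast
  qed
  note perm = indep3_swap(1)[OF *(1)] indep3_swap(1)[OF indep3_swap(2)[OF *(1)]]
  have sp: "V = mp.span {q, p, r}" "V = mp.span {r, p, q}"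
    unfolding *(2) by (rule arg_cong[of _ _ mp.span], blast)+
  have xs: "x = Const b * q + Const a * p + Const c * r" "x = Const c * r + Const a * p + Const b * q"
    unfolding abc by (simp_all add: add_ac)
  have "a \<noteq> 0 \<or> b \<noteq> 0 \<or> c \<noteq> 0" using x(2) abc by auto
  then show thesis
    using key[OF * mem(2,3) abc] key[OF perm(1) sp(1) mem(1,3) xs(1)] key[OF perm(2) sp(2) mem(1,2) xs(2)] that by blast
qed

lemma nets_extend2:
  assumes V: "V \<in> nets" and x: "x \<in> V" "y \<in> V" "\<And>a b. Const a * x + Const b * y = 0 \<Longrightarrow> a = 0 \<and> b = 0"
  obtains r where "V = mp.span {x, y, r}" "indep3 x y r" "r \<in> V"
proof -
  have "x \<noteq> 0" using x(3)[of 1 0] by auto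
  then obtain q r where *: "V = mp.span {x, q, r}" "indep3 x q r" "q \<in> V" "r \<in> V"
    using nets_extend1[OF V x(1)] by blast
  obtain a b c where abc: "y = Const a * x + Const b * q + Const c * r" using x(2) unfolding *(1) in_span3 by blast
  have key: "\<exists>r. V = mp.span {x, y, r} \<and> indep3 x y r \<and> r \<in> V"
    if "V = mp.span {x, q, r}" "indep3 x q r" "r \<in> V" "y = Const a * x + Const b * q + Const c * r" "b \<noteq> 0"
    for q r a b c
  proof -
    have i: "Const (1 / b) * Const b = 1" "Const (1 / b) * Const a = Const (a / b)" "Const (1 / b) * Const c = Const (c / b)"
      using that(5) by (simp_all flip: Const_mult)
    have "q = Const (- (a / b)) * x + Const (1 / b) * y + Const (- (c / b)) * r"
      unfolding that(4) distrib_left mult.assoc[symmetric] i Const_uminus by simp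
    then have "q \<in> mp.span {x, y, r}" by (rule in_span3I)
    note in_span3_generators(1)[of x y r] this in_span3_generators(3)[of r x y]
    from span3_eq_of_indep3[OF that(2) this] have "mp.span {x, y, r} = V" "indep3 x y r" unfolding that(1) .
    then show ?thesis using that(3) by blast
  qed
  have perm: "V = mp.span {x, r, q}" "indep3 x r q" "y = Const a * x + Const c * r + Const b * q"
    unfolding *(1) abc
    by (rule arg_cong[of _ _ mp.span], blast) (rule indep3_swap(2)[OF *(2)], simp add: add_ac)
  have "b \<noteq> 0 \<or> c \<noteq> 0" using x(3)[of a "-1"] abc by (auto simp: Const_uminus)
  then show thesis using key[OF *(1,2,4) abc] key[OF perm(1,2) *(3) perm(3)] that by blast
qed

lemma span3_cong:
  assumes "indep3 x y (r :: ('v, 'a::field) mpoly)" "r = Const a * x + Const b * y + r'"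
  shows "mp.span {x, y, r} = mp.span {x, y, r'}"
proof -
  have "r \<in> mp.span {x, y, r'}" by (rule in_span3I[of _ a _ b _ 1]) (simp add: assms(2))
  note in_span3_generators(1)[of x y r'] in_span3_generators(2)[of y x r'] this
  from span3_eq_of_indep3(1)[OF assms(1) this] show ?thesis by simp
qed

definition nets_with_square :: "'a::field form set set" where
  "nets_with_square = {net_8c, net_7b, net_7c, net_6b, net_6c, net_6d, net_5a, net_5b, net_4, net_2a, net_2b}"

definition orbit_of_square :: "'a::field form set \<Rightarrow> bool" where
  "orbit_of_square V \<longleftrightarrow> (\<exists>N\<in>nets_with_square. N \<in> orbit V)"

lemma orbit_of_squareI:
  assumes "W \<in> orbit V" "orbit_of_square W"
  shows "orbit_of_square V"
  using assms orbit_trans unfolding orbit_of_square_def by blast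

lemma orbit_of_square_lin_subst:
  assumes "invertible A" "orbit_of_square (lin_subst A ` V)"
  shows "orbit_of_square V"
  by (rule orbit_of_squareI[OF _ assms(2)]) (use assms(1) in \<open>auto simp: orbit_def\<close>)

lemma orbit_of_squareI_named:
  assumes "mp.span S \<in> orbit V" "mp.span S \<in> orbit N" "N \<in> nets_with_square"
  shows "orbit_of_square V"
proof -
  have "N \<in> orbit V" using assms(1,2) orbit_sym orbit_trans by blast
  then show ?thesis using assms(3) unfolding orbit_of_square_def by blast
qed

lemma qf_in_R2_ex: "p \<in> R 2 \<Longrightarrow> \<exists>a b c d e f. p = qf a b c d e f"
  by (erule R2_qf) blast

lemma binary_quadratic_root:
  fixes p q r :: "'a::alg_closed_field"
  obtains x y where "x \<noteq> 0 \<or> y \<noteq> 0" "p * x\<^sup>2 + q * x * y + r * y\<^sup>2 = 0"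
proof (cases "p = 0")
  case True
  then show thesis using that[of 1 0] by simp
next
  case False
  then have "degree [:r, q, p:] > 0" by simp
  then obtain x where "poly [:r, q, p:] x = 0" using alg_closed_imp_poly_has_root by blast
  then show thesis using that[of x 1] by (simp add: algebra_simps power2_eq_square)
qed

text \<open>The third generator can be taken free of X^2 and XY; what remains is sorted by whether
  it contains Z^2, or else YZ, or neither.\<close>

lemma square_case_XX_XY:
  fixes V :: "'k::{alg_closed_field, field_char_0} form set"
  assumes V: "V \<in> nets" and x: "qf 1 0 0 0 0 0 \<in> V" "qf 0 0 0 0 0 1 \<in> V"
  shows "orbit_of_square V"
proof -
  obtain r where r: "V = mp.span {qf 1 0 0 0 0 0, qf 0 0 0 0 0 1, r}" "indep3 (qf 1 0 0 0 0 0) (qf 0 0 0 0 0 1) r" "r \<in> V"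
    using nets_extend2[OF V x] by (auto simp: qf_add qf_scale qf_eq_0_iff)
  obtain a b c d e f where q: "r = qf a b c d e f" using qf_in_R2_ex[OF nets_R2[OF V r(3)]] by blast
  have V': "V = mp.span {qf 1 0 0 0 0 0, qf 0 0 0 0 0 1, qf 0 b c d e 0}"
    unfolding r(1) by (rule span3_cong[OF r(2), of a f]) (simp add: q qf_add qf_scale)
  have N: "mp.span {qf 1 0 0 0 0 0, qf 0 0 0 0 0 1, qf 0 b c d e 0} \<in> nets" using V V' by simp
  have ne: "b \<noteq> 0 \<or> c \<noteq> 0 \<or> d \<noteq> 0 \<or> e \<noteq> 0"
  proof (rule ccontr)
    assume "\<not> ?thesis"
    then have "Const a * qf 1 0 0 0 0 0 + Const f * qf 0 0 0 0 0 1 + Const (-1) * r = 0"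
      by (simp add: q qf_add qf_scale qf_0)
    then show False using r(2) unfolding indep3_def by (metis one_neq_zero neg_equal_0_iff_equal)
  qed
  note st = orbit_rowsI[OF refl N]
  consider "c \<noteq> 0" | "c = 0" "d \<noteq> 0" | "c = 0" "d = 0" by blast
  then show ?thesis
  proof cases
    case 1
    \<comment> \<open>Completing the square in Z; the terms in X^2 and XY that this produces already
      lie in the net.\<close>
    define \<alpha> where "\<alpha> = b / c - d\<^sup>2 / (4 * c\<^sup>2)"
    have W: "mp.span {qf 1 0 0 0 0 0, qf 0 0 0 0 0 1, qf 0 \<alpha> 1 0 0 0} \<in> orbit V" (is "?W \<in> _")
      unfolding V'
      by (rule st[of 1 0 0 0 1 0 "- e / (2 * c)" "- d / (2 * c)" 1 1 _ 0 _ 0 _ 0 1 0 "- e\<^sup>2 / (4 * c)" "- (d * e) / (2 * c)" c],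
        unfold qf_subst) (use 1 in \<open>simp_all add: \<alpha>_def field_simps power2_eq_square\<close>)
    then have WN: "?W \<in> nets" using orbit_nets[OF V] by blast
    note st = orbit_rowsI[OF refl WN]
    show ?thesis
    proof (cases "\<alpha> = 0")
      case True
      have "net_5b \<in> orbit ?W"
        unfolding named_nets_qf
        by (rule st[of 0 1 0 1 0 0 0 0 1 1 _ 0 _ 0 _ 0 0 1 0 1 0], unfold qf_subst)
          (use True in simp_all)
      then show ?thesis using W orbit_trans unfolding orbit_of_square_def nets_with_square_def by blast
    next
      case False
      obtain k where k: "k ^ 2 = - \<alpha>" using nth_root_exists'[of 2 "- \<alpha>"] by auto
      have k0: "k \<noteq> 0" using k False by auto
      have a: "\<alpha> = - (k * k)" using k by (simp add: power2_eq_square)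
      have "net_6b \<in> orbit ?W"
        unfolding named_nets_qf
        by (rule st[of 1 0 0 0 "1 / (2 * k)" 0 0 "1 / 2" 1 1 _ 0 _ 0 _ 0 0 "1 / (2 * k)" 0 1 0],
        unfold qf_subst) (use k0 in \<open>simp_all add: a field_simps power2_eq_square\<close>)
      then show ?thesis using W orbit_trans unfolding orbit_of_square_def nets_with_square_def by blast
    qed
  next
    case 2
    define g where "g = e / d"
    have e: "e = g * d" using 2 by (simp add: g_def)
    have "net_5a \<in> orbit V"
    proof -
      have W: "mp.span {qf 1 0 0 0 0 0, qf 0 0 0 0 0 1, qf 0 0 0 1 0 0} \<in> orbit V" (is "?W \<in> _")
        unfolding V'
        by (rule st[of 1 0 0 "-g" 1 0 "b * g / d" "- b / d" "1 / d" 1 _ 0 _ 0 _ "-g" 1 0 "b * g\<^sup>2" "- (b * g)" 1],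
        unfold qf_subst) (use 2 in \<open>simp_all add: e field_simps power2_eq_square\<close>)
      then have WN: "?W \<in> nets" using orbit_nets[OF V] by blast
      have "net_5a \<in> orbit ?W"
        unfolding named_nets_qf
        by (rule orbit_rowsI[OF refl WN, of 0 0 1 1 0 0 0 1 0 0 _ 0 _ 1 _ 0 1 0 1 0 0],
            unfold qf_subst) simp_all
      then show ?thesis using W orbit_trans by blast
    qed
    then show ?thesis unfolding orbit_of_square_def nets_with_square_def by blast
  next
    case 3
    consider "b \<noteq> 0" "e \<noteq> 0" | "b \<noteq> 0" "e = 0" | "b = 0" "e \<noteq> 0" using ne 3 by blast
    then show ?thesis
    proof cases
      case be: 1
      have "mp.span {qf 1 0 0 0 0 0, qf 0 1 0 0 1 0, qf 0 0 0 0 0 1} \<in> orbit V"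
        unfolding V'
        by (rule st[of 1 0 0 0 1 0 0 0 "b / e" 1 _ 0 _ 0 _ 0 0 1 0 b 0], unfold qf_subst)
          (use 3 be in simp_all)
      from orbit_of_squareI_named[OF this span_4_orbit] show ?thesis unfolding nets_with_square_def by blast
    next
      case be: 2
      have "net_2b \<in> orbit V"
        unfolding V' named_nets_qf
        by (rule st[of 1 0 0 0 1 0 0 0 1 1 _ 0 _ 0 _ "-1/2" "-1/2" "1/2" 0 b 0], unfold qf_subst)
          (use 3 be in simp_all)
      then show ?thesis unfolding orbit_of_square_def nets_with_square_def by blast
    next
      case be: 3
      have "net_2a \<in> orbit V"
        unfolding V' named_nets_qf
        by (rule st[of 1 0 0 0 1 0 0 0 1 1 _ 0 _ 0 _ 0 1 0 0 0 e], unfold qf_subst)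
          (use 3 be in simp_all)
      then show ?thesis unfolding orbit_of_square_def nets_with_square_def by blast
    qed
  qed
qed

lemma nets_scale_mem:
  assumes "V \<in> nets" "Const c * p \<in> V" "c \<noteq> 0"
  shows "p \<in> V"
proof -
  have "Const (1 / c) * (Const c * p) \<in> V"
    using assms(1,2) mp.subspace_scale unfolding nets_def by blast
  then show ?thesis using assms(3) by (simp add: mult.assoc[symmetric] Const_mult[symmetric])
qed

lemma nets_add_mem:
  assumes "V \<in> nets" "p \<in> V" "q \<in> V"
  shows "Const a * p + Const b * q \<in> V"
  using assms mp.subspace_scale mp.subspace_add unfolding nets_def by blast

lemma square_case_XX_XL:
  fixes V :: "'k::{alg_closed_field, field_char_0} form set"
  assumes V: "V \<in> nets" and x: "qf 1 0 0 0 0 0 \<in> V" "qf 0 0 0 0 e f \<in> V" and ne: "e \<noteq> 0 \<or> f \<noteq> 0"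
  shows "orbit_of_square V"
proof -
  obtain A where A: "invertible A" "lin_subst A (qf 0 0 0 0 e f) = qf 0 0 0 0 0 1"
    "lin_subst A (qf 1 0 0 0 0 0) = qf 1 0 0 0 0 (0 :: 'k)"
  proof (cases "f = 0")
    case False
    show thesis
      by (rule that[of "rows 1 0 0 0 (1 / f) (- e / f) 0 0 1"])
        (use False in \<open>simp_all add: invertible_rows lin_subst_qf qf_eq_iff\<close>)
  next
    case True
    show thesis
      by (rule that[of "rows 1 0 0 0 0 1 0 (1 / e) 0"])
        (use True ne in \<open>simp_all add: invertible_rows lin_subst_qf qf_eq_iff\<close>)
  qed
  show ?thesis
  proof (rule orbit_of_square_lin_subst[OF A(1) square_case_XX_XY])
    show "lin_subst A ` V \<in> nets" by (rule lin_subst_nets[OF A(1) V])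
    show "qf 1 0 0 0 0 0 \<in> lin_subst A ` V" "qf 0 0 0 0 0 1 \<in> lin_subst A ` V"
      using imageI[OF x(1), of "lin_subst A"] imageI[OF x(2), of "lin_subst A"] A(2,3) by simp_all
  qed
qed

text \<open>Subtracting a multiple of the second generator frees the third one from Y^2. If it
  contains neither Z^2 nor YZ, it is X times a linear form, which is the previous case.\<close>

lemma square_case_YY:
  fixes V :: "'k::{alg_closed_field, field_char_0} form set"
  assumes V: "V \<in> nets" and x: "qf 1 0 0 0 0 0 \<in> V" "qf 0 1 0 0 e f \<in> V"
  shows "orbit_of_square V"
proof -
  obtain r where r: "V = mp.span {qf 1 0 0 0 0 0, qf 0 1 0 0 e f, r}" "indep3 (qf 1 0 0 0 0 0) (qf 0 1 0 0 e f) r" "r \<in> V"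
    using nets_extend2[OF V x] by (auto simp: qf_add qf_scale qf_eq_0_iff)
  obtain a b c d e' f' where q: "r = qf a b c d e' f'" using qf_in_R2_ex[OF nets_R2[OF V r(3)]] by blast
  define e2 f2 where "e2 = e' - b * e" and "f2 = f' - b * f"
  have V': "V = mp.span {qf 1 0 0 0 0 0, qf 0 1 0 0 e f, qf 0 0 c d e2 f2}"
    unfolding r(1) by (rule span3_cong[OF r(2), of a b]) (simp add: q qf_add qf_scale e2_def f2_def)
  have N: "mp.span {qf 1 0 0 0 0 0, qf 0 1 0 0 e f, qf 0 0 c d e2 f2} \<in> nets" using V V' by simp
  note st = orbit_rowsI[OF refl N]
  consider "c \<noteq> 0" | "c = 0" "d \<noteq> 0" | "c = 0" "d = 0" by blast
  then show ?thesis
  proof cases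
    case 3
    have "qf 0 0 0 0 e2 f2 \<in> V" unfolding V' using 3 in_span3_generators(3) by simp
    moreover have "e2 \<noteq> 0 \<or> f2 \<noteq> 0"
    proof (rule ccontr)
      assume "\<not> ?thesis"
      then have "Const a * qf 1 0 0 0 0 0 + Const b * qf 0 1 0 0 e f + Const (-1) * r = 0"
        using 3 by (simp add: q qf_add qf_scale qf_eq_0_iff e2_def f2_def)
      then show False using r(2) unfolding indep3_def by (metis one_neq_zero neg_equal_0_iff_equal)
    qed
    ultimately show ?thesis using square_case_XX_XL[OF V x(1)] by blast
  next
    case 1
    define s where "s = d / (2 * c)"
    have d: "d = 2 * c * s" using 1 by (simp add: s_def)
    define f1 where "f1 = f - e * s"
    define g where "g = (f2 - e2 * s) / c + s\<^sup>2 * f1"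
    define h where "h = e2 / c + s\<^sup>2 * e"
    have W: "mp.span {qf 1 0 0 0 0 0, qf 0 1 0 0 e f1, qf 0 0 1 0 h g} \<in> orbit V" (is "?W \<in> _")
      unfolding V'
      by (rule st[of 1 0 0 0 1 0 0 "-s" 1 1 _ 0 _ 0 _ 0 1 0 0 "- (c * s\<^sup>2)" c],
        unfold qf_subst) (use 1 in \<open>simp_all add: d f1_def g_def h_def field_simps power2_eq_square\<close>)
    then have WN: "?W \<in> nets" using orbit_nets[OF V] by blast
    \<comment> \<open>Translating Y and Z by multiples of X removes XY from the second and XZ from
      the third generator. The two surviving coefficients \<open>e\<close> and \<open>g\<close>
      decide between #8c, #7c and #6d.\<close>
    have U: "mp.span {qf 1 0 0 0 0 0, qf 0 1 0 0 e 0, qf 0 0 1 0 0 g} \<in> orbit ?W" (is "?U \<in> _")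
      by (rule orbit_rowsI[OF refl WN,
            of 1 0 0 "- f1 / 2" 1 0 "- h / 2" 0 1 1 _ 0 _ 0 _ "- f1\<^sup>2 / 4 - e * h / 2" 1 0 "- h\<^sup>2 / 4 - g * f1 / 2" 0 1],
        unfold qf_subst) (simp_all add: field_simps power2_eq_square)
    then have UN: "?U \<in> nets" using orbit_nets[OF WN] by blast
    have UV: "?U \<in> orbit V" using U W orbit_trans by blast
    note st = orbit_rowsI[OF refl UN]
    consider "e \<noteq> 0" "g \<noteq> 0" | "e \<noteq> 0" "g = 0" | "e = 0" "g \<noteq> 0" | "e = 0" "g = 0" by blast
    then have "\<exists>N\<in>nets_with_square. N \<in> orbit ?U"
    proof cases
      case eg: 1
      \<comment> \<open>With X to Z, Y to y X and Z to -(y^2 / e) Y the second generator becomes a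
        multiple of X^2 - YZ; the cube root is the condition that the third becomes a multiple of
        Y^2 - XZ.\<close>
      obtain y where y: "y ^ 3 = - (g * e\<^sup>2)" using nth_root_exists'[of 3 "- (g * e\<^sup>2)"] by auto
      then have y0: "y \<noteq> 0" using eg by auto
      have y4: "y * y * y = - (g * e * e)" using y by (simp add: power3_eq_cube power2_eq_square mult.assoc)
      have "net_8c \<in> orbit ?U"
        unfolding named_nets_qf
        by (rule st[of 0 0 1 y 0 0 0 "- y\<^sup>2 / e" 0 1 _ 0 _ 0 _ 0 "y\<^sup>2" 0 0 0 "y ^ 4 / e\<^sup>2"],
        unfold qf_subst) (use eg y0 y4 in \<open>simp_all add: field_simps power2_eq_square power4_eq_xxxx\<close>)
      then show ?thesis unfolding nets_with_square_def by blast
    next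
      case eg: 2
      have "net_7c \<in> orbit ?U"
        unfolding named_nets_qf
        by (rule st[of 0 1 0 1 0 0 0 0 "1 / e" 0 _ 1 _ 0 _ 1 0 0 0 0 "1 / e\<^sup>2"],
        unfold qf_subst) (use eg in \<open>simp_all add: field_simps power2_eq_square\<close>)
      then show ?thesis unfolding nets_with_square_def by blast
    next
      case eg: 3
      have "net_7c \<in> orbit ?U"
        unfolding named_nets_qf
        by (rule st[of 0 1 0 0 0 "1 / g" 1 0 0 0 _ 1 _ 0 _ 0 0 "1 / g\<^sup>2" 1 0 0],
        unfold qf_subst) (use eg in \<open>simp_all add: field_simps power2_eq_square\<close>)
      then show ?thesis unfolding nets_with_square_def by blast
    next
      case eg: 4
      have "?U = net_6d" unfolding named_nets_qf using eg by simp
      then show ?thesis unfolding nets_with_square_def using orbit_refl by blast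
    qed
    then show ?thesis using UV orbit_trans unfolding orbit_of_square_def by blast
  next
    case 2
    define k where "k = (e2 - d * f / 2) / d"
    have W: "mp.span {qf 1 0 0 0 0 0, qf 0 1 0 0 e 0, qf 0 0 0 1 k 0} \<in> orbit V" (is "?W \<in> _")
      unfolding V'
      by (rule st[of 1 0 0 "- f / 2" 1 0 "- f2 / d" 0 1 1 _ 0 _ 0 _ "- f\<^sup>2 / 4 - e * f2 / d" 1 0 "- (k * f2) - f2 * f / 2" 0 d],
        unfold qf_subst) (use 2 in \<open>simp_all add: k_def field_simps power2_eq_square\<close>)
    then have WN: "?W \<in> nets" using orbit_nets[OF V] by blast
    note st = orbit_rowsI[OF refl WN]
    consider "e \<noteq> 0" | "e = 0" "k = 0" | "e = 0" "k \<noteq> 0" by blast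
    then have "orbit_of_square ?W"
    proof cases
      case e: 1
      \<comment> \<open>The translation by k/3 is chosen so that XY cancels and the remaining Y^2
        and XZ in the image of YZ + k XZ occur in the ratio 1 : 1, hence as a multiple of the second
        generator.\<close>
      have "mp.span {qf 1 0 0 0 0 0, qf 0 1 0 0 1 0, qf 0 0 0 1 0 0} \<in> orbit ?W"
        by (rule st[of 1 0 0 "- k / 3" 1 0 "- (4 * k\<^sup>2) / (9 * e)" "2 * k / (3 * e)" "1 / e" 1 _ 0 _ 0 _ "k\<^sup>2 / 9 - 4 * k\<^sup>2 / 9" 1 0
            "- (8 * k ^ 3) / (27 * e)" "2 * k / (3 * e)" "1 / e"],
        unfold qf_subst) (use e in \<open>simp_all add: field_simps power2_eq_square power3_eq_cube\<close>)
      from orbit_of_squareI_named[OF this span_7b_orbit] show ?thesis unfolding nets_with_square_def by blast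
    next
      case e: 2
      then have "mp.span {qf 1 0 0 0 0 0, qf 0 1 0 0 0 0, qf 0 0 0 1 0 0} \<in> orbit ?W" using orbit_refl by simp
      from orbit_of_squareI_named[OF this span_5b_orbit] show ?thesis unfolding nets_with_square_def by blast
    next
      case e: 3
      have "mp.span {qf 1 0 0 0 0 0, qf 0 1 0 0 0 0, qf 0 0 0 1 1 0} \<in> orbit ?W"
        by (rule st[of "1 / k" 0 0 0 1 0 0 0 1 "1 / k\<^sup>2" _ 0 _ 0 _ 0 1 0 0 0 1],
        unfold qf_subst) (use e in \<open>simp_all add: field_simps power2_eq_square\<close>)
      from orbit_of_squareI_named[OF this span_6c_orbit] show ?thesis unfolding nets_with_square_def by blast
    qed
    with W show ?thesis by (rule orbit_of_squareI)
  qed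
qed

text \<open>On the line X = 0 the two other generators restrict to a pencil of binary quadratic
  forms, which has a member of zero discriminant. That member of the net is X times a linear form
  or, after a change of Y and Z and scaling, Y^2 plus such a product.\<close>

lemma square_case_XX:
  fixes V :: "'k::{alg_closed_field, field_char_0} form set"
  assumes V: "V \<in> nets" and x: "qf 1 0 0 0 0 0 \<in> V"
  shows "orbit_of_square V"
proof -
  obtain p q where pq: "V = mp.span {qf 1 0 0 0 0 0, p, q}" "indep3 (qf 1 0 0 0 0 0) p q" "p \<in> V" "q \<in> V"
    using nets_extend1[OF V x] by (auto simp: qf_eq_0_iff)
  obtain a1 b1 c1 d1 e1 f1 a2 b2 c2 d2 e2 f2 where p: "p = qf a1 b1 c1 d1 e1 f1" and q: "q = qf a2 b2 c2 d2 e2 f2"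
    using qf_in_R2_ex[OF nets_R2[OF V pq(3)]] qf_in_R2_ex[OF nets_R2[OF V pq(4)]] by blast
  \<comment> \<open>The left side of the equation is the discriminant of the restriction of u p + v
    q to X = 0.\<close>
  obtain u v where uv: "u \<noteq> 0 \<or> v \<noteq> 0"
    "(d1\<^sup>2 - 4 * b1 * c1) * u\<^sup>2 + (2 * d1 * d2 - 4 * b1 * c2 - 4 * b2 * c1) * u * v + (d2\<^sup>2 - 4 * b2 * c2) * v\<^sup>2 = 0"
    by (rule binary_quadratic_root)
  define b c d e f where "b = u * b1 + v * b2" and "c = u * c1 + v * c2" and "d = u * d1 + v * d2"
    and "e = u * e1 + v * e2" and "f = u * f1 + v * f2"
  have disc: "d\<^sup>2 = 4 * b * c"
  proof -
    have "d\<^sup>2 - 4 * b * c = 0" unfolding b_def c_def d_def using uv(2) by algebra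
    then show ?thesis by simp
  qed
  have eq: "qf 0 b c d e f = Const (- (u * a1 + v * a2)) * qf 1 0 0 0 0 0 + Const u * p + Const v * q"
    by (simp add: p q qf_add qf_scale b_def c_def d_def e_def f_def)
  have mem: "qf 0 b c d e f \<in> V" unfolding eq pq(1) in_span3 by blast
  have ne: "b \<noteq> 0 \<or> c \<noteq> 0 \<or> d \<noteq> 0 \<or> e \<noteq> 0 \<or> f \<noteq> 0"
  proof (rule ccontr)
    assume "\<not> ?thesis"
    then have "Const (- (u * a1 + v * a2)) * qf 1 0 0 0 0 0 + Const u * p + Const v * q = 0"
      using eq by (simp add: qf_0)
    then show False using pq(2) uv(1) unfolding indep3_def by blast
  qed
  consider "b \<noteq> 0" | "b = 0" "c \<noteq> 0" | "b = 0" "c = 0" by blast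
  then show ?thesis
  proof cases
    case 3
    then have "d = 0" using disc by simp
    then show ?thesis using square_case_XX_XL[OF V x] mem ne 3 by blast
  next
    case 1
    define A :: "'k^3^3" where "A = rows 1 0 0 0 1 (- d / (2 * b)) 0 0 1"
    have A: "invertible A" by (simp add: A_def invertible_rows)
    have "c = d * d / (4 * b)" using disc 1 by (simp add: field_simps power2_eq_square)
    then have 2: "lin_subst A (qf 0 b c d e f) = Const b * qf 0 1 0 0 ((e - f * d / (2 * b)) / b) (f / b)"
      unfolding A_def lin_subst_qf qf_scale qf_eq_iff using 1 by (simp add: field_simps power2_eq_square)
    have 3: "lin_subst A (qf 1 0 0 0 0 0) = qf 1 0 0 0 0 0" by (simp add: A_def lin_subst_qf)
    have N: "lin_subst A ` V \<in> nets" by (rule lin_subst_nets[OF A V])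
    have m: "Const b * qf 0 1 0 0 ((e - f * d / (2 * b)) / b) (f / b) \<in> lin_subst A ` V" "qf 1 0 0 0 0 0 \<in> lin_subst A ` V"
      using imageI[OF mem, of "lin_subst A"] imageI[OF x, of "lin_subst A"] 2 3 by simp_all
    show ?thesis
      by (rule orbit_of_square_lin_subst[OF A square_case_YY[OF N m(2) nets_scale_mem[OF N m(1) 1]]])
  next
    case 2
    define A :: "'k^3^3" where "A = rows 1 0 0 0 0 1 0 1 0"
    have A: "invertible A" by (simp add: A_def invertible_rows)
    have "d = 0" using disc 2 by simp
    then have 4: "lin_subst A (qf 0 b c d e f) = Const c * qf 0 1 0 0 (f / c) (e / c)"
      unfolding A_def lin_subst_qf qf_scale qf_eq_iff using 2 by simp
    have 3: "lin_subst A (qf 1 0 0 0 0 0) = qf 1 0 0 0 0 0" by (simp add: A_def lin_subst_qf)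
    have N: "lin_subst A ` V \<in> nets" by (rule lin_subst_nets[OF A V])
    have m: "Const c * qf 0 1 0 0 (f / c) (e / c) \<in> lin_subst A ` V" "qf 1 0 0 0 0 0 \<in> lin_subst A ` V"
      using imageI[OF mem, of "lin_subst A"] imageI[OF x, of "lin_subst A"] 3 4 by simp_all
    show ?thesis
      by (rule orbit_of_square_lin_subst[OF A square_case_YY[OF N m(2) nets_scale_mem[OF N m(1) 2(2)]]])
  qed
qed

text \<open>The hypothesis says that the form is the square of a nonzero linear form in \<open>X\<close> and \<open>Y\<close>.\<close>

lemma square_case_binary:
  fixes V :: "'k::{alg_closed_field, field_char_0} form set"
  assumes V: "V \<in> nets" and x: "qf a b 0 0 0 f \<in> V" "f\<^sup>2 = 4 * a * b" "a \<noteq> 0 \<or> b \<noteq> 0"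
  obtains A where "invertible A" "qf 1 0 0 0 0 0 \<in> lin_subst A ` V"
proof (cases "a = 0")
  case False
  define A :: "'k^3^3" where "A = rows 1 (- f / (2 * a)) 0 0 1 0 0 0 1"
  have A: "invertible A" by (simp add: A_def invertible_rows)
  have b: "b = f * f / (4 * a)" using x(2) False by (simp add: field_simps power2_eq_square)
  have "lin_subst A (qf a b 0 0 0 f) = Const a * qf 1 0 0 0 0 0"
    unfolding A_def lin_subst_qf qf_scale qf_eq_iff b using False by (simp add: field_simps power2_eq_square)
  then have "Const a * qf 1 0 0 0 0 0 \<in> lin_subst A ` V" using imageI[OF x(1), of "lin_subst A"] by simp
  then show thesis using that A nets_scale_mem[OF lin_subst_nets[OF A V]] False by blast
next
  case True
  define A :: "'k^3^3" where "A = rows 0 1 0 1 0 0 0 0 1"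
  have A: "invertible A" by (simp add: A_def invertible_rows)
  have "lin_subst A (qf a b 0 0 0 f) = Const b * qf 1 0 0 0 0 0"
    unfolding A_def lin_subst_qf qf_scale qf_eq_iff using True x(2) by simp
  then have "Const b * qf 1 0 0 0 0 0 \<in> lin_subst A ` V" using imageI[OF x(1), of "lin_subst A"] by simp
  then show thesis using that A nets_scale_mem[OF lin_subst_nets[OF A V]] True x(3) by blast
qed

section \<open>Nets and partial derivatives of cubics\<close>

text \<open>Fewer equations than unknowns: a coordinate that is always 0 pads the system to a square
  one, where injectivity would imply surjectivity.\<close>

lemma linear_kernel_nontrivial:
  fixes f :: "('a::field)^'n \<Rightarrow> 'a^'n"
  assumes "Vector_Spaces.linear (*s) (*s) f" "\<And>x. f x $ k = 0"
  obtains x where "x \<noteq> 0" "f x = 0"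
proof -
  have "\<not> surj f"
  proof
    assume "surj f"
    then obtain x where "f x = axis k 1" by (metis surjD)
    then show False using assms(2)[of x] by (simp add: axis_def)
  qed
  then have "\<not> inj f" using vec.linear_injective_imp_surjective[OF assms(1)] by blast
  then show thesis using that vec.linear_inj_iff_eq_0[OF assms(1)] by blast
qed

lemma net_contains_partials:
  fixes V :: "'a::field_char_0 form set"
  assumes V: "V \<in> nets"
  obtains \<phi> where "\<phi> \<in> R 3" "\<phi> \<noteq> 0" "\<And>i. mp_diff i \<phi> \<in> V"
proof -
  obtain p1 p2 p3 where *: "p1 \<in> R 2" "p2 \<in> R 2" "p3 \<in> R 2" "indep3 p1 p2 p3" "V = mp.span {p1, p2, p3}"
    using V nets_iff by blast
  obtain a1 b1 c1 d1 e1 f1 where p1: "p1 = qf a1 b1 c1 d1 e1 f1" using qf_in_R2_ex[OF *(1)] by blast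
  obtain a2 b2 c2 d2 e2 f2 where p2: "p2 = qf a2 b2 c2 d2 e2 f2" using qf_in_R2_ex[OF *(2)] by blast
  obtain a3 b3 c3 d3 e3 f3 where p3: "p3 = qf a3 b3 c3 d3 e3 f3" using qf_in_R2_ex[OF *(3)] by blast
  \<comment> \<open>The entry (i, j) of \<open>M\<close> is the coefficient of the j-th generator in
    the prospective i-th partial derivative.\<close>
  define L where "L = (\<lambda>(u::'a) v w (M :: 'a^(3 \<times> 3)) i. M $ (i, 1) * u + M $ (i, 2) * v + M $ (i, 3) * w)"
  have Ladd: "L u v w (M + N) i = L u v w M i + L u v w N i" and Lsc: "L u v w (c *s M) i = c * L u v w M i"
    for u v w M N i c by (simp_all add: L_def algebra_simps)
  define A B C D E F where "A = L a1 a2 a3" and "B = L b1 b2 b3" and "C = L c1 c2 c3" and "D = L d1 d2 d3"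
    and "E = L e1 e2 e3" and "F = L f1 f2 f3"
  note defs = A_def B_def C_def D_def E_def F_def
  \<comment> \<open>Equality of mixed derivatives amounts to nine coefficient comparisons, but the
    three between D, E and F form a cycle D1 = E2 = F3 and count as two. The ninth slot is the zero
    padding.\<close>
  define eqs where "eqs = (\<lambda>M (r :: 3 \<times> 3).
    if r = (1, 1) then F M 1 - 2 * A M 2 else if r = (1, 2) then E M 1 - 2 * A M 3
    else if r = (1, 3) then F M 2 - 2 * B M 1 else if r = (2, 1) then E M 3 - 2 * C M 1
    else if r = (2, 2) then D M 2 - 2 * B M 3 else if r = (2, 3) then D M 3 - 2 * C M 2
    else if r = (3, 1) then D M 1 - E M 2 else if r = (3, 2) then E M 2 - F M 3 else 0)"
  define f where "f M = (\<chi> r. eqs M r)" for M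
  have add: "eqs (M + N) r = eqs M r + eqs N r" and sc: "eqs (c *s M) r = c * eqs M r" for M N c r
    unfolding eqs_def defs Ladd Lsc by (simp_all add: algebra_simps)
  have "Vector_Spaces.linear (*s) (*s) f"
    by (intro Vector_Spaces.linear.intro module_hom.intro module_hom_axioms.intro vec.vector_space_axioms
        vec.module_axioms) (simp_all add: f_def vec_eq_iff add sc)
  moreover have "f M $ (3, 3) = 0" for M by (simp add: f_def eqs_def)
  ultimately obtain M where M: "M \<noteq> 0" "f M = 0" using linear_kernel_nontrivial by blast
  have e0: "eqs M r = 0" for r
  proof -
    have "f M $ r = 0" by (simp add: M(2))
    then show ?thesis by (simp add: f_def)
  qed
  have e: "F M 1 = 2 * A M 2" "E M 1 = 2 * A M 3" "F M 2 = 2 * B M 1" "E M 3 = 2 * C M 1"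
    "D M 2 = 2 * B M 3" "D M 3 = 2 * C M 2" "E M 2 = D M 1" "F M 3 = D M 1"
    using e0[of "(1, 1)"] e0[of "(1, 2)"] e0[of "(1, 3)"] e0[of "(2, 1)"] e0[of "(2, 2)"] e0[of "(2, 3)"]
      e0[of "(3, 1)"] e0[of "(3, 2)"] by (simp_all add: eqs_def)
  define \<phi> where "\<phi> = cub (A M 1 / 3) (B M 2 / 3) (C M 3 / 3) (A M 2) (A M 3) (B M 1) (B M 3) (C M 1) (C M 2) (D M 1)"
  have comb: "Const (M $ (i, 1)) * p1 + Const (M $ (i, 2)) * p2 + Const (M $ (i, 3)) * p3 =
      qf (A M i) (B M i) (C M i) (D M i) (E M i) (F M i)" for i
    unfolding p1 p2 p3 qf_scale qf_add defs L_def ..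
  have d: "mp_diff i \<phi> = Const (M $ (i, 1)) * p1 + Const (M $ (i, 2)) * p2 + Const (M $ (i, 3)) * p3" for i
    unfolding comb using exhaust_3[of i] by (auto simp: \<phi>_def mp_diff_cub e)
  have "\<phi> \<noteq> 0"
  proof
    assume "\<phi> = 0"
    then have "M $ (i, 1) = 0 \<and> M $ (i, 2) = 0 \<and> M $ (i, 3) = 0" for i
      using d[of i] *(4) unfolding indep3_def by (metis mp_diff_0)
    then have "M $ (i, j) = 0" for i j using exhaust_3[of j] by auto
    then show False using M(1) by (simp add: vec_eq_iff)
  qed
  moreover have "mp_diff i \<phi> \<in> V" for i unfolding d *(5) in_span3 by blast
  ultimately show thesis using that[of \<phi>] by (simp add: \<phi>_def)
qed

lemma J_eq_of_indep3:
  assumes V: "V \<in> nets" and d: "\<And>i. mp_diff i \<phi> \<in> V"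
    and "indep3 (mp_diff 1 \<phi>) (mp_diff 2 \<phi>) (mp_diff 3 \<phi>)"
  shows "V = J \<phi>"
proof -
  obtain p q r where *: "V = mp.span {p, q, r}" using V nets_iff by blast
  show ?thesis
    unfolding J_def * by (rule span3_eq_of_indep3(1)[OF assms(3)]) (use d * in blast)+
qed

lemma J_lin_subst:
  fixes \<phi> :: "'a::field form"
  assumes A: "invertible A"
  shows "J (lin_subst A \<phi>) = lin_subst A ` J \<phi>"
proof -
  have sub: "J (lin_subst A \<psi>) \<subseteq> lin_subst A ` J \<psi>" for A and \<psi> :: "'a form"
  proof -
    have "mp_diff i (lin_subst A \<psi>) \<in> lin_subst A ` J \<psi>" for i
    proof -
      have "mp_diff i (lin_subst A \<psi>) = lin_subst A (Const (A $ 1 $ i) * mp_diff 1 \<psi> +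
          Const (A $ 2 $ i) * mp_diff 2 \<psi> + Const (A $ 3 $ i) * mp_diff 3 \<psi>)"
        by (simp add: mp_diff_lin_subst sum_3)
      moreover have "Const (A $ 1 $ i) * mp_diff 1 \<psi> + Const (A $ 2 $ i) * mp_diff 2 \<psi> + Const (A $ 3 $ i) * mp_diff 3 \<psi> \<in> J \<psi>"
        unfolding J_def in_span3 by blast
      ultimately show ?thesis by (rule image_eqI)
    qed
    moreover have "mp.subspace (lin_subst A ` J \<psi>)" unfolding J_def lin_subst_span by (rule mp.subspace_span)
    ultimately show ?thesis unfolding J_def[of "lin_subst A \<psi>"] by (intro mp.span_minimal) auto
  qed
  obtain B where B: "A ** B = mat 1" "B ** A = mat 1" using invertible_inverse[OF A] by blast
  have "lin_subst A ` J \<phi> = lin_subst A ` J (lin_subst B (lin_subst A \<phi>))"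
    using lin_subst_inverse[OF B(1)] by simp
  also have "\<dots> \<subseteq> lin_subst A ` lin_subst B ` J (lin_subst A \<phi>)" using sub by blast
  also have "\<dots> = J (lin_subst A \<phi>)" by (simp add: image_image lin_subst_inverse[OF B(2)])
  finally show ?thesis using sub by blast
qed

lemma J_Const_mult: "c \<noteq> 0 \<Longrightarrow> J (Const c * \<phi>) = J (\<phi> :: 'a::field form)"
proof -
  have sub: "J (Const c * \<psi>) \<subseteq> J \<psi>" for c and \<psi> :: "'a form"
    unfolding J_def by (rule mp.span_minimal) (auto intro: mp.span_scale mp.span_base)
  assume "c \<noteq> 0"
  then have "Const (1 / c) * Const c = (1 :: 'a form)" by (simp flip: Const_mult)
  then have "Const (1 / c) * (Const c * \<phi>) = \<phi>" by (simp flip: mult.assoc)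
  note eq = this
  show ?thesis using sub[of c \<phi>] sub[of "1 / c" "Const c * \<phi>"] unfolding eq by (rule subset_antisym)
qed

text \<open>Such an \<open>A\<close> sends (0, 0, 1) to \<open>u\<close>, so substituting it moves a
  chosen point or direction to the last coordinate.\<close>

lemma invertible_third_column:
  assumes "(u :: 'a::field^3) \<noteq> 0"
  obtains A :: "'a::field^3^3" where "invertible A" "\<forall>i. A $ i $ 3 = u $ i"
proof -
  consider "u $ 3 \<noteq> 0" | "u $ 1 \<noteq> 0" | "u $ 2 \<noteq> 0" using assms by (auto simp: vec_eq_iff forall_3)
  then show thesis
  proof cases
    case 1
    have "rows 1 0 (u$1) 0 1 (u$2) 0 0 (u$3) $ i $ 3 = u $ i" for i using exhaust_3[of i] by auto
    moreover have "invertible (rows 1 0 (u$1) 0 1 (u$2) 0 0 (u$3))" using 1 by (simp add: invertible_rows)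
    ultimately show thesis using that by blast
  next
    case 2
    have "rows 0 0 (u$1) 0 1 (u$2) 1 0 (u$3) $ i $ 3 = u $ i" for i using exhaust_3[of i] by auto
    moreover have "invertible (rows 0 0 (u$1) 0 1 (u$2) 1 0 (u$3))" using 2 by (simp add: invertible_rows)
    ultimately show thesis using that by blast
  next
    case 3
    have "rows 1 0 (u$1) 0 0 (u$2) 0 1 (u$3) $ i $ 3 = u $ i" for i using exhaust_3[of i] by auto
    moreover have "invertible (rows 1 0 (u$1) 0 0 (u$2) 0 1 (u$3))" using 3 by (simp add: invertible_rows)
    ultimately show thesis using that by blast
  qed
qed

lemma mp_diff_lin_subst_mem:
  assumes V: "(V :: 'a::field form set) \<in> nets" and A: "invertible A" and "\<And>i. mp_diff i \<phi> \<in> V"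
  shows "mp_diff i (lin_subst A \<phi>) \<in> lin_subst A ` V"
proof -
  have "Const (A $ 1 $ i) * mp_diff 1 \<phi> + Const (A $ 2 $ i) * mp_diff 2 \<phi> \<in> V"
    by (rule nets_add_mem[OF V assms(3) assms(3)])
  from nets_add_mem[OF V this assms(3), of 1 "A $ 3 $ i" 3]
  have "Const (A $ 1 $ i) * mp_diff 1 \<phi> + Const (A $ 2 $ i) * mp_diff 2 \<phi> + Const (A $ 3 $ i) * mp_diff 3 \<phi> \<in> V"
    by simp
  from imageI[OF this, of "lin_subst A"] show ?thesis by (simp add: mp_diff_lin_subst sum_3)
qed

text \<open>A dependence between the partial derivatives is a direction of zero derivative; once it
  is the Z-direction, the cubic is a binary form in X and Y. The pencil of its partial derivatives
  contains a form of zero discriminant, that is a square.\<close>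

lemma cone_partials_square:
  fixes V :: "'k::{alg_closed_field, field_char_0} form set"
  assumes V: "V \<in> nets" and \<phi>: "\<phi> \<in> R 3" "\<phi> \<noteq> 0" and d: "\<And>i. mp_diff i \<phi> \<in> V"
    and dep: "\<not> indep3 (mp_diff 1 \<phi>) (mp_diff 2 \<phi>) (mp_diff 3 \<phi>)"
  obtains A where "invertible A" "qf 1 0 0 0 0 0 \<in> lin_subst A ` V"
proof -
  obtain u1 u2 u3 where u: "Const u1 * mp_diff 1 \<phi> + Const u2 * mp_diff 2 \<phi> + Const u3 * mp_diff 3 \<phi> = 0"
    "u1 \<noteq> 0 \<or> u2 \<noteq> 0 \<or> u3 \<noteq> 0" using dep unfolding indep3_def by blast
  let ?u = "(\<chi> i. triple u1 u2 u3 i) :: 'k^3"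
  have "?u \<noteq> 0" using u(2) by (auto simp: vec_eq_iff forall_3)
  then obtain A :: "'k^3^3" where A: "invertible A" "\<forall>i. A $ i $ 3 = ?u $ i" by (rule invertible_third_column)
  define \<psi> where "\<psi> = lin_subst A \<phi>"
  define V' where "V' = lin_subst A ` V"
  have V': "V' \<in> nets" unfolding V'_def by (rule lin_subst_nets[OF A(1) V])
  have d': "mp_diff i \<psi> \<in> V'" for i unfolding \<psi>_def V'_def by (rule mp_diff_lin_subst_mem[OF V A(1) d])
  have "mp_diff 3 \<psi> = lin_subst A (Const u1 * mp_diff 1 \<phi> + Const u2 * mp_diff 2 \<phi> + Const u3 * mp_diff 3 \<phi>)"
    unfolding \<psi>_def mp_diff_lin_subst sum_3 A(2)[rule_format] by simp
  then have d3: "mp_diff 3 \<psi> = 0" using u(1) by simp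
  obtain B where B: "A ** B = mat 1" using invertible_inverse[OF A(1)] by blast
  have "\<psi> \<noteq> 0" using \<phi>(2) lin_subst_inverse[OF B, of \<phi>] unfolding \<psi>_def by force
  have "\<psi> \<in> R 3" unfolding \<psi>_def by (rule lin_subst_homogeneous[OF \<phi>(1)])
  then obtain a b c d e f g h i j where \<psi>: "\<psi> = cub a b c d e f g h i j" by (rule R3_cub)
  have z: "e = 0" "g = 0" "c = 0" "i = 0" "h = 0" "j = 0"
    using d3 unfolding \<psi> mp_diff_cub qf_eq_0_iff by auto
  have m1: "qf (3 * a) f 0 0 0 (2 * d) \<in> V'" and m2: "qf d (3 * b) 0 0 0 (2 * f) \<in> V'"
    using d'[of 1] d'[of 2] unfolding \<psi> mp_diff_cub z by simp_all
  have ne: "a \<noteq> 0 \<or> b \<noteq> 0 \<or> d \<noteq> 0 \<or> f \<noteq> 0" using \<open>\<psi> \<noteq> 0\<close> unfolding \<psi> z by (auto simp: cub_0)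
  obtain u v where uv: "u \<noteq> 0 \<or> v \<noteq> 0"
    "(4 * d\<^sup>2 - 12 * a * f) * u\<^sup>2 + (8 * d * f - 36 * a * b - 4 * d * f) * u * v + (4 * f\<^sup>2 - 12 * b * d) * v\<^sup>2 = 0"
    by (rule binary_quadratic_root)
  define P Q S where "P = u * (3 * a) + v * d" and "Q = u * f + v * (3 * b)" and "S = u * (2 * d) + v * (2 * f)"
  have m: "qf P Q 0 0 0 S \<in> V'"
    using nets_add_mem[OF V' m1 m2, of u v] by (simp add: qf_scale qf_add P_def Q_def S_def)
  have disc: "S\<^sup>2 = 4 * P * Q"
  proof -
    have "S\<^sup>2 - 4 * P * Q = 0" unfolding P_def Q_def S_def using uv(2) by algebra
    then show ?thesis by simp
  qed
  obtain P Q S where PQS: "qf P Q 0 0 0 S \<in> V'" "S\<^sup>2 = 4 * P * Q" "P \<noteq> 0 \<or> Q \<noteq> 0"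
  proof (cases "P = 0 \<and> Q = 0")
    case False
    then show thesis using that m disc by blast
  next
    \<comment> \<open>If the combination is zero, the two partial derivatives are proportional. Then
      the Hessian of the binary cubic vanishes, and each partial derivative is itself a
      square.\<close>
    case True
    then have "S = 0" using disc by simp
    with True have eq: "u * (3 * a) + v * d = 0" "u * f + v * (3 * b) = 0" "u * (2 * d) + v * (2 * f) = 0"
      unfolding P_def Q_def S_def by simp_all
    have k: "d * d = 3 * a * f" "f * f = 3 * b * d"
    proof -
      have "u * (d * d - 3 * a * f) = 0" "v * (d * d - 3 * a * f) = 0" "u * (f * f - 3 * b * d) = 0" "v * (f * f - 3 * b * d) = 0"
        using eq by algebra+
      then show "d * d = 3 * a * f" "f * f = 3 * b * d" using uv(1) by auto
    qed
    consider "a \<noteq> 0 \<or> f \<noteq> 0" | "b \<noteq> 0 \<or> d \<noteq> 0" using ne by blast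
    then show thesis
    proof cases
      case 1
      then show thesis using that[OF m1] k by (auto simp: power2_eq_square)
    next
      case 2
      then show thesis using that[OF m2] k by (auto simp: power2_eq_square)
    qed
  qed
  obtain C where C: "invertible C" "qf 1 0 0 0 0 0 \<in> lin_subst C ` V'" by (rule square_case_binary[OF V' PQS])
  have "qf 1 0 0 0 0 0 \<in> lin_subst (A ** C) ` V"
    using C(2) unfolding V'_def image_image lin_subst_lin_subst .
  then show thesis using that invertible_mult[OF A(1) C(1)] by blast
qed

lemma span_of_mem:
  assumes V: "V \<in> nets" and "indep3 p q r" "p \<in> V" "q \<in> V" "r \<in> V"
  shows "V = mp.span {p, q, r}"
proof -
  obtain u v w where *: "V = mp.span {u, v, w}" using V nets_iff by blast
  show ?thesis unfolding * by (rule span3_eq_of_indep3(1)[OF assms(2)]) (use assms(3-5) * in blast)+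
qed

text \<open>The third column is prescribed so that the derivative in Z is transformed as a form,
  with no other derivative mixed in.\<close>

lemma binary_quadratic_normal_form:
  fixes e g j :: "'k::{alg_closed_field, field_char_0}"
  assumes ne: "e \<noteq> 0 \<or> g \<noteq> 0 \<or> j \<noteq> 0"
  obtains A :: "'k::{alg_closed_field, field_char_0}^3^3" where "invertible A" "\<forall>i. A $ i $ 3 = (if i = 3 then 1 else 0)"
    "lin_subst A (qf e g 0 0 0 j) = qf 0 0 0 0 0 1 \<or> lin_subst A (qf e g 0 0 0 j) = qf 1 0 0 0 0 0"
proof -
  have third: "rows p q 0 r s 0 0 0 1 $ i $ 3 = (if i = 3 then 1 else 0)" for p q r s :: 'k and i
    using exhaust_3[of i] by auto
  obtain t where t: "t ^ 2 = j\<^sup>2 - 4 * e * g" using nth_root_exists'[of 2 "j\<^sup>2 - 4 * e * g"] by auto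
  consider "e \<noteq> 0" "t \<noteq> 0" | "e \<noteq> 0" "t = 0" | "e = 0" "j \<noteq> 0" | "e = 0" "j = 0" "g \<noteq> 0" using ne by blast
  then show thesis
  proof cases
    case 1
    \<comment> \<open>\<open>v\<close>, \<open>w\<close>, \<open>h\<close> stand for reciprocals, so
      that \<open>algebra\<close> only meets polynomial identities. The columns (p, w) and (q, s) of
      the matrix are the two zeros of the form, scaled so that its polar form takes the value 1 on
      them.\<close>
    define v w h where "v = 1 / e" and "w = 1 / t" and "h = (1 / 2 :: 'k)"
    have vwh: "v * e = 1" "w * t = 1" "2 * h = 1" using 1 by (simp_all add: v_def w_def h_def)
    have t2: "t * t = j * j - 4 * e * g" using t by (simp add: power2_eq_square)
    define p q s where "p = (t - j) * w * v * h" and "q = (t + j) * w * h" and "s = - (e * w)"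
    have c: "e * (p * p) + g * (w * w) + j * (p * w) = 0" "e * (q * q) + g * (s * s) + j * (q * s) = 0"
      "2 * (e * p * q + g * w * s) + j * (p * s + q * w) = 1"
      unfolding p_def q_def s_def using vwh t2 by algebra+
    have "t * (p * s - q * w) = - 1" unfolding p_def q_def s_def using vwh by algebra
    then have nz: "p * s - q * w \<noteq> 0" by auto
    have "lin_subst (rows p q 0 w s 0 0 0 1) (qf e g 0 0 0 j) = qf 0 0 0 0 0 1"
      unfolding lin_subst_qf qf_eq_iff using c by (simp add: power2_eq_square)
    moreover have "invertible (rows p q 0 w s 0 0 0 1)" using nz by (simp add: invertible_rows)
    ultimately show thesis using that third by blast
  next
    case 2
    obtain x where x: "x ^ 2 = e" using nth_root_exists'[of 2 e] by auto
    then have x0: "x \<noteq> 0" using 2 by auto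
    have "g = j * j / (4 * e)" using t 2 by (simp add: field_simps power2_eq_square)
    then show thesis
      using 2 x0 by (intro that[of "rows (1 / x) (- j / (2 * e)) 0 0 1 0 0 0 1"])
        (auto simp: third invertible_rows lin_subst_qf qf_eq_iff field_simps power2_eq_square x[symmetric])
  next
    case 3
    then show thesis
      by (intro that[of "rows (1 / j) (- g / j) 0 0 1 0 0 0 1"])
        (auto simp: third invertible_rows lin_subst_qf qf_eq_iff field_simps power2_eq_square)
  next
    case 4
    obtain x where x: "x ^ 2 = g" using nth_root_exists'[of 2 g] by auto
    then have x0: "x \<noteq> 0" using 4 by auto
    show thesis
      using 4 x0 by (intro that[of "rows 0 1 0 (1 / x) 0 0 0 0 1"])
        (auto simp: third invertible_rows lin_subst_qf qf_eq_iff field_simps power2_eq_square x[symmetric])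
  qed
qed

text \<open>With the singular point at (0, 0, 1) the derivative in Z is a binary quadratic form in X
  and Y, nonzero by independence. If it is XY, the cubic is nodal, a conic with a secant, or a
  triangle (#8a, #7a, #6a); if it is X^2, the cubic is cuspidal or a conic with a tangent (#5b,
  #4).\<close>

lemma net_of_singular_cubic:
  fixes V :: "'k::{alg_closed_field, field_char_0} form set"
  assumes V: "V \<in> nets" and \<phi>: "\<phi> \<in> R 3" and d: "\<And>i. mp_diff i \<phi> \<in> V"
    and ind: "indep3 (mp_diff 1 \<phi>) (mp_diff 2 \<phi>) (mp_diff 3 \<phi>)"
    and p: "p \<noteq> 0" "\<And>i. mp_eval (($) p) (mp_diff i \<phi>) = 0"
  shows "\<exists>N\<in>{net_8a, net_7a, net_6a, net_5b, net_4}. N \<in> orbit V"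
proof -
  obtain A0 :: "'k^3^3" where A0: "invertible A0" "\<forall>i. A0 $ i $ 3 = p $ i" by (rule invertible_third_column[OF p(1)])
  define \<psi> where "\<psi> = lin_subst A0 \<phi>"
  have "mp_eval (($) (axis 3 1)) (mp_diff i \<psi>) = 0" for i
  proof -
    have "A0 *v axis 3 1 = p"
      unfolding matrix_vector_mul_component vec_eq_iff by (simp add: matrix_vector_mult_def sum_3 axis_def A0(2)[rule_format])
    then show ?thesis unfolding \<psi>_def mp_diff_lin_subst sum_3 by (simp add: mp_eval_lin_subst p(2))
  qed
  note sing = this[of 1] this[of 2] this[of 3]
  have "\<psi> \<in> R 3" unfolding \<psi>_def by (rule lin_subst_homogeneous[OF \<phi>])
  then obtain a b c d' e f g h i j where \<psi>: "\<psi> = cub a b c d' e f g h i j" by (rule R3_cub)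
  have z: "c = 0" "h = 0" "i = 0" using sing unfolding \<psi> mp_diff_cub mp_eval_qf by (simp_all add: axis_def)
  define V0 where "V0 = lin_subst A0 ` V"
  have V0: "V0 \<in> nets" unfolding V0_def by (rule lin_subst_nets[OF A0(1) V])
  have J0: "V0 = J \<psi>" unfolding V0_def \<psi>_def J_lin_subst[OF A0(1)] using J_eq_of_indep3[OF V d ind] by simp
  have ind0: "indep3 (mp_diff 1 \<psi>) (mp_diff 2 \<psi>) (mp_diff 3 \<psi>)"
    by (rule nets_span3(2)[OF V0]) (simp add: J0 J_def)
  have "e \<noteq> 0 \<or> g \<noteq> 0 \<or> j \<noteq> 0"
  proof (rule ccontr)
    assume "\<not> ?thesis"
    then have "mp_diff 3 \<psi> = 0" unfolding \<psi> mp_diff_cub z by (simp add: qf_0)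
    then show False using ind0 unfolding indep3_def by (metis add_0 mult_zero_right mult_zero_left Const_0 one_neq_zero)
  qed
  then obtain A :: "'k^3^3" where A: "invertible A" "\<forall>i. A $ i $ 3 = (if i = 3 then 1 else 0)"
    "lin_subst A (qf e g 0 0 0 j) = qf 0 0 0 0 0 1 \<or> lin_subst A (qf e g 0 0 0 j) = qf 1 0 0 0 0 0"
    by (rule binary_quadratic_normal_form)
  define \<xi> where "\<xi> = lin_subst A \<psi>"
  define W where "W = J \<xi>"
  have W: "W = lin_subst A ` V0" unfolding W_def \<xi>_def J_lin_subst[OF A(1)] J0 ..
  have WN: "W \<in> nets" unfolding W by (rule lin_subst_nets[OF A(1) V0])
  have WV: "W \<in> orbit V"
    unfolding W V0_def image_image lin_subst_lin_subst orbit_def using invertible_mult[OF A0(1) A(1)] by blast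
  have d3: "mp_diff 3 \<xi> = lin_subst A (qf e g 0 0 0 j)"
    unfolding \<xi>_def mp_diff_lin_subst sum_3 A(2)[rule_format] by (simp add: \<psi> mp_diff_cub z)
  have "\<xi> \<in> R 3" unfolding \<xi>_def by (rule lin_subst_homogeneous[OF \<open>\<psi> \<in> R 3\<close>])
  then obtain a b c d e f g h i j where \<xi>: "\<xi> = cub a b c d e f g h i j" by (rule R3_cub)
  have "qf e g (3 * c) (2 * i) (2 * h) j = qf 0 0 0 0 0 1 \<or> qf e g (3 * c) (2 * i) (2 * h) j = qf 1 0 0 0 0 0"
    using A(3) d3 unfolding \<xi> mp_diff_cub by simp
  then consider (node) "e = 0" "g = 0" "c = 0" "i = 0" "h = 0" "j = 1" | (cusp) "e = 1" "g = 0" "c = 0" "i = 0" "h = 0" "j = 0"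
    unfolding qf_eq_iff by auto
  then have "\<exists>N\<in>{net_8a, net_7a, net_6a, net_5b, net_4}. N \<in> orbit W"
  proof cases
    case node
    have We: "W = mp.span {qf (3 * a) f 0 1 0 (2 * d), qf d (3 * b) 0 0 1 (2 * f), qf 0 0 0 0 0 1}"
      unfolding W_def J_def \<xi> mp_diff_cub node by simp
    note st = orbit_rowsI[OF refl WN[unfolded We]]
    consider "a \<noteq> 0" "b \<noteq> 0" | "a \<noteq> 0" "b = 0" | "a = 0" "b \<noteq> 0" | "a = 0" "b = 0" by blast
    then show ?thesis
    proof cases
      case ab: 1
      \<comment> \<open>The scalings \<open>x\<close> of X and \<open>y\<close> of Y are to satisfy
        3 a x^2 = y and 3 b y^2 = x; eliminating y gives the cube root.\<close>
      obtain x where x: "x ^ 3 = 1 / (27 * a\<^sup>2 * b)" using nth_root_exists'[of 3 "1 / (27 * a\<^sup>2 * b)"] by auto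
      then have x0: "x \<noteq> 0" using ab by auto
      have x3: "x * x * x * a * a * b * 27 = 1" using x ab by (simp add: field_simps power2_eq_square power3_eq_cube)
      define y where "y = 3 * a * x\<^sup>2"
      have y: "y = 3 * a * x * x" "3 * b * y * y = x"
      proof -
        show "y = 3 * a * x * x" by (simp add: y_def power2_eq_square)
        have "3 * b * y * y = x * (x * x * x * a * a * b * 27)" by (simp add: y_def power2_eq_square)
        then show "3 * b * y * y = x" unfolding x3 by simp
      qed
      have y0: "y \<noteq> 0" using x0 ab by (simp add: y_def)
      have "net_8a \<in> orbit W"
        unfolding We named_nets_qf
        by (rule st[of x 0 0 0 y 0 "- (d * x)" "- (f * y)" 1 "d * x * y" _ y _ 0 _ "f * x * y" 0 x "x * y" 0 0],
        unfold qf_subst) (use x0 y0 y in \<open>simp_all add: algebra_simps power2_eq_square\<close>)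
      then show ?thesis by blast
    next
      case ab: 2
      have "net_7a \<in> orbit W"
        unfolding We named_nets_qf
        by (rule st[of 1 0 0 0 1 0 "- d" "- f" "3 * a" "3 * a" _ d _ 0 _ 0 f "3 * a" 0 1 0],
        unfold qf_subst) (use ab in \<open>simp_all add: algebra_simps power2_eq_square\<close>)
      then show ?thesis by blast
    next
      case ab: 3
      have "net_7a \<in> orbit W"
        unfolding We named_nets_qf
        by (rule st[of 0 1 0 1 0 0 "- f" "- d" "3 * b" 0 _ d _ "3 * b" _ "3 * b" f 0 0 1 0],
        unfold qf_subst) (use ab in \<open>simp_all add: algebra_simps power2_eq_square\<close>)
      then show ?thesis by blast
    next
      case ab: 4
      have "net_6a \<in> orbit W"
        unfolding We named_nets_qf
        by (rule st[of 1 0 0 0 1 0 "- d" "- f" 1 d _ 1 _ 0 _ f 0 1 1 0 0],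
        unfold qf_subst) (use ab in \<open>simp_all add: algebra_simps power2_eq_square\<close>)
      then show ?thesis by blast
    qed
  next
    case cusp
    have We: "W = mp.span {qf (3 * a) f 0 0 2 (2 * d), qf d (3 * b) 0 0 0 (2 * f), qf 1 0 0 0 0 0}"
      unfolding W_def J_def \<xi> mp_diff_cub cusp by simp
    note st = orbit_rowsI[OF refl WN[unfolded We]]
    show ?thesis
    proof (cases "b = 0")
      case False
      define s where "s = f / (3 * b)"
      have f: "f = 3 * b * s" using False by (simp add: s_def)
      have "net_5b \<in> orbit W"
        unfolding We named_nets_qf
        by (rule st[of 0 1 0 0 "- s" 1 "1 / 2" 0 "f * s - d" "3 * a + f * s\<^sup>2 - 2 * d * s" _ f _ 1 _ "d - 3 * b * s\<^sup>2" "3 * b" 0 1 0 0],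
        unfold qf_subst) (use False in \<open>simp_all add: f field_simps power2_eq_square\<close>)
      then show ?thesis by blast
    next
      case True
      have "f \<noteq> 0"
      proof
        assume "f = 0"
        have "indep3 (mp_diff 1 \<xi>) (mp_diff 2 \<xi>) (mp_diff 3 \<xi>)"
          by (rule nets_span3(2)[OF WN]) (simp add: W_def J_def)
        then have "indep3 (qf (3 * a) 0 0 0 2 (2 * d)) (qf d 0 0 0 0 0) (qf 1 0 0 0 0 0)"
          unfolding \<xi> mp_diff_cub cusp True \<open>f = 0\<close> by simp
        moreover have "Const 0 * qf (3 * a) 0 0 0 2 (2 * d) + Const (-1) * qf d 0 0 0 0 0 + Const d * qf 1 0 0 0 0 0 = 0"
          by (simp add: qf_scale qf_add qf_0)
        ultimately show False unfolding indep3_def by (metis neg_equal_0_iff_equal one_neq_zero)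
      qed
      have "net_4 \<in> orbit W"
        unfolding We named_nets_qf
        by (rule st[of 0 1 0 1 0 0 "- d" 0 "f / 2" f _ 0 _ "3 * a" _ 0 "2 * f" d 0 0 1],
        unfold qf_subst) (use \<open>f \<noteq> 0\<close> True in \<open>simp_all add: field_simps power2_eq_square\<close>)
      then show ?thesis by blast
    qed
  qed
  then show ?thesis using WV orbit_trans by blast
qed

section \<open>Singular points of the discriminant\<close>

text \<open>Each degenerate alternative keeps its geometric datum, base point or square, next to the
  orbit: the datum serves to show that the discriminant is singular, the orbit serves in the
  analysis of closures.\<close>

theorem classification_of_nets:
  fixes V :: "'k::{alg_closed_field, field_char_0} form set"
  assumes V: "V \<in> nets"
  shows "(\<exists>\<phi>. smooth_cubic \<phi> \<and> V = J \<phi>) \<or>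
    (\<exists>p. p \<noteq> 0 \<and> (\<forall>q\<in>V. mp_eval (($) p) q = 0) \<and> (\<exists>N\<in>{net_8a, net_7a, net_6a, net_5b, net_4}. N \<in> orbit V)) \<or>
    (\<exists>A. invertible A \<and> qf 1 0 0 0 0 0 \<in> lin_subst A ` V \<and> orbit_of_square V)"
proof -
  obtain \<phi> where \<phi>: "\<phi> \<in> R 3" "\<phi> \<noteq> 0" "\<And>i. mp_diff i \<phi> \<in> V" by (rule net_contains_partials[OF V]) blast
  show ?thesis
  proof (cases "indep3 (mp_diff 1 \<phi>) (mp_diff 2 \<phi>) (mp_diff 3 \<phi>)")
    case False
    obtain A where A: "invertible A" "qf 1 0 0 0 0 0 \<in> lin_subst A ` V"
      by (rule cone_partials_square[OF V \<phi> False])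
    have "orbit_of_square V"
      by (rule orbit_of_square_lin_subst[OF A(1) square_case_XX[OF lin_subst_nets[OF A(1) V] A(2)]])
    with A have "\<exists>A. invertible A \<and> qf 1 0 0 0 0 0 \<in> lin_subst A ` V \<and> orbit_of_square V"
      by (intro exI conjI)
    then show ?thesis by (intro disjI2)
  next
    case True
    have J: "V = J \<phi>" by (rule J_eq_of_indep3[OF V \<phi>(3) True])
    show ?thesis
    proof (cases "smooth_cubic \<phi>")
      case True
      with J have "\<exists>\<phi>. smooth_cubic \<phi> \<and> V = J \<phi>" by (intro exI conjI)
      then show ?thesis by (rule disjI1)
    next
      case False
      then obtain p where "singular_point \<phi> p" unfolding smooth_cubic_def using \<phi>(1) by blast
      then have p: "p \<noteq> 0" "\<And>i. mp_eval (($) p) (mp_diff i \<phi>) = 0" unfolding singular_point_def by blast+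
      have "mp_eval (($) p) q = 0" if "q \<in> V" for q
      proof -
        obtain a b c where q: "q = Const a * mp_diff 1 \<phi> + Const b * mp_diff 2 \<phi> + Const c * mp_diff 3 \<phi>"
          using \<open>q \<in> V\<close> unfolding J J_def in_span3 by blast
        show ?thesis unfolding q by (simp add: p(2))
      qed
      then have "\<forall>q\<in>V. mp_eval (($) p) q = 0" by (rule ballI)
      with p(1) net_of_singular_cubic[OF V \<phi>(1,3) True p]
      have "\<exists>p. p \<noteq> 0 \<and> (\<forall>q\<in>V. mp_eval (($) p) q = 0) \<and> (\<exists>N\<in>{net_8a, net_7a, net_6a, net_5b, net_4}. N \<in> orbit V)"
        by (intro exI conjI)
      then show ?thesis by (intro disjI2 disjI1)
    qed
  qed
qed

section \<open>The gradient of the determinant\<close>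

lemma conic_matrix_comb:
  "conic_matrix (Const x * p + Const y * q + Const z * r) $ i $ j =
   x * conic_matrix p $ i $ j + y * conic_matrix q $ i $ j + z * conic_matrix r $ i $ j"
  by (simp add: conic_matrix_def lookup_add add_divide_distrib)

lemma conic_matrix_sym: "conic_matrix q $ i $ j = conic_matrix q $ j $ i"
  by (simp add: conic_matrix_def add.commute)

lemma mp_eval_conic:
  assumes "q \<in> R 2"
  shows "mp_eval (($) p) q = (\<Sum>i\<in>UNIV. \<Sum>j\<in>UNIV. conic_matrix q $ i $ j * p $ i * (p $ j :: 'a::field_char_0))"
proof -
  obtain a b c d e f where q: "q = qf a b c d e f" using qf_in_R2_ex[OF assms] by blast
  show ?thesis unfolding q conic_matrix_qf by (simp add: sum_3 algebra_simps power2_eq_square)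
qed

text \<open>The second equation is Jacobi's formula: the derivative in direction \<open>l\<close> is
  the trace of adj(m) times \<open>S l\<close>, written out along the rows.\<close>

lemma discriminant_eval:
  fixes b :: "3 \<Rightarrow> 'a::field form" and x :: "'a^3"
  defines "S \<equiv> \<lambda>l. conic_matrix (b l)"
  defines "m \<equiv> conic_matrix (Const (x $ 1) * b 1 + Const (x $ 2) * b 2 + Const (x $ 3) * b 3)"
  shows "mp_eval (($) x) (discriminant_form b) =
      m$1$1 * (m$2$2 * m$3$3 - m$2$3 * m$3$2) - m$1$2 * (m$2$1 * m$3$3 - m$2$3 * m$3$1) + m$1$3 * (m$2$1 * m$3$2 - m$2$2 * m$3$1)"
    and "mp_eval (($) x) (mp_diff l (discriminant_form b)) =
      S l$1$1 * (m$2$2 * m$3$3 - m$2$3 * m$3$2) - S l$1$2 * (m$2$1 * m$3$3 - m$2$3 * m$3$1) + S l$1$3 * (m$2$1 * m$3$2 - m$2$2 * m$3$1) +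
      m$1$1 * (S l$2$2 * m$3$3 + m$2$2 * S l$3$3 - S l$2$3 * m$3$2 - m$2$3 * S l$3$2) -
      m$1$2 * (S l$2$1 * m$3$3 + m$2$1 * S l$3$3 - S l$2$3 * m$3$1 - m$2$3 * S l$3$1) +
      m$1$3 * (S l$2$1 * m$3$2 + m$2$1 * S l$3$2 - S l$2$2 * m$3$1 - m$2$2 * S l$3$1)"
proof -
  define M :: "3 \<Rightarrow> 3 \<Rightarrow> 'a form" where "M i j = Const (S 1 $ i $ j) * X + Const (S 2 $ i $ j) * Y + Const (S 3 $ i $ j) * Z" for i j
  have F: "discriminant_form b = M 1 1 * (M 2 2 * M 3 3 - M 2 3 * M 3 2) - M 1 2 * (M 2 1 * M 3 3 - M 2 3 * M 3 1) +
      M 1 3 * (M 2 1 * M 3 2 - M 2 2 * M 3 1)"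
  proof -
    have "(\<Sum>l\<in>UNIV. Const (conic_matrix (b l) $ i $ j) * Var l) = M i j" for i j
      by (simp add: sum_3 M_def S_def)
    then show ?thesis unfolding discriminant_form_def by (simp add: det_3 algebra_simps)
  qed
  have e: "mp_eval (($) x) (M i j) = m $ i $ j" for i j
    unfolding m_def conic_matrix_comb by (simp add: M_def S_def mult.commute)
  have d: "mp_diff l (M i j) = Const (S l $ i $ j)" for i j
    using exhaust_3[of l] by (auto simp: M_def mp_diff_Var)
  show "mp_eval (($) x) (discriminant_form b) =
      m$1$1 * (m$2$2 * m$3$3 - m$2$3 * m$3$2) - m$1$2 * (m$2$1 * m$3$3 - m$2$3 * m$3$1) + m$1$3 * (m$2$1 * m$3$2 - m$2$2 * m$3$1)"
    unfolding F by (simp add: e)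
  show "mp_eval (($) x) (mp_diff l (discriminant_form b)) =
      S l$1$1 * (m$2$2 * m$3$3 - m$2$3 * m$3$2) - S l$1$2 * (m$2$1 * m$3$3 - m$2$3 * m$3$1) + S l$1$3 * (m$2$1 * m$3$2 - m$2$2 * m$3$1) +
      m$1$1 * (S l$2$2 * m$3$3 + m$2$2 * S l$3$3 - S l$2$3 * m$3$2 - m$2$3 * S l$3$2) -
      m$1$2 * (S l$2$1 * m$3$3 + m$2$1 * S l$3$3 - S l$2$3 * m$3$1 - m$2$3 * S l$3$1) +
      m$1$3 * (S l$2$1 * m$3$2 + m$2$1 * S l$3$2 - S l$2$2 * m$3$1 - m$2$2 * S l$3$1)"
    unfolding F by (simp add: e d algebra_simps)
qed

text \<open>The square of a linear form has a symmetric matrix of rank one. Its adjugate vanishes,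
  and with it the determinant and the gradient.\<close>

lemma square_imp_discriminant_singular:
  fixes V :: "'a::field_char_0 form set"
  assumes b: "is_basis b V" and A: "invertible A" "qf 1 0 0 0 0 0 \<in> lin_subst A ` V"
  shows "\<exists>x. singular_point (discriminant_form b) x"
proof -
  obtain q where q: "q \<in> V" "lin_subst A q = qf 1 0 0 0 0 0" using A(2) by force
  obtain B where B: "A ** B = mat 1" using invertible_inverse[OF A(1)] by blast
  have q': "q = lin_subst B (qf 1 0 0 0 0 0)" using lin_subst_inverse[OF B, of q] q(2) by simp
  obtain u v w where uvw: "q = Const u * b 1 + Const v * b 2 + Const w * b 3"
    using q(1) b unfolding is_basis_iff in_span3 by (metis in_span3)
  define x :: "'a^3" where "x = (\<chi> i. triple u v w i)"
  have xs: "x $ 1 = u" "x $ 2 = v" "x $ 3 = w" by (simp_all add: x_def)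
  have "q \<noteq> 0"
  proof
    assume "q = 0"
    then have "qf 1 0 0 0 0 (0::'a) = 0" using q(2) by simp
    then show False by (simp add: qf_eq_0_iff)
  qed
  have "x \<noteq> 0"
  proof
    assume "x = 0"
    then have "u = 0" "v = 0" "w = 0" using xs by simp_all
    then show False using \<open>q \<noteq> 0\<close> uvw by simp
  qed
  have m: "conic_matrix q $ i $ j = B $ 1 $ i * B $ 1 $ j" for i j
    unfolding q' lin_subst_qf conic_matrix_qf using exhaust_3[of i] exhaust_3[of j]
    by (auto simp: power2_eq_square)
  have "singular_point (discriminant_form b) x"
    unfolding singular_point_def discriminant_eval xs uvw[symmetric] m using \<open>x \<noteq> 0\<close>
    by (simp add: algebra_simps conic_matrix_sym[of _ 2 1] conic_matrix_sym[of _ 3 1] conic_matrix_sym[of _ 3 2])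
  then show ?thesis by blast
qed

text \<open>The columns of \<open>N\<close> are the vectors \<open>S l\<close> p. Since p is a base
  point, p^T N = 0, so some member m of the net satisfies m p = 0. Its adjugate is a multiple of p
  p^T, hence by Jacobi's formula every derivative is a multiple of p^T (\<open>S l\<close>) p =
  0.\<close>

lemma base_point_imp_discriminant_singular:
  fixes V :: "'a::field_char_0 form set"
  assumes V: "V \<in> nets" and b: "is_basis b V" and p: "p \<noteq> 0" "\<forall>q\<in>V. mp_eval (($) p) q = 0"
  shows "\<exists>x. singular_point (discriminant_form b) x"
proof -
  have bV: "b i \<in> V" for i using b unfolding is_basis_def by (metis mp.span_base rangeI)
  define S where "S l = conic_matrix (b l)" for l
  have Sym: "S l $ i $ j = S l $ j $ i" for l i j unfolding S_def by (rule conic_matrix_sym)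
  have bp: "S l$1$1 * p$1 * p$1 + S l$2$2 * p$2 * p$2 + S l$3$3 * p$3 * p$3 + 2 * S l$1$2 * p$1 * p$2 +
      2 * S l$1$3 * p$1 * p$3 + 2 * S l$2$3 * p$2 * p$3 = 0" for l
  proof -
    have "mp_eval (($) p) (b l) = 0" using p(2) bV by blast
    then show ?thesis unfolding mp_eval_conic[OF nets_R2[OF V bV]] S_def[symmetric]
      by (simp add: sum_3 Sym[of l 2 1] Sym[of l 3 1] Sym[of l 3 2] algebra_simps)
  qed
  define N :: "'a^3^3" where "N = (\<chi> i l. S l$i$1 * p$1 + S l$i$2 * p$2 + S l$i$3 * p$3)"
  have pN: "p$1 * N$1$l + p$2 * N$2$l + p$3 * N$3$l = 0" for l
    using bp[of l] by (simp add: N_def Sym[of l 2 1] Sym[of l 3 1] Sym[of l 3 2] algebra_simps)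
  have "\<not> invertible N"
  proof
    assume "invertible N"
    then obtain M where M: "N ** M = mat 1" using invertible_inverse by blast
    have "p $ l = 0" for l
    proof -
      have "p$1 * (N ** M)$1$l + p$2 * (N ** M)$2$l + p$3 * (N ** M)$3$l =
          (p$1 * N$1$1 + p$2 * N$2$1 + p$3 * N$3$1) * M$1$l + (p$1 * N$1$2 + p$2 * N$2$2 + p$3 * N$3$2) * M$2$l +
          (p$1 * N$1$3 + p$2 * N$2$3 + p$3 * N$3$3) * M$3$l"
        by (simp add: matrix_matrix_mult_def sum_3 algebra_simps)
      then show ?thesis unfolding pN M using exhaust_3[of l] by (auto simp: mat_def)
    qed
    then show False using p(1) by (simp add: vec_eq_iff)
  qed
  then obtain x where x: "x \<noteq> 0" "N *v x = 0"
    unfolding invertible_left_inverse matrix_left_invertible_ker by blast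
  define q where "q = Const (x $ 1) * b 1 + Const (x $ 2) * b 2 + Const (x $ 3) * b 3"
  define m where "m = conic_matrix q"
  have sm: "m $ i $ j = m $ j $ i" for i j unfolding m_def by (rule conic_matrix_sym)
  have mp: "m$i$1 * p$1 + m$i$2 * p$2 + m$i$3 * p$3 = 0" for i
  proof -
    have "(N *v x) $ i = 0" by (simp add: x(2))
    then show ?thesis unfolding m_def q_def conic_matrix_comb S_def[symmetric]
      by (simp add: N_def matrix_vector_mult_def sum_3 algebra_simps)
  qed
  \<comment> \<open>Multiplying by squares of the coordinates of p expresses that the adjugate is a
    multiple of p p^T without naming the factor.\<close>
  have alg: "p1 * p1 * D = 0 \<and> p2 * p2 * D = 0 \<and> p3 * p3 * D = 0"
    if "m11 * p1 + m12 * p2 + m13 * p3 = 0" "m12 * p1 + m22 * p2 + m23 * p3 = 0" "m13 * p1 + m23 * p2 + m33 * p3 = 0"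
      "s11 * p1 * p1 + s22 * p2 * p2 + s33 * p3 * p3 + 2 * s12 * p1 * p2 + 2 * s13 * p1 * p3 + 2 * s23 * p2 * p3 = 0"
      "D = s11 * (m22 * m33 - m23 * m23) - s12 * (m12 * m33 - m23 * m13) + s13 * (m12 * m23 - m22 * m13) +
      m11 * (s22 * m33 + m22 * s33 - s23 * m23 - m23 * s23) - m12 * (s12 * m33 + m12 * s33 - s23 * m13 - m23 * s13) +
      m13 * (s12 * m23 + m12 * s23 - s22 * m13 - m22 * s13)"
    for m11 m12 m13 m22 m23 m33 s11 s12 s13 s22 s23 s33 p1 p2 p3 D :: 'a
    using that by (intro conjI) algebra+
  have alg2: "p1 * D = 0 \<and> p2 * D = 0 \<and> p3 * D = 0"
    if "m11 * p1 + m12 * p2 + m13 * p3 = 0" "m12 * p1 + m22 * p2 + m23 * p3 = 0" "m13 * p1 + m23 * p2 + m33 * p3 = 0"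
      "D = m11 * (m22 * m33 - m23 * m23) - m12 * (m12 * m33 - m23 * m13) + m13 * (m12 * m23 - m22 * m13)"
    for m11 m12 m13 m22 m23 m33 p1 p2 p3 D :: 'a
    using that by (intro conjI) algebra+
  note mps = mp[of 1] mp[of 2, unfolded sm[of 2 1]] mp[of 3, unfolded sm[of 3 1] sm[of 3 2]]
  have p0: "p$1 \<noteq> 0 \<or> p$2 \<noteq> 0 \<or> p$3 \<noteq> 0" using p(1) by (auto simp: vec_eq_iff forall_3)
  have "singular_point (discriminant_form b) x"
    unfolding singular_point_def discriminant_eval q_def[symmetric] m_def[symmetric] S_def[symmetric]
      sm[of 2 1] sm[of 3 1] sm[of 3 2] Sym[of _ 2 1] Sym[of _ 3 1] Sym[of _ 3 2]
  proof (intro conjI allI)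
    show "x \<noteq> 0" by (rule x(1))
    show "m$1$1 * (m$2$2 * m$3$3 - m$2$3 * m$2$3) - m$1$2 * (m$1$2 * m$3$3 - m$2$3 * m$1$3) + m$1$3 * (m$1$2 * m$2$3 - m$2$2 * m$1$3) = 0"
      using alg2[OF mps refl] p0 by (metis mult_eq_0_iff)
    fix l
    show "S l$1$1 * (m$2$2 * m$3$3 - m$2$3 * m$2$3) - S l$1$2 * (m$1$2 * m$3$3 - m$2$3 * m$1$3) + S l$1$3 * (m$1$2 * m$2$3 - m$2$2 * m$1$3) +
      m$1$1 * (S l$2$2 * m$3$3 + m$2$2 * S l$3$3 - S l$2$3 * m$2$3 - m$2$3 * S l$2$3) -
      m$1$2 * (S l$1$2 * m$3$3 + m$1$2 * S l$3$3 - S l$2$3 * m$1$3 - m$2$3 * S l$1$3) +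
      m$1$3 * (S l$1$2 * m$2$3 + m$1$2 * S l$2$3 - S l$2$2 * m$1$3 - m$2$2 * S l$1$3) = 0"
      using alg[OF mps bp[of l] refl] p0 by (metis mult_eq_0_iff)
  qed
  then show ?thesis by blast
qed

theorem smooth_discriminant_imp_J:
  fixes V :: "'k::{alg_closed_field, field_char_0} form set"
  assumes V: "V \<in> nets" and "discriminant_cubic smooth_cubic V"
  shows "\<exists>\<phi>. smooth_cubic \<phi> \<and> V = J \<phi>"
proof -
  obtain b where b: "is_basis b V" "smooth_cubic (discriminant_form b)"
    using assms(2) unfolding discriminant_cubic_def by blast
  then have ns: "\<nexists>x. singular_point (discriminant_form b) x" unfolding smooth_cubic_def by blast
  from classification_of_nets[OF V] show ?thesis
    using ns square_imp_discriminant_singular[OF b(1)] base_point_imp_discriminant_singular[OF V b(1)] by blast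
qed

section \<open>Weierstrass form of smooth cubics\<close>

lemma cub_zero_of_eval_zero:
  fixes p :: "'a::field_char_0 form"
  assumes "p \<in> R 3" "\<And>x. mp_eval (($) x) p = 0"
  shows "p = 0"
proof -
  obtain a b c d e f g h i j where p: "p = cub a b c d e f g h i j" using assms(1) by (rule R3_cub)
  have ev: "mp_eval (($) (\<chi> k. triple x y z k)) p = a * x ^ 3 + b * y ^ 3 + c * z ^ 3 + d * (x\<^sup>2 * y) + e * (x\<^sup>2 * z) +
      f * (x * y\<^sup>2) + g * (y\<^sup>2 * z) + h * (x * z\<^sup>2) + i * (y * z\<^sup>2) + j * (x * y * z)" for x y z
    by (simp add: p)
  have ev0: "a * x ^ 3 + b * y ^ 3 + c * z ^ 3 + d * (x\<^sup>2 * y) + e * (x\<^sup>2 * z) +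
      f * (x * y\<^sup>2) + g * (y\<^sup>2 * z) + h * (x * z\<^sup>2) + i * (y * z\<^sup>2) + j * (x * y * z) = 0" for x y z
    unfolding ev[symmetric] by (rule assms(2))
  have "a = 0" "b = 0" "c = 0" using ev0[of 1 0 0] ev0[of 0 1 0] ev0[of 0 0 1] by simp_all
  note abc = this
  have "d + f = 0" "- d + f = 0" using ev0[of 1 1 0] ev0[of 1 "-1" 0] abc by simp_all
  moreover have "e + h = 0" "- e + h = 0" using ev0[of 1 0 1] ev0[of 1 0 "-1"] abc by simp_all
  moreover have "g + i = 0" "- g + i = 0" using ev0[of 0 1 1] ev0[of 0 1 "-1"] abc by simp_all
  ultimately have z: "d = 0" "f = 0" "e = 0" "h = 0" "g = 0" "i = 0"
    by (auto simp: add_eq_0_iff2)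
  have "j = 0" using ev0[of 1 1 1] abc z by simp
  then show ?thesis using abc z p by (simp add: cub_0)
qed

text \<open>Lets identities between cubic forms be checked on values, where \<open>algebra\<close>
  can use relations between field elements.\<close>

lemma R3_eqI:
  fixes p q :: "'a::field_char_0 form"
  assumes "p \<in> R 3" "q \<in> R 3" "\<And>x. mp_eval (($) x) p = mp_eval (($) x) q"
  shows "p = q"
proof -
  have "p - q = p + Const (-1) * q" by (simp add: Const_uminus)
  also have "\<dots> \<in> R 3" by (intro homogeneous_add homogeneous_Const_mult assms(1,2))
  finally have "p - q = 0" using assms(3) by (intro cub_zero_of_eval_zero) simp_all
  then show ?thesis by simp
qed

text \<open>Given as a function, so that the resultant below is never expanded into coefficients. If
  r(x, 1) is a constant c, homogeneity turns r(1, y) into c y^n, which vanishes at y = 0.\<close>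

lemma binary_form_root:
  fixes r :: "'k::{alg_closed_field, field_char_0} \<Rightarrow> 'k \<Rightarrow> 'k"
  assumes p: "poly_fun (\<lambda>x. r x 1)" "poly_fun (\<lambda>y. r 1 y)" and h: "\<And>t x y. r (t * x) (t * y) = t ^ n * r x y" and n: "n > 0"
  obtains x y where "x \<noteq> 0 \<or> y \<noteq> 0" "r x y = 0"
proof -
  obtain P where P: "\<And>x. r x 1 = poly P x" using p(1) unfolding poly_fun_def by blast
  show thesis
  proof (cases "degree P > 0")
    case True
    then obtain x where "poly P x = 0" using alg_closed_imp_poly_has_root by blast
    then show thesis using that[of x 1] P by simp
  next
    case False
    then obtain c where "P = [:c:]" by (metis degree_eq_zeroE gr0I)
    then have c: "r x 1 = c" for x using P by simp
    have "r 1 y = c * y ^ n" if "y \<noteq> 0" for y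
      using h[of y "1 / y" 1] that c by (simp add: mult.commute)
    moreover have "poly_fun (\<lambda>y. c * y ^ n)" by (intro poly_fun_mult poly_fun_const poly_fun_power poly_fun_id)
    ultimately have "r 1 0 = c * 0 ^ n" using poly_fun_eqI[OF p(2), of "\<lambda>y. c * y ^ n" 0] by blast
    then show thesis using that[of 1 0] n by simp
  qed
qed

section \<open>Common zeros of two plane cubics\<close>

lemma cubic_splits:
  fixes p q r :: "'k::alg_closed_field"
  obtains z1 z2 z3 where "p = - (z1 + z2 + z3)" "q = z1 * z2 + z1 * z3 + z2 * z3" "r = - (z1 * z2 * z3)"
proof -
  have "degree [:r, q, p, 1:] > 0" by simp
  then obtain z1 where "poly [:r, q, p, 1:] z1 = 0" using alg_closed_imp_poly_has_root by blast
  then have z1: "r + z1 * (q + z1 * (p + z1)) = 0" by simp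
  have "degree [:q + p * z1 + z1 * z1, p + z1, 1:] > 0" by simp
  then obtain z2 where "poly [:q + p * z1 + z1 * z1, p + z1, 1:] z2 = 0" using alg_closed_imp_poly_has_root by blast
  then have z2: "q + p * z1 + z1 * z1 + z2 * (p + z1 + z2) = 0" by simp
  define z3 where "z3 = - p - z1 - z2"
  show thesis
  proof
    show "p = - (z1 + z2 + z3)" by (simp add: z3_def)
    show "q = z1 * z2 + z1 * z3 + z2 * z3" unfolding z3_def using z2 by algebra
    show "r = - (z1 * z2 * z3)" unfolding z3_def using z1 z2 by algebra
  qed
qed

text \<open>
  The resultant with respect to \<open>z\<close> of \<open>z\<^sup>3 + p z\<^sup>2 + q z + r\<close> and \<open>u z\<^sup>2 + v z + w\<close>.
\<close>

definition res32 :: "'a \<Rightarrow> 'a \<Rightarrow> 'a \<Rightarrow> 'a \<Rightarrow> 'a \<Rightarrow> 'a \<Rightarrow> 'a::comm_ring_1" where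
  "res32 p q r u v w = u ^ 3 * r\<^sup>2 - u\<^sup>2 * v * q * r + u\<^sup>2 * w * (q\<^sup>2 - 2 * p * r) + u * v\<^sup>2 * p * r +
     u * v * w * (3 * r - p * q) + u * w\<^sup>2 * (p\<^sup>2 - 2 * q) - v ^ 3 * r + v\<^sup>2 * w * q - v * w\<^sup>2 * p + w ^ 3"

text \<open>In terms of the three roots of the cubic, the resultant is the product of the values of
  the quadratic polynomial at them; this remains true when \<open>u\<close> is 0.\<close>

lemma res32_eq_0_imp_common_root:
  fixes p q r u v w :: "'k::alg_closed_field"
  assumes "res32 p q r u v w = 0"
  obtains z where "z ^ 3 + p * z\<^sup>2 + q * z + r = 0" "u * z\<^sup>2 + v * z + w = 0"
proof -
  obtain z1 z2 z3 where z: "p = - (z1 + z2 + z3)" "q = z1 * z2 + z1 * z3 + z2 * z3" "r = - (z1 * z2 * z3)"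
    by (rule cubic_splits)
  have "res32 p q r u v w = (u * z1\<^sup>2 + v * z1 + w) * (u * z2\<^sup>2 + v * z2 + w) * (u * z3\<^sup>2 + v * z3 + w)"
    unfolding res32_def z by algebra
  moreover have "z1 ^ 3 + p * z1\<^sup>2 + q * z1 + r = 0" "z2 ^ 3 + p * z2\<^sup>2 + q * z2 + r = 0" "z3 ^ 3 + p * z3\<^sup>2 + q * z3 + r = 0"
    unfolding z by algebra+
  ultimately show thesis using assms that by auto
qed

text \<open>The existence part of Bezout. With a point off \<phi> at (0, 0, 1), \<phi> is monic in z
  up to a factor, and \<psi> can be reduced modulo \<phi> to degree 2 in z. The resultant is then a
  binary form in x and y and has a zero.\<close>

lemma cubics_common_zero:
  fixes \<phi> \<psi> :: "'k::{alg_closed_field, field_char_0} form"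
  assumes \<phi>: "\<phi> \<in> R 3" "\<phi> \<noteq> 0" and \<psi>: "\<psi> \<in> R 3"
  obtains x where "x \<noteq> 0" "mp_eval (($) x) \<phi> = 0" "mp_eval (($) x) \<psi> = 0"
proof -
  obtain p where p: "mp_eval (($) p) \<phi> \<noteq> 0" using cub_zero_of_eval_zero \<phi> by blast
  have p0: "p \<noteq> 0"
  proof
    assume "p = 0"
    obtain a b c d e f g h i j where "\<phi> = cub a b c d e f g h i j" using \<phi>(1) by (rule R3_cub)
    then show False using p \<open>p = 0\<close> by simp
  qed
  obtain A :: "'k^3^3" where A: "invertible A" "\<forall>i. A $ i $ 3 = p $ i" by (rule invertible_third_column[OF p0])
  have A3: "A *v axis 3 1 = p" by (simp add: vec_eq_iff matrix_vector_mult_def sum_3 axis_def A(2))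
  obtain a b c d e f g h i j where 1: "lin_subst A \<phi> = cub a b c d e f g h i j"
    using lin_subst_homogeneous[OF \<phi>(1)] by (rule R3_cub)
  obtain a' b' c' d' e' f' g' h' i' j' where 2: "lin_subst A \<psi> = cub a' b' c' d' e' f' g' h' i' j'"
    using lin_subst_homogeneous[OF \<psi>] by (rule R3_cub)
  have "mp_eval (($) (axis 3 1)) (lin_subst A \<phi>) \<noteq> 0" using p by (simp add: mp_eval_lin_subst A3)
  then have c: "c \<noteq> 0" by (simp add: 1 axis_def)
  \<comment> \<open>Subtracting \<open>k\<close> times the first cubic from the second removes
    z^3.\<close>
  define k where "k = c' / c"
  have k: "c' = k * c" using c by (simp add: k_def)
  define P Q S U V W where "P x y = (h * x + i * y) / c" and "Q x y = (e * x\<^sup>2 + j * x * y + g * y\<^sup>2) / c"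
    and "S x y = (a * x ^ 3 + d * x\<^sup>2 * y + f * x * y\<^sup>2 + b * y ^ 3) / c"
    and "U x y = (h' * x + i' * y) - k * (h * x + i * y)"
    and "V x y = (e' * x\<^sup>2 + j' * x * y + g' * y\<^sup>2) - k * (e * x\<^sup>2 + j * x * y + g * y\<^sup>2)"
    and "W x y = (a' * x ^ 3 + d' * x\<^sup>2 * y + f' * x * y\<^sup>2 + b' * y ^ 3) - k * (a * x ^ 3 + d * x\<^sup>2 * y + f * x * y\<^sup>2 + b * y ^ 3)"
    for x y
  note defs = P_def Q_def S_def U_def V_def W_def
  let ?r = "\<lambda>x y. res32 (P x y) (Q x y) (S x y) (U x y) (V x y) (W x y)"
  have hom: "P (t * x) (t * y) = t * P x y" "Q (t * x) (t * y) = t ^ 2 * Q x y" "S (t * x) (t * y) = t ^ 3 * S x y"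
    "U (t * x) (t * y) = t * U x y" "V (t * x) (t * y) = t ^ 2 * V x y" "W (t * x) (t * y) = t ^ 3 * W x y" for t x y
    using c by (simp_all add: defs field_simps power2_eq_square power3_eq_cube)
  note pf = poly_fun_add poly_fun_diff poly_fun_mult poly_fun_power poly_fun_const poly_fun_id
  obtain x y where xy: "x \<noteq> 0 \<or> y \<noteq> 0" "?r x y = 0"
  \<comment> \<open>The degree is 9 = 3 * 3, as for any resultant of two cubic forms.\<close>
  proof (rule binary_form_root[of ?r 9])
    show "poly_fun (\<lambda>x. ?r x 1)" "poly_fun (\<lambda>y. ?r 1 y)"
      unfolding res32_def defs divide_inverse by (intro pf)+
    show "?r (t * x) (t * y) = t ^ 9 * ?r x y" for t x y
      unfolding res32_def hom by algebra
  qed simp_all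
  obtain z where z: "z ^ 3 + P x y * z\<^sup>2 + Q x y * z + S x y = 0" "U x y * z\<^sup>2 + V x y * z + W x y = 0"
    using res32_eq_0_imp_common_root[OF xy(2)] by blast
  define q :: "'k^3" where "q = (\<chi> l. triple x y z l)"
  have q: "q $ 1 = x" "q $ 2 = y" "q $ 3 = z" by (simp_all add: q_def)
  have e1: "mp_eval (($) q) (lin_subst A \<phi>) = c * (z ^ 3 + P x y * z\<^sup>2 + Q x y * z + S x y)"
    unfolding 1 mp_eval_cub q using c by (simp add: defs field_simps)
  have e2: "mp_eval (($) q) (lin_subst A \<psi>) = (U x y * z\<^sup>2 + V x y * z + W x y) + k * mp_eval (($) q) (lin_subst A \<phi>)"
    unfolding 1 2 mp_eval_cub q k by (simp add: defs algebra_simps)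
  have "q \<noteq> 0" using xy(1) q by auto
  have "A *v q \<noteq> 0"
  proof
    assume "A *v q = 0"
    then show False using \<open>q \<noteq> 0\<close> A(1) unfolding invertible_left_inverse matrix_left_invertible_ker by blast
  qed
  then show thesis using that[of "A *v q"] e1 e2 z by (simp add: mp_eval_lin_subst)
qed

section \<open>Smoothness, flexes and the Weierstrass form\<close>

lemma singular_point_lin_subst:
  fixes \<phi> :: "'a::field form"
  assumes A: "invertible A" and s: "singular_point (lin_subst A \<phi>) x"
  shows "singular_point \<phi> (A *v x)"
proof -
  obtain B where B: "A ** B = mat 1" "B ** A = mat 1" using invertible_inverse[OF A] by blast
  have \<phi>: "\<phi> = lin_subst B (lin_subst A \<phi>)" using lin_subst_inverse[OF B(1)] by simp
  have Bx: "B *v (A *v x) = x" by (simp add: matrix_vector_mul_assoc B(2))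
  have "mp_eval (($) (A *v x)) (mp_diff i \<phi>) = 0" for i
    by (subst \<phi>, unfold mp_diff_lin_subst[of i B]) (use s in \<open>simp add: mp_eval_lin_subst Bx singular_point_def\<close>)
  moreover have "A *v x \<noteq> 0" using s Bx unfolding singular_point_def by force
  moreover have "mp_eval (($) (A *v x)) \<phi> = 0" using s by (simp add: singular_point_def mp_eval_lin_subst)
  ultimately show ?thesis unfolding singular_point_def by blast
qed

lemma smooth_cubic_lin_subst:
  assumes "invertible A" "smooth_cubic \<phi>"
  shows "smooth_cubic (lin_subst A \<phi>)"
  using assms singular_point_lin_subst lin_subst_homogeneous unfolding smooth_cubic_def by blast

definition hessian_at :: "'a::field form \<Rightarrow> 'a^3 \<Rightarrow> 'a^3^3" where
  "hessian_at \<phi> x = (\<chi> i j. mp_eval (($) x) (mp_diff i (mp_diff j \<phi>)))"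

lemma hessian_at_lin_subst:
  "hessian_at (lin_subst A \<phi>) x = transpose A ** hessian_at \<phi> (A *v x) ** A"
  by (simp add: hessian_at_def vec_eq_iff transpose_def matrix_matrix_mult_def mp_diff_lin_subst mp_eval_lin_subst sum_3 algebra_simps)

text \<open>The Hessian determinant is itself a cubic form. The common zero may be a singular point;
  it is a flex when \<phi> is smooth.\<close>

lemma flex_exists:
  fixes \<phi> :: "'k::{alg_closed_field, field_char_0} form"
  assumes \<phi>: "\<phi> \<in> R 3" "\<phi> \<noteq> 0"
  obtains x where "x \<noteq> 0" "mp_eval (($) x) \<phi> = 0" "det (hessian_at \<phi> x) = 0"
proof -
  define H where "H i j = mp_diff i (mp_diff j \<phi>)" for i j
  define h where "h = H 1 1 * H 2 2 * H 3 3 + H 1 2 * H 2 3 * H 3 1 + H 1 3 * H 2 1 * H 3 2 +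
    Const (-1) * (H 1 1 * H 2 3 * H 3 2) + Const (-1) * (H 1 2 * H 2 1 * H 3 3) + Const (-1) * (H 1 3 * H 2 2 * H 3 1)"
  have H2: "mp_diff j \<phi> \<in> R (Suc (Suc 0))" for j
    by (rule mp_diff_homogeneous) (use \<phi>(1) in \<open>simp add: numeral_3_eq_3\<close>)
  have H1: "H i j \<in> R (Suc 0)" for i j unfolding H_def by (rule mp_diff_homogeneous[OF H2])
  have "H i j * H k l * H m n \<in> R 3" for i j k l m n
    using homogeneous_mult[OF homogeneous_mult[OF H1 H1] H1] by (simp add: numeral_3_eq_3)
  then have "h \<in> R 3" unfolding h_def by (intro homogeneous_add homogeneous_Const_mult)
  then obtain x where x: "x \<noteq> 0" "mp_eval (($) x) \<phi> = 0" "mp_eval (($) x) h = 0"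
    using cubics_common_zero[OF \<phi>] by blast
  have "mp_eval (($) x) h = det (hessian_at \<phi> x)"
    unfolding det_3 hessian_at_def h_def H_def by simp
  then show thesis using that x by simp
qed

lemma weierstrass_cub: "weierstrass a b = cub (-1) 0 (-b) 0 0 0 1 (-a) 0 0"
  by (simp add: weierstrass_def cub_def Const_uminus algebra_simps)

text \<open>A zero discriminant means that x^3 + a x + b has a double root x, and then (x, 0, 1) is
  a singular point.\<close>

lemma smooth_weierstrass_disc:
  fixes a b :: "'a::field_char_0"
  assumes "smooth_cubic (weierstrass a b)"
  shows "4 * a ^ 3 + 27 * b\<^sup>2 \<noteq> 0"
proof
  assume d: "4 * a ^ 3 + 27 * b\<^sup>2 = 0"
  obtain x :: 'a where x: "3 * x * x + a = 0" "2 * a * x + 3 * b = 0"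
  proof (cases "a = 0")
    case True
    then show thesis using d that[of 0] by simp
  next
    case False
    have "3 * (- 3 * b / (2 * a)) * (- 3 * b / (2 * a)) + a = (4 * a ^ 3 + 27 * b\<^sup>2) / (4 * a\<^sup>2)"
      using False by (simp add: field_simps power2_eq_square power3_eq_cube)
    then show thesis using d False that[of "- 3 * b / (2 * a)"] by simp
  qed
  have x3: "x ^ 3 + a * x + b = 0"
  proof -
    have "3 * (x ^ 3 + a * x + b) = x * (3 * x * x + a) + (2 * a * x + 3 * b)"
      by (simp add: algebra_simps power3_eq_cube)
    then have "3 * (x ^ 3 + a * x + b) = 0" unfolding x by (simp only: mult_zero_right add_0)
    then show ?thesis by (metis mult_eq_0_iff zero_neq_numeral)
  qed
  define p :: "'a^3" where "p = (\<chi> l. triple x 0 1 l)"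
  have p: "p $ 1 = x" "p $ 2 = 0" "p $ 3 = 1" by (simp_all add: p_def)
  have "p \<noteq> 0" using p(3) by auto
  moreover have "mp_eval (($) p) (weierstrass a b) = - (x ^ 3 + a * x + b)"
    by (simp add: weierstrass_cub p)
  moreover have "mp_eval (($) p) (mp_diff i (weierstrass a b)) = 0" for i
  proof -
    have "mp_eval (($) p) (mp_diff 1 (weierstrass a b)) = - (3 * x * x + a)"
      "mp_eval (($) p) (mp_diff 2 (weierstrass a b)) = 0"
      "mp_eval (($) p) (mp_diff 3 (weierstrass a b)) = - (2 * a * x + 3 * b)"
      by (simp_all add: weierstrass_cub mp_diff_cub p power2_eq_square)
    then show ?thesis unfolding x using exhaust_3[of i] by auto
  qed
  ultimately have "singular_point (weierstrass a b) p" unfolding singular_point_def x3 by simp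
  then show False using assms unfolding smooth_cubic_def by blast
qed

text \<open>The flex goes to (0, 0, 1) and its tangent to Y = 0. The equation then contains Y Z^2
  and X^3 but not Z^3, X Z^2 or X^2 Z, which leaves completing a square and depressing a
  cubic.\<close>

lemma smooth_cubic_weierstrass:
  fixes \<phi> :: "'k::{alg_closed_field, field_char_0} form"
  assumes sm: "smooth_cubic \<phi>"
  obtains A a b where "invertible A" "lin_subst A \<phi> = weierstrass a b" "4 * a ^ 3 + 27 * b\<^sup>2 \<noteq> 0"
proof -
  have \<phi>: "\<phi> \<in> R 3" using sm unfolding smooth_cubic_def by blast
  have "\<phi> \<noteq> 0"
  proof
    assume "\<phi> = 0"
    then have "singular_point \<phi> (axis 1 1)" by (simp add: singular_point_def)
    then show False using sm unfolding smooth_cubic_def by blast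
  qed
  then obtain p where p: "p \<noteq> 0" "mp_eval (($) p) \<phi> = 0" "det (hessian_at \<phi> p) = 0"
    using flex_exists[OF \<phi>] by blast
  obtain A0 :: "'k^3^3" where A0: "invertible A0" "\<forall>i. A0 $ i $ 3 = p $ i" by (rule invertible_third_column[OF p(1)])
  have A03: "A0 *v axis 3 1 = p" by (simp add: vec_eq_iff matrix_vector_mult_def sum_3 axis_def A0(2))
  define \<psi> where "\<psi> = lin_subst A0 \<phi>"
  have sm1: "smooth_cubic \<psi>" unfolding \<psi>_def by (rule smooth_cubic_lin_subst[OF A0(1) sm])
  then have "\<psi> \<in> R 3" unfolding smooth_cubic_def by blast
  then obtain a b c d e f g h i j where \<psi>: "\<psi> = cub a b c d e f g h i j" by (rule R3_cub)
  have "mp_eval (($) (axis 3 1)) \<psi> = 0" using p(2) by (simp add: \<psi>_def mp_eval_lin_subst A03)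
  then have c: "c = 0" by (simp add: \<psi> axis_def)
  have hi: "h \<noteq> 0 \<or> i \<noteq> 0"
  proof (rule ccontr)
    assume "\<not> ?thesis"
    then have "mp_eval (($) (axis 3 1)) (mp_diff l \<psi>) = 0" for l
      using exhaust_3[of l] by (auto simp: \<psi> mp_diff_cub c axis_def)
    moreover have "(axis 3 1 :: 'k^3) \<noteq> 0" by (simp add: axis_eq_0_iff)
    ultimately have "singular_point \<psi> (axis 3 1)"
      unfolding singular_point_def using \<open>mp_eval (($) (axis 3 1)) \<psi> = 0\<close> by blast
    then show False using sm1 unfolding smooth_cubic_def by blast
  qed
  obtain A1 :: "'k^3^3" where A1: "invertible A1" "\<forall>l. A1 $ l $ 3 = (if l = 3 then 1 else 0)"
    "h * A1$1$1 + i * A1$2$1 = 0" "h * A1$1$2 + i * A1$2$2 = 1"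
  proof (cases "i = 0")
    case False
    have "rows 1 0 0 (- h / i) (1 / i) 0 0 0 1 $ l $ 3 = (if l = 3 then 1 else (0::'k))" for l using exhaust_3[of l] by auto
    then show thesis using False by (intro that[of "rows 1 0 0 (- h / i) (1 / i) 0 0 0 1"]) (simp_all add: invertible_rows)
  next
    case True
    have "rows 0 (1 / h) 0 1 0 0 0 0 1 $ l $ 3 = (if l = 3 then 1 else (0::'k))" for l using exhaust_3[of l] by auto
    then show thesis using True hi by (intro that[of "rows 0 (1 / h) 0 1 0 0 0 0 1"]) (simp_all add: invertible_rows)
  qed
  have A13: "A1 *v axis 3 1 = axis 3 1"
    by (simp add: vec_eq_iff matrix_vector_mult_def sum_3 axis_def A1(2))
  define \<xi> where "\<xi> = lin_subst A1 \<psi>"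
  have sm2: "smooth_cubic \<xi>" unfolding \<xi>_def by (rule smooth_cubic_lin_subst[OF A1(1) sm1])
  then have "\<xi> \<in> R 3" unfolding smooth_cubic_def by blast
  then obtain a2 b2 c2 d2 e2 f2 g2 h2 i2 j2 where \<xi>: "\<xi> = cub a2 b2 c2 d2 e2 f2 g2 h2 i2 j2" by (rule R3_cub)
  have ev: "mp_eval (($) (axis 3 1)) \<xi> = 0"
    using p(2) by (simp add: \<xi>_def \<psi>_def mp_eval_lin_subst A03 A13)
  then have c2: "c2 = 0" by (simp add: \<xi> axis_def)
  have dl: "mp_eval (($) (axis 3 1)) (mp_diff l \<xi>) = h * A1$1$l + i * A1$2$l" for l
    unfolding \<xi>_def mp_diff_lin_subst sum_3
    by (simp add: mp_eval_lin_subst A13) (simp add: \<psi> mp_diff_cub c axis_def mult.commute)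
  have h2: "h2 = 0" using dl[of 1] A1(3) by (simp add: \<xi> mp_diff_cub axis_def)
  have i2: "i2 = 1" using dl[of 2] A1(4) by (simp add: \<xi> mp_diff_cub axis_def)
  have "det (hessian_at \<xi> (axis 3 1)) = 0"
    using p(3) by (simp add: \<xi>_def \<psi>_def hessian_at_lin_subst A13 A03 det_mul)
  moreover have "hessian_at \<xi> (axis 3 1) = rows (2 * e2) j2 0 j2 (2 * g2) 2 0 2 0"
  proof -
    show ?thesis
      by (simp add: vec_eq_iff forall_3 hessian_at_def \<xi> mp_diff_cub mp_diff_qf axis_def c2 h2 i2)
  qed
  \<comment> \<open>The determinant is -8 \<open>e2\<close>: at a flex the tangent Y = 0 has contact
    of order three.\<close>
  ultimately have e2: "e2 = 0" by (simp add: det_rows)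
  have a2: "a2 \<noteq> 0"
  proof
    \<comment> \<open>In this case Y divides the cubic, and a point where the line Y = 0 meets the
      residual conic is singular.\<close>
    assume a2: "a2 = 0"
    obtain x z where xz: "x \<noteq> 0 \<or> z \<noteq> 0" "d2 * x\<^sup>2 + j2 * x * z + 1 * z\<^sup>2 = 0" by (rule binary_quadratic_root)
    define q :: "'k^3" where "q = (\<chi> l. triple x 0 z l)"
    have q: "q $ 1 = x" "q $ 2 = 0" "q $ 3 = z" by (simp_all add: q_def)
    have "q \<noteq> 0" using xz(1) q by auto
    moreover have "mp_eval (($) q) \<xi> = 0" by (simp add: \<xi> q a2 c2 e2 h2)
    moreover have "mp_eval (($) q) (mp_diff l \<xi>) = 0" for l
      using exhaust_3[of l] xz(2) by (auto simp: \<xi> mp_diff_cub q a2 c2 e2 h2 i2 algebra_simps)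
    ultimately have "singular_point \<xi> q" unfolding singular_point_def by blast
    then show False using sm2 unfolding smooth_cubic_def by blast
  qed
  obtain x where "x ^ 3 = - 1 / a2" using nth_root_exists'[of 3 "- 1 / a2"] by auto
  then have x: "a2 * x ^ 3 = - 1" "x \<noteq> 0" using a2 by auto
  define m where "m = (1 / 2 :: 'k)"
  have m: "2 * m = 1" by (simp add: m_def)
  define D E F where "D = d2 - m * m * j2 * j2" and "E = f2 - m * j2 * g2" and "F = b2 - m * m * g2 * g2"
  define k where "k = D / (3 * a2)"
  have k: "3 * a2 * k = D" using a2 by (simp add: k_def)
  \<comment> \<open>The old Y becomes Z. The last row completes the square in the old Z, the shift
    \<open>k\<close> of X removes the quadratic term of the cubic, and \<open>x\<close> normalises
    its leading coefficient.\<close>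
  define A2 :: "'k^3^3" where "A2 = rows x 0 (- k) 0 0 1 (- (m * j2 * x)) 1 (m * j2 * k - m * g2)"
  have A2: "invertible A2" using x(2) by (simp add: A2_def invertible_rows)
  define aw bw where "aw = - (x * (3 * a2 * k * k - 2 * D * k + E))" and "bw = - (- (a2 * k ^ 3) + D * k * k - E * k + F)"
  have "lin_subst A2 \<xi> = weierstrass aw bw"
  proof (rule R3_eqI)
    show "lin_subst A2 \<xi> \<in> R 3" by (rule lin_subst_homogeneous[OF \<open>\<xi> \<in> R 3\<close>])
    show "weierstrass aw bw \<in> R 3" by (simp add: weierstrass_cub)
    fix q :: "'k^3"
    define u v w where "u = q $ 1" and "v = q $ 2" and "w = q $ 3"
    have A2q: "(A2 *v q) $ 1 = x * u - k * w" "(A2 *v q) $ 2 = w" "(A2 *v q) $ 3 = v - m * (j2 * (x * u - k * w) + g2 * w)"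
      by (simp_all add: A2_def matrix_vector_mult_def sum_3 u_def v_def w_def algebra_simps)
    show "mp_eval (($) q) (lin_subst A2 \<xi>) = mp_eval (($) q) (weierstrass aw bw)"
      unfolding mp_eval_lin_subst \<xi> weierstrass_cub mp_eval_cub A2q u_def[symmetric] v_def[symmetric] w_def[symmetric]
        c2 h2 i2 e2 aw_def bw_def
      using x(1) k m unfolding D_def E_def F_def by algebra
  qed
  then have W: "lin_subst (A0 ** A1 ** A2) \<phi> = weierstrass aw bw"
    unfolding \<xi>_def \<psi>_def lin_subst_lin_subst .
  have inv: "invertible (A0 ** A1 ** A2)" using A0(1) A1(1) A2 invertible_mult by blast
  show thesis
    by (rule that[OF inv W]) (rule smooth_weierstrass_disc, unfold W[symmetric], rule smooth_cubic_lin_subst[OF inv sm])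
qed

section \<open>The \<open>j\<close>-invariant and the orbits of Jacobian nets\<close>

lemma J_weierstrass:
  "J (weierstrass a b) = mp.span {qf (-3) 0 (- a) 0 0 0, qf 0 0 0 2 0 0, qf 0 1 (- (3 * b)) 0 (- (2 * a)) (0 :: 'a::field)}"
  unfolding J_def weierstrass_cub mp_diff_cub by simp

lemma indep3_weierstrass:
  "indep3 (qf (-3) 0 (- a) 0 0 0) (qf 0 0 0 2 0 0) (qf 0 1 (- (3 * b)) 0 (- (2 * a)) (0 :: 'a::field_char_0))"
  by (rule indep3_qf) simp

lemma J_weierstrass_nets: "J (weierstrass a b) \<in> (nets :: 'a::field_char_0 form set set)"
  unfolding J_weierstrass by (rule span3_nets[OF indep3_weierstrass]) simp_all

text \<open>For c = 1 this is -82944 (4 a^3 + 27 b^2), for c = 4 it is -331776 a^3, so the pencil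
  determines the ratio a^3 : b^2.\<close>

lemma kinv_weierstrass:
  "kinv c (pluecker (triple (qf (-3) 0 (- a) 0 0 0) (qf 0 0 0 2 0 0) (qf 0 1 (- (3 * b)) 0 (- (2 * a)) 0))) =
    - 331776 * a ^ 3 + (746496 * c - 2985984) * (b\<^sup>2 :: 'a::field_char_0)"
  by (simp add: kinv_def inv2_def inv4_def apolar_def aronhold_def jac_def con_def bracket_pluecker
      algebra_simps power2_eq_square power3_eq_cube power4_eq_xxxx)

lemma kinv_scale: "kinv c (\<lambda>\<mu>. m * w \<mu>) = m ^ 4 * kinv c (w :: _ \<Rightarrow> 'a::field)"
proof -
  obtain F where F: "F \<in> homogeneous 4" "\<And>x :: _ \<Rightarrow> 'a. kinv c x = mp_eval x F"
    using hom_fun_kinv[of c] unfolding hom_fun_def by blast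
  show ?thesis unfolding F(2) by (rule mp_eval_scale[OF F(1)])
qed

text \<open>The point is that one factor \<open>e\<close> serves for all \<open>c\<close>, which
  preserves the ratio of the two invariants.\<close>

lemma same_orbit_kinv:
  assumes "indep3 p q r" "p \<in> R 2" "q \<in> R 2" "r \<in> R 2" "indep3 p' q' r'"
    "mp.span {p', q', r'} \<in> orbit (mp.span {p, q, r})"
  obtains e where "\<And>c. kinv c (pluecker (triple p' q' r')) = e * kinv c (pluecker (triple p q r))"
proof -
  obtain b d where b: "is_basis b (mp.span {p', q', r'})"
    "\<And>c. kinv c (pluecker b) = d ^ 8 * kinv c (pluecker (triple p q r))"
    by (rule kinv_orbit[OF assms(1-4,6)]) blast
  obtain m where "pluecker (triple p' q' r') = (\<lambda>\<mu>. m * pluecker b \<mu>)"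
    by (rule pluecker_basis_change[OF b(1) is_basis_triple[OF assms(5)]])
  then have "kinv c (pluecker (triple p' q' r')) = (m ^ 4 * d ^ 8) * kinv c (pluecker (triple p q r))" for c
    by (simp add: kinv_scale b(2))
  then show thesis by (rule that)
qed

lemma J_weierstrass_same_orbit:
  fixes a b a' b' :: "'a::field_char_0"
  assumes "J (weierstrass a' b') \<in> orbit (J (weierstrass a b))"
  obtains e where "a' ^ 3 = e * a ^ 3" "b'\<^sup>2 = e * b\<^sup>2"
proof -
  obtain e where "\<And>c. - 331776 * a' ^ 3 + (746496 * c - 2985984) * b'\<^sup>2 = e * (- 331776 * a ^ 3 + (746496 * c - 2985984) * b\<^sup>2)"
    using same_orbit_kinv[OF indep3_weierstrass[of a b] _ _ _ indep3_weierstrass[of a' b']] assms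
    unfolding J_weierstrass kinv_weierstrass by (metis qf_in_R2)
  \<comment> \<open>At c = 4 the term in b^2 vanishes, and at c = 5 its coefficient is
    746496.\<close>
  from this[of 4] this[of 5] have "331776 * a' ^ 3 = 331776 * (e * a ^ 3)" "746496 * b'\<^sup>2 = 746496 * (e * b\<^sup>2)"
    by (simp_all add: algebra_simps)
  then show thesis by (intro that[of e]) simp_all
qed

lemma form_iso_orbit_J:
  assumes "form_iso \<phi> \<psi>"
  shows "J \<psi> \<in> orbit (J \<phi>)"
proof -
  obtain A c where A: "invertible A" "c \<noteq> 0" "lin_subst A \<phi> = Const c * \<psi>" using assms unfolding form_iso_def by blast
  then have "J \<psi> = lin_subst A ` J \<phi>" using J_lin_subst[OF A(1), of \<phi>] J_Const_mult[OF A(2)] by simp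
  then show ?thesis unfolding orbit_def using A(1) by blast
qed

lemma form_isoI: "invertible A \<Longrightarrow> lin_subst A \<phi> = \<psi> \<Longrightarrow> form_iso \<phi> \<psi>"
  unfolding form_iso_def by (intro exI[of _ A] exI[of _ 1]) simp

text \<open>Uniqueness in the definite description comes from the nets: two Weierstrass forms of
  \<phi> have Jacobian nets in one orbit, so a^3 and b^2 are multiplied by a common factor.\<close>

lemma j_invariant_weierstrass:
  fixes \<phi> :: "'k::{alg_closed_field, field_char_0} form"
  assumes iso: "form_iso \<phi> (weierstrass a b)" and d: "4 * a ^ 3 + 27 * b\<^sup>2 \<noteq> 0"
  shows "j_invariant \<phi> = 1728 * (4 * a ^ 3) / (4 * a ^ 3 + 27 * b\<^sup>2)"
  unfolding j_invariant_def
proof (rule the_equality)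
  show "\<exists>a' b'. 4 * a' ^ 3 + 27 * b'\<^sup>2 \<noteq> 0 \<and> form_iso \<phi> (weierstrass a' b') \<and>
      1728 * (4 * a ^ 3) / (4 * a ^ 3 + 27 * b\<^sup>2) = 1728 * (4 * a' ^ 3) / (4 * a' ^ 3 + 27 * b'\<^sup>2)"
    using iso d by blast
  fix j assume "\<exists>a b. 4 * a ^ 3 + 27 * b\<^sup>2 \<noteq> 0 \<and> form_iso \<phi> (weierstrass a b) \<and> j = 1728 * (4 * a ^ 3) / (4 * a ^ 3 + 27 * b\<^sup>2)"
  then obtain a' b' where *: "4 * a' ^ 3 + 27 * b'\<^sup>2 \<noteq> 0" "form_iso \<phi> (weierstrass a' b')"
    "j = 1728 * (4 * a' ^ 3) / (4 * a' ^ 3 + 27 * b'\<^sup>2)" by blast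
  have "J (weierstrass a' b') \<in> orbit (J (weierstrass a b))"
    using form_iso_orbit_J[OF iso] form_iso_orbit_J[OF *(2)] orbit_sym orbit_trans by blast
  then obtain e where e: "a' ^ 3 = e * a ^ 3" "b'\<^sup>2 = e * b\<^sup>2" by (rule J_weierstrass_same_orbit)
  have s: "4 * a' ^ 3 + 27 * b'\<^sup>2 = e * (4 * a ^ 3 + 27 * b\<^sup>2)" unfolding e by (simp add: algebra_simps)
  then have "e \<noteq> 0" using *(1) by auto
  have "j = e * (1728 * (4 * a ^ 3)) / (e * (4 * a ^ 3 + 27 * b\<^sup>2))" unfolding *(3) s unfolding e by (simp add: mult_ac)
  also have "\<dots> = 1728 * (4 * a ^ 3) / (4 * a ^ 3 + 27 * b\<^sup>2)" by (rule mult_divide_mult_cancel_left[OF \<open>e \<noteq> 0\<close>])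
  finally show "j = 1728 * (4 * a ^ 3) / (4 * a ^ 3 + 27 * b\<^sup>2)" .
qed

text \<open>\<open>rel\<close> is equality of the j-invariants after cross-multiplication. The two
  equations are related by the classical scaling a' = u^4 a, b' = u^6 b.\<close>

lemma weierstrass_scaling:
  fixes a b a' b' :: "'k::{alg_closed_field, field_char_0}"
  assumes rel: "a ^ 3 * b'\<^sup>2 = a' ^ 3 * b\<^sup>2" and d: "4 * a ^ 3 + 27 * b\<^sup>2 \<noteq> 0" "4 * a' ^ 3 + 27 * b'\<^sup>2 \<noteq> 0"
  shows "J (weierstrass a' b') \<in> orbit (J (weierstrass a b))"
proof -
  obtain u where u: "u \<noteq> 0" "a' = u ^ 4 * a" "b' = u ^ 6 * b"
  proof -
    consider "a = 0" | "b = 0" "a \<noteq> 0" | "a \<noteq> 0" "b \<noteq> 0" by blast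
    then show thesis
    proof cases
      case 1
      then have b: "b \<noteq> 0" "a' = 0" "b' \<noteq> 0" using d rel by auto
      obtain u where u: "u ^ 6 = b' / b" using nth_root_exists'[of 6 "b' / b"] by auto
      then have "u \<noteq> 0" using b by auto
      then show thesis using that[of u] u 1 b by simp
    next
      case 2
      then have b: "b' = 0" "a' \<noteq> 0" using d rel by auto
      obtain u where u: "u ^ 4 = a' / a" using nth_root_exists'[of 4 "a' / a"] by auto
      then have "u \<noteq> 0" using 2 b by auto
      then show thesis using that[of u] u 2 b by simp
    next
      case 3
      have "a' \<noteq> 0" using rel d 3 by auto
      then have "b' \<noteq> 0" using rel 3 by auto
      \<comment> \<open>\<open>s\<close> has to be u^2, which is the quotient of u^6 = b' / b by u^4
        = a' / a.\<close>
      define s where "s = b' * a / (b * a')"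
      obtain u where u: "u ^ 2 = s" using nth_root_exists'[of 2 s] by auto
      have "s \<noteq> 0" using 3 \<open>a' \<noteq> 0\<close> \<open>b' \<noteq> 0\<close> by (simp add: s_def)
      then have "u \<noteq> 0" using u by auto
      have sb: "s * (b * a') = b' * a" using 3 \<open>a' \<noteq> 0\<close> by (simp add: s_def)
      have "(s\<^sup>2 * a - a') * (b\<^sup>2 * a'\<^sup>2) = 0"
      proof -
        have "s\<^sup>2 * a * (b\<^sup>2 * a'\<^sup>2) = a * (s * (b * a'))\<^sup>2" by (simp add: power2_eq_square)
        also have "\<dots> = a ^ 3 * b'\<^sup>2" unfolding sb by (simp add: power2_eq_square power3_eq_cube)
        also have "\<dots> = a' * (b\<^sup>2 * a'\<^sup>2)" unfolding rel by (simp add: power2_eq_square power3_eq_cube)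
        finally show ?thesis by (simp add: left_diff_distrib)
      qed
      then have a: "a' = s\<^sup>2 * a" using 3 \<open>a' \<noteq> 0\<close> by simp
      have "b' * a = s ^ 3 * b * a" using sb unfolding a by algebra
      then have b: "b' = s ^ 3 * b" using 3 by simp
      have "s\<^sup>2 = u ^ 4" "s ^ 3 = u ^ 6" unfolding u[symmetric] by (simp_all flip: power_mult)
      then show thesis using that[of u] a b \<open>u \<noteq> 0\<close> by simp
    qed
  qed
  define A :: "'k^3^3" where "A = rows (1 / u\<^sup>2) 0 0 0 (1 / u ^ 3) 0 0 0 1"
  have A: "invertible A" using u(1) by (simp add: A_def invertible_rows)
  have "lin_subst A (weierstrass a b) = Const (1 / u ^ 6) * weierstrass a' b'"
  proof (rule R3_eqI)
    show "lin_subst A (weierstrass a b) \<in> R 3" by (rule lin_subst_homogeneous) (simp add: weierstrass_cub)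
    show "Const (1 / u ^ 6) * weierstrass a' b' \<in> R 3" by (rule homogeneous_Const_mult) (simp add: weierstrass_cub)
    fix x :: "'k^3"
    have Ax: "(A *v x) $ 1 = x $ 1 / u\<^sup>2" "(A *v x) $ 2 = x $ 2 / u ^ 3" "(A *v x) $ 3 = x $ 3"
      by (simp_all add: A_def matrix_vector_mult_def sum_3)
    show "mp_eval (($) x) (lin_subst A (weierstrass a b)) = mp_eval (($) x) (Const (1 / u ^ 6) * weierstrass a' b')"
      unfolding mp_eval_lin_subst weierstrass_cub mp_eval_simps mp_eval_cub Ax u(2,3)
      using u(1) by (simp add: field_simps)
  qed
  then have "form_iso (weierstrass a b) (weierstrass a' b')"
    unfolding form_iso_def using A u(1) by (intro exI[of _ A] exI[of _ "1 / u ^ 6"]) simp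
  then show ?thesis by (rule form_iso_orbit_J)
qed

theorem j_invariant_determines_orbit:
  fixes \<phi> \<psi> :: "'k::{alg_closed_field, field_char_0} form"
  assumes "smooth_cubic \<phi>" "smooth_cubic \<psi>" "j_invariant \<phi> = j_invariant \<psi>"
  shows "orbit (J \<phi>) = orbit (J \<psi>)"
proof -
  obtain A a b where 1: "invertible A" "lin_subst A \<phi> = weierstrass a b" "4 * a ^ 3 + 27 * b\<^sup>2 \<noteq> 0"
    by (rule smooth_cubic_weierstrass[OF assms(1)])
  obtain A' a' b' where 2: "invertible A'" "lin_subst A' \<psi> = weierstrass a' b'" "4 * a' ^ 3 + 27 * b'\<^sup>2 \<noteq> 0"
    by (rule smooth_cubic_weierstrass[OF assms(2)])
  note iso = form_isoI[OF 1(1,2)] form_isoI[OF 2(1,2)]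
  have "1728 * (4 * a ^ 3) / (4 * a ^ 3 + 27 * b\<^sup>2) = 1728 * (4 * a' ^ 3) / (4 * a' ^ 3 + 27 * b'\<^sup>2)"
    using assms(3) unfolding j_invariant_weierstrass[OF iso(1) 1(3)] j_invariant_weierstrass[OF iso(2) 2(3)] .
  then have "1728 * (4 * a ^ 3) * (4 * a' ^ 3 + 27 * b'\<^sup>2) = 1728 * (4 * a' ^ 3) * (4 * a ^ 3 + 27 * b\<^sup>2)"
    by (rule iffD1[OF frac_eq_eq[OF 1(3) 2(3)]])
  then have "186624 * (a ^ 3 * b'\<^sup>2) = 186624 * (a' ^ 3 * b\<^sup>2)" by (simp add: algebra_simps)
  then have "a ^ 3 * b'\<^sup>2 = a' ^ 3 * b\<^sup>2" by simp
  from weierstrass_scaling[OF this 1(3) 2(3)] form_iso_orbit_J[OF iso(1)] form_iso_orbit_J[OF iso(2)]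
  show ?thesis unfolding orbit_eq by simp
qed

lemma weierstrass_fermat:
  fixes b :: "'k::{alg_closed_field, field_char_0}"
  assumes b: "b \<noteq> 0"
  obtains A where "invertible A" "lin_subst A (weierstrass 0 b) = fermat"
proof -
  \<comment> \<open>The substitution rests on 4 (v^3 + w^3) = (v + w)^3 + 3 (v + w) (v - w)^2;
    \<open>s\<close> and \<open>t\<close> adjust the two coefficients.\<close>
  obtain s where "s ^ 3 = - 1 / (4 * b)" using nth_root_exists'[of 3 "- 1 / (4 * b)"] by auto
  then have s: "4 * b * s ^ 3 = - 1" "s \<noteq> 0" using b by auto
  obtain t where "t ^ 2 = 3 / (4 * s)" using nth_root_exists'[of 2 "3 / (4 * s)"] by auto
  then have t: "4 * s * t\<^sup>2 = 3" "t \<noteq> 0" using s(2) by auto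
  define A :: "'k^3^3" where "A = rows (-1) 0 0 0 t (- t) 0 s s"
  have A: "invertible A" using s t by (simp add: A_def invertible_rows)
  have fc: "fermat = cub 1 1 1 0 0 0 0 0 0 (0 :: 'k)" by (simp add: fermat_def cub_def)
  have "lin_subst A (weierstrass 0 b) = fermat"
  proof (rule R3_eqI)
    show "lin_subst A (weierstrass 0 b) \<in> R 3" by (rule lin_subst_homogeneous) (simp add: weierstrass_cub)
    show "fermat \<in> (R 3 :: 'k form set)" by (simp add: fc)
    fix x :: "'k^3"
    define u v w where "u = x $ 1" and "v = x $ 2" and "w = x $ 3"
    have Ax: "(A *v x) $ 1 = - u" "(A *v x) $ 2 = t * (v - w)" "(A *v x) $ 3 = s * (v + w)"
      by (simp_all add: A_def matrix_vector_mult_def sum_3 u_def v_def w_def algebra_simps)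
    have "4 * mp_eval (($) x) (lin_subst A (weierstrass 0 b)) = 4 * mp_eval (($) x) fermat"
      unfolding mp_eval_lin_subst weierstrass_cub fc mp_eval_cub Ax u_def[symmetric] v_def[symmetric] w_def[symmetric]
      using s(1) t(1) by algebra
    then show "mp_eval (($) x) (lin_subst A (weierstrass 0 b)) = mp_eval (($) x) fermat" by simp
  qed
  with A show thesis by (rule that)
qed

lemma J_fermat: "J (fermat :: 'a::field_char_0 form) = net_6d"
proof -
  have fc: "fermat = cub 1 1 1 0 0 0 0 0 0 (0 :: 'a)" by (simp add: fermat_def cub_def)
  show ?thesis
  proof (rule nets_subset_eq[symmetric])
    show "net_6d \<in> (nets :: 'a form set set)" by simp
    have i: "indep3 (qf 3 0 0 0 0 0) (qf 0 3 0 0 0 0) (qf 0 0 3 0 0 (0::'a))" by (rule indep3_qf) simp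
    have J: "J fermat = mp.span {qf 3 0 0 0 0 0, qf 0 3 0 0 0 0, qf 0 0 3 0 0 (0::'a)}"
      unfolding J_def fc mp_diff_cub by simp
    show "J fermat \<in> (nets :: 'a form set set)" unfolding J by (rule span3_nets[OF i]) simp_all
    show "net_6d \<subseteq> J (fermat :: 'a form)"
      unfolding named_nets_qf J
    proof (rule mp.span_minimal)
      have "qf 1 0 0 0 0 0 \<in> mp.span {qf 3 0 0 0 0 0, qf 0 3 0 0 0 0, qf 0 0 3 0 0 (0::'a)}"
        by (rule in_span3I[of _ "1/3" _ 0 _ 0]) (simp add: qf_scale)
      moreover have "qf 0 1 0 0 0 0 \<in> mp.span {qf 3 0 0 0 0 0, qf 0 3 0 0 0 0, qf 0 0 3 0 0 (0::'a)}"
        by (rule in_span3I[of _ 0 _ "1/3" _ 0]) (simp add: qf_scale)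
      moreover have "qf 0 0 1 0 0 0 \<in> mp.span {qf 3 0 0 0 0 0, qf 0 3 0 0 0 0, qf 0 0 3 0 0 (0::'a)}"
        by (rule in_span3I[of _ 0 _ 0 _ "1/3"]) (simp add: qf_scale)
      ultimately show "{qf 1 0 0 0 0 0, qf 0 1 0 0 0 0, qf 0 0 1 0 0 0} \<subseteq> mp.span {qf 3 0 0 0 0 0, qf 0 3 0 0 0 0, qf 0 0 3 0 0 (0::'a)}"
        by blast
    qed (rule mp.subspace_span)
  qed
qed

text \<open>Again X, Y, Z have weights 0, 1, 2. The limit contains Y^2 - 2 a XZ, and this is where a
  \<noteq> 0 enters: for a = 0 the limit would be the model of #5b.\<close>

lemma J_weierstrass_spec_7b:
  fixes a b :: "'k::{alg_closed_field, field_char_0}"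
  assumes a: "a \<noteq> 0"
  shows "specialization (orbit (J (weierstrass a b))) (orbit net_7b)"
proof -
  obtain k where "k ^ 2 = - a / 3" using nth_root_exists'[of 2 "- a / 3"] by auto
  then have k: "a = - (3 * k * k)" by (simp add: power2_eq_square field_simps)
  have U: "mp.span {qf 1 0 0 0 0 0, qf 0 0 0 1 0 0, qf 0 1 0 0 (- (2 * a)) 0} \<in> orbit net_7b"
    by (rule orbit_trans[OF orbit_rowsI[OF refl span_7b_nets,
          of 1 0 0 0 1 0 0 0 "- (2 * a)" 1 _ 0 _ 0 _ 0 0 1 0 "- (2 * a)" 0] span_7b_orbit],
        unfold qf_subst) (use a in simp_all)
  show ?thesis
  proof (rule specialization_of_qf_curve[OF refl U J_weierstrass_nets named_nets(4),
        of "qf 0 0 0 0 (2 * k) 0" "qf 0 0 0 0 0 0" "qf 0 0 (- (2 * a * k + 3 * b)) 0 0 0"], goal_cases)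
    case (1 t)
    obtain x where x: "x ^ 2 = t" using nth_root_exists'[of 2 t] by auto
    then have x0: "x \<noteq> 0" using 1 by auto
    \<comment> \<open>X is also shifted by k t Z, with t = x^2. Then -3 X^2 - a Z^2 = -3 (X - k Z)
      (X + k Z) becomes -3 X (X + 2 k t Z), which is linear in \<open>t\<close>; without the shift
      t^2 would occur.\<close>
    show ?case
      by (rule orbit_rowsI[OF J_weierstrass[of a b] J_weierstrass_nets[of a b],
            of 1 0 "k * (x * x)" 0 x 0 0 0 "x * x" "-3" _ 0 _ 0 _ 0 "2 * x * (x * x)" 0 0 0 "x * x"],
          unfold qf_subst) (use x0 in \<open>simp_all add: k x[symmetric] algebra_simps power2_eq_square\<close>)
  qed
qed

section \<open>Irreducible cubics\<close>

text \<open>Multiplies each variable by a new variable T: the coefficient of T^d is the homogeneous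
  part of degree d.\<close>

definition grading :: "'a::field form \<Rightarrow> 'a form poly" where
  "grading = mp_hom (\<lambda>c. [:Const c:]) (\<lambda>i. monom (Var i) 1)"

lemma coeff_hom_grading: "coeff_hom (\<lambda>c::'a::field. [:Const c :: 'a form:])"
  by (simp add: coeff_hom_def Const_add Const_mult)

lemma mon_val_Var: "mon_val Var m = Poly_Mapping.single m (1 :: 'a::comm_semiring_1)"
proof -
  have "mp_subst Var (Poly_Mapping.single m (1 :: 'a)) = Poly_Mapping.single m 1" by (rule mp_subst_Var)
  then show ?thesis unfolding mp_subst_hom mp_hom_single[OF coeff_hom_Const] by simp
qed

lemma mon_val_monom: "mon_val (\<lambda>i. monom (Var i) 1) m = monom (Poly_Mapping.single m (1 :: 'a::field)) (tdeg (m :: 3 \<Rightarrow>\<^sub>0 nat))"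
proof -
  have "(\<Prod>i\<in>I. monom (Var i) 1 ^ expo m i) = monom (\<Prod>i\<in>I. (Var i :: 'a form) ^ expo m i) (\<Sum>i\<in>I. expo m i)" if "finite I" for I
    using that by induction (simp_all add: monom_power mult_monom one_pCons monom_0)
  from this[OF finite_keys] show ?thesis unfolding mon_val_Var[symmetric] by (simp add: mon_val_def tdeg_def)
qed

lemma coeff_grading: "cf (coeff (grading p) d) m = (if tdeg m = d then cf p m else 0)"
proof (induction p rule: mpoly_single_induct)
  case (single n c)
  have "grading (Poly_Mapping.single n c) = [:Const c:] * monom (Poly_Mapping.single n 1) (tdeg n)"
    unfolding grading_def mp_hom_single[OF coeff_hom_grading] mon_val_monom ..
  also have "\<dots> = monom (Const c * Poly_Mapping.single n 1) (tdeg n)" by (simp add: smult_monom)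
  also have "Const c * Poly_Mapping.single n 1 = Poly_Mapping.single n c" by (simp add: Const_def mult_single)
  finally show ?case by (auto simp: lookup_single when_def)
next
  case (add p q)
  then show ?case unfolding grading_def mp_hom_add[OF coeff_hom_grading] by (simp add: lookup_add)
qed

lemma grading_mult: "grading (p * q) = grading p * grading q"
  unfolding grading_def by (rule mp_hom_mult[OF coeff_hom_grading])

lemma grading_homogeneous:
  assumes "p \<in> R d"
  shows "grading p = monom p d"
  by (rule poly_eqI, rule poly_mapping_eqI) (use assms in \<open>auto simp: coeff_grading homogeneous_iff\<close>)

text \<open>
  The degree and the order at 0 of the grading are both additive, and they coincide exactly for
  homogeneous polynomials.
\<close>

lemma homogeneous_factors:
  fixes p q :: "'a::field form"
  assumes "p * q \<in> R n" "p * q \<noteq> 0"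
  obtains i j where "i + j = n" "p \<in> R i" "q \<in> R j"
proof -
  let ?P = "grading p" and ?Q = "grading q"
  have PQ: "?P * ?Q = monom (p * q) n" using grading_homogeneous[OF assms(1)] by (simp add: grading_mult)
  have mono: "r \<in> R (degree (grading r))" if "order 0 (grading r) = degree (grading r)" "grading r \<noteq> 0" for r :: "'a form"
  proof -
    have "coeff (grading r) d = 0" if "d < degree (grading r)" for d
    proof -
      have "[:- 0, 1:] ^ degree (grading r) dvd grading r"
        using order_1[of 0 "grading r"] \<open>order 0 (grading r) = degree (grading r)\<close> by simp
      then obtain s where "grading r = monom 1 (degree (grading r)) * s"
        by (auto simp: monom_altdef elim!: dvdE)
      then have "coeff (grading r) d = coeff (monom 1 (degree (grading r)) * s) d" by simp
      then show ?thesis using \<open>d < _\<close> by (simp add: coeff_monom_mult)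
    qed
    then have c0: "coeff (grading r) d = 0" if "d \<noteq> degree (grading r)" for d
      using that coeff_eq_0[of "grading r" d] by (metis linorder_neqE_nat)
    show ?thesis unfolding homogeneous_iff
    proof (intro allI impI)
      fix m assume "cf r m \<noteq> 0"
      then have "cf (coeff (grading r) (tdeg m)) m \<noteq> 0" by (simp add: coeff_grading)
      then show "tdeg m = degree (grading r)" using c0 by force
    qed
  qed
  have nz: "?P * ?Q \<noteq> 0" unfolding PQ using assms(2) by (simp add: monom_eq_0_iff)
  then have nz': "?P \<noteq> 0" "?Q \<noteq> 0" by auto
  have deg: "degree ?P + degree ?Q = n"
    using degree_mult_eq[OF nz'] degree_monom_eq[OF assms(2), of n] unfolding PQ by simp
  have "order 0 (monom (p * q) n) = n"
    unfolding monom_altdef using order_smult[OF assms(2)] order_power_n_n[of 0 n] by simp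
  then have ord: "order 0 ?P + order 0 ?Q = n" using order_mult[OF nz, of 0] unfolding PQ by simp
  have "order 0 ?P \<le> degree ?P" "order 0 ?Q \<le> degree ?Q" using nz' order_degree by blast+
  then have "order 0 ?P = degree ?P" "order 0 ?Q = degree ?Q" using deg ord by linarith+
  then show thesis using that[OF deg mono mono] nz' by blast
qed

lemma R0_Const:
  assumes "p \<in> R 0"
  shows "p = Const (cf p 0)"
proof (rule poly_mapping_eqI)
  fix m
  show "cf p m = cf (Const (cf p 0)) m"
  proof (cases "m = 0")
    case False
    then have "tdeg m \<noteq> 0" by (metis gr_zeroI mon_expo mon_eq_iff tdeg_mon add_is_0 expo_mon mon_def add_0 single_zero)
    then show ?thesis using assms False by (auto simp: homogeneous_iff Const_def lookup_single)
  qed (simp add: Const_def)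
qed

lemma R1_linear:
  assumes "p \<in> R (Suc 0)"
  obtains a b c where "p = Const a * X + Const b * Y + Const c * (Z :: 'a::comm_ring_1 form)"
proof
  have V: "Const a * X = Poly_Mapping.single (mon 1 0 0) a" "Const a * Y = Poly_Mapping.single (mon 0 1 0) a"
    "Const a * Z = Poly_Mapping.single (mon 0 0 1) a" for a :: 'a
    by (simp_all add: single_mon)
  show "p = Const (cf p (mon 1 0 0)) * X + Const (cf p (mon 0 1 0)) * Y + Const (cf p (mon 0 0 1)) * Z"
    unfolding V
  proof (rule poly_mapping_eqI)
    fix m
    obtain i j k where m: "m = mon i j k" using mon_expo by blast
    show "cf p m = cf (Poly_Mapping.single (mon 1 0 0) (cf p (mon 1 0 0)) + Poly_Mapping.single (mon 0 1 0) (cf p (mon 0 1 0)) +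
        Poly_Mapping.single (mon 0 0 1) (cf p (mon 0 0 1))) m"
    proof (cases "i + j + k = 1")
      case True
      then have "i = 0 \<or> i = 1" "j = 0 \<or> j = 1" by arith+
      with True show ?thesis unfolding m by (elim disjE) (simp_all add: lookup_add lookup_single)
    next
      case False
      then have "cf p m = 0" using assms by (simp add: homogeneous_cf_0 m)
      then show ?thesis using False by (auto simp: m lookup_add lookup_single when_def)
    qed
  qed
qed

text \<open>Factors of a form are forms, so a reducible cubic has a linear factor and vanishes on
  its zero set. Excluding this pointwise reduces irreducibility to evaluating the cubic at suitable
  points.\<close>

lemma irreducible_cubic:
  fixes F :: "'a::field form"
  assumes F: "F \<in> R 3" "F \<noteq> 0"
    and lin: "\<And>a b c. (\<And>x. a * x $ 1 + b * x $ 2 + c * x $ 3 = 0 \<Longrightarrow> mp_eval (($) x) F = 0) \<Longrightarrow> False"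
  shows "irreducible F"
proof -
  have unit: "p dvd 1" if "p \<in> R 0" "p \<noteq> 0" for p :: "'a form"
  proof -
    define c where "c = cf p 0"
    have p: "p = Const c" unfolding c_def by (rule R0_Const[OF that(1)])
    then have "c \<noteq> 0" using that(2) by auto
    then have "1 = p * Const (1 / c)" unfolding p by (simp flip: Const_mult)
    then show ?thesis by (rule dvdI)
  qed
  have nolin: False if Flq: "F = l * q" and l1: "l \<in> R (Suc 0)" for l q :: "'a form"
  proof -
    obtain a b c where l: "l = Const a * X + Const b * Y + Const c * Z" using l1 by (rule R1_linear)
    show False
    proof (rule lin[of a b c])
      fix x :: "'a^3" assume "a * x $ 1 + b * x $ 2 + c * x $ 3 = 0"
      then show "mp_eval (($) x) F = 0" unfolding Flq l by simp
    qed
  qed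
  show ?thesis
  proof (rule irreducibleI)
    show "F \<noteq> 0" by (rule F(2))
    show "\<not> F dvd 1"
    proof
      assume "F dvd 1"
      then obtain G where G: "F * G = 1" by (metis dvdE)
      have "F * G \<in> R 0" "F * G \<noteq> 0" unfolding G by simp_all
      then obtain i j where ij: "i + j = 0" "F \<in> R i" by (rule homogeneous_factors)
      obtain m where m: "cf F m \<noteq> 0" using F(2) by (metis lookup_zero poly_mapping_eqI)
      then have "tdeg m = i" "tdeg m = 3" using ij(2) F(1) unfolding homogeneous_iff by blast+
      then show False using ij(1) by simp
    qed
    fix p q assume pq: "F = p * q"
    then have nz: "p \<noteq> 0" "q \<noteq> 0" using F(2) by auto
    obtain i j where ij: "i + j = 3" "p \<in> R i" "q \<in> R j" using homogeneous_factors[of p q 3] F pq by metis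
    have "i = 0 \<or> i = 1 \<or> i = 2 \<or> i = 3" using ij(1) by arith
    then show "p dvd 1 \<or> q dvd 1"
    proof (elim disjE)
      assume "i = 0" then show ?thesis using unit[of p] ij(2) nz(1) by simp
    next
      assume "i = 1" then show ?thesis using nolin[of p q] pq ij(2) by simp
    next
      assume "i = 2"
      then have "j = Suc 0" using ij(1) by simp
      then show ?thesis using nolin[of q p] pq ij(3) by (simp add: mult.commute)
    next
      assume "i = 3"
      then have "j = 0" using ij(1) by simp
      then show ?thesis using unit[of q] ij(3) nz(2) by simp
    qed
  qed
qed

text \<open>The discriminants of #8a and #8c both have this shape. The node is (1, 0, 0), with
  tangents Y = 0 and Z = 0.\<close>

lemma nodal_cubicI:
  fixes p r :: "'a::field_char_0"
  assumes "p \<noteq> 0" "r \<noteq> 0"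
  shows "nodal_cubic (cub 0 p p 0 0 0 0 0 0 r)" (is "nodal_cubic ?F")
  unfolding nodal_cubic_def
proof (intro conjI exI)
  have ev: "mp_eval (($) (\<chi> k. triple x y z k)) ?F = p * y ^ 3 + p * z ^ 3 + r * (x * y * z)" for x y z by simp
  show "irreducible ?F"
  proof (rule irreducible_cubic)
    show "?F \<noteq> 0" using assms cub_eq_iff[of 0 p p 0 0 0 0 0 0 r 0 0 0 0 0 0 0 0 0 0] by (simp add: cub_0)
    fix a b c assume *: "\<And>x :: 'a^3. a * x $ 1 + b * x $ 2 + c * x $ 3 = 0 \<Longrightarrow> mp_eval (($) x) ?F = 0"
    have v: "p * y ^ 3 + p * z ^ 3 + r * (x * y * z) = 0" if "a * x + b * y + c * z = 0" for x y z
      unfolding ev[symmetric] by (rule *) (use that in simp)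
    \<comment> \<open>The point (-b, a, 0) of the line forces a = 0; after that (x, c, -b) lies on
      the line for every x.\<close>
    have "a = 0" using v[of "- b" a 0] assms by simp
    then have 1: "p * c ^ 3 - p * b ^ 3 - r * (x * c * b) = 0" for x using v[of x c "- b"] by simp
    have "b = 0 \<or> c = 0" "p * c ^ 3 = p * b ^ 3" using 1[of 0] 1[of 1] assms by auto
    then have "b = 0" "c = 0" using assms by auto
    then show False using v[of 0 1 0] \<open>a = 0\<close> assms by simp
  qed simp
  show "node ?F (axis 1 1)"
    unfolding node_def
  proof (rule conjI)
    show "singular_point ?F (axis 1 1)"
      unfolding singular_point_def
      by (simp add: axis_eq_0_iff forall_3 mp_diff_cub) (simp add: axis_def)
    \<comment> \<open>X is added as a third form so that the results on triples apply.\<close>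
    have "indep3 (Const (2 * r) * Y) Z X"
      unfolding indep3_def
    proof (intro allI impI)
      fix u v w assume eq: "Const u * (Const (2 * r) * Y) + Const v * Z + Const w * X = (0 :: 'a form)"
      have "mp_eval (($) x) (Const u * (Const (2 * r) * Y) + Const v * Z + Const w * X) = 0" for x :: "'a^3"
        unfolding eq by simp
      from this[of "axis 1 1"] this[of "axis 2 1"] this[of "axis 3 1"]
      show "u = 0 \<and> v = 0 \<and> w = 0" using assms by (simp add: axis_def)
    qed
    note i = indep3_imp[OF this]
    have ne: "Const (2 * r) * Y \<noteq> (Z :: 'a form)" by (rule i(2))
    have li: "mp.independent {Const (2 * r) * Y, Z :: 'a form}" by (rule mp.independent_mono[OF i(1)]) auto
    have tc: "tangent_cone ?F (axis 1 1) = Const (2 * r) * Y * Z"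
      unfolding tangent_cone_def
      by (simp add: sum_3 mp_diff_cub mp_diff_qf axis_def Const_mult Const_numeral algebra_simps)
    have l: "Const (2 * r) * Y \<in> (R 1 :: 'a form set)" using homogeneous_Const_mult[OF homogeneous_Var] by simp
    have l': "Z \<in> (R 1 :: 'a form set)" by simp
    show "\<exists>l\<in>R 1. \<exists>l'\<in>R 1. l \<noteq> l' \<and> mp.independent {l, l'} \<and> tangent_cone ?F (axis 1 1) = l * l'"
      using ne li tc by (intro bexI[OF bexI[OF _ l'] l] conjI)
  qed
qed simp

text \<open>The factor 1/2 compensates the 2 in \<open>tangent_cone\<close>, so that the tangent
  cone at (0, 0, 1) is exactly Y^2.\<close>

lemma cuspidal_cubicI:
  fixes p :: "'a::field_char_0"
  assumes "p \<noteq> 0"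
  shows "cuspidal_cubic (cub p 0 0 0 0 0 (1 / 2) 0 0 0)" (is "cuspidal_cubic ?F")
  unfolding cuspidal_cubic_def
proof (intro conjI exI)
  have ev: "mp_eval (($) (\<chi> k. triple x y z k)) ?F = p * x ^ 3 + (1 / 2) * (y\<^sup>2 * z)" for x y z by simp
  show "irreducible ?F"
  proof (rule irreducible_cubic)
    show "?F \<noteq> 0" using assms cub_eq_iff[of p 0 0 0 0 0 "1 / 2" 0 0 0 0 0 0 0 0 0 0 0 0 0] by (simp add: cub_0)
    fix a b c assume *: "\<And>x :: 'a^3. a * x $ 1 + b * x $ 2 + c * x $ 3 = 0 \<Longrightarrow> mp_eval (($) x) ?F = 0"
    have v: "p * x ^ 3 + (1 / 2) * (y\<^sup>2 * z) = 0" if "a * x + b * y + c * z = 0" for x y z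
      unfolding ev[symmetric] by (rule *) (use that in simp)
    have "b = 0" using v[of "- b" a 0] assms by simp
    then have 1: "p * (- c) ^ 3 + (1 / 2) * (y\<^sup>2 * a) = 0" for y using v[of "- c" y a] by simp
    have "c = 0" using 1[of 0] assms by simp
    then have "a = 0" using 1[of 1] by simp
    then show False using v[of 1 0 0] \<open>b = 0\<close> \<open>c = 0\<close> assms by simp
  qed simp
  show "cusp ?F (axis 3 1)"
    unfolding cusp_def
  proof (intro conjI bexI[of _ Y])
    show "singular_point ?F (axis 3 1)"
      unfolding singular_point_def
      by (simp add: axis_eq_0_iff forall_3 mp_diff_cub) (simp add: axis_def)
    show "(Y :: 'a form) \<noteq> 0"
    proof
      assume "(Y :: 'a form) = 0"
      then have "mp_eval (($) (axis 2 1)) (Y :: 'a form) = mp_eval (($) (axis 2 1 :: 'a^3)) 0" by (rule arg_cong)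
      then show False by (simp add: axis_def)
    qed
    show "tangent_cone ?F (axis 3 1) = Y * Y"
      unfolding tangent_cone_def
      by (simp add: sum_3 mp_diff_cub mp_diff_qf axis_def)
    show "Y \<in> (R 1 :: 'a form set)" by simp
  qed
qed simp

section \<open>Discriminants of #8a, #8c and #7b\<close>

lemma discriminant_form_R3: "discriminant_form b \<in> R 3"
proof -
  have M: "(\<Sum>l\<in>UNIV. Const (conic_matrix (b l) $ i $ j) * Var l) \<in> R (Suc 0)" for i j
    by (intro homogeneous_sum homogeneous_Const_mult homogeneous_Var)
  have prod: "p * q * r \<in> R 3" if "p \<in> R (Suc 0)" "q \<in> R (Suc 0)" "r \<in> R (Suc 0)" for p q r :: "'a::field form"
    using homogeneous_mult[OF homogeneous_mult[OF that(1,2)] that(3)] by (simp add: numeral_3_eq_3)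
  have neg: "p - q \<in> R 3" if "p \<in> R 3" "q \<in> R 3" for p q :: "'a::field form"
    using homogeneous_add[OF that(1) homogeneous_Const_mult[OF that(2), of "-1"]] by (simp add: Const_uminus)
  show ?thesis
    unfolding discriminant_form_def det_3 by (simp only: vec_lambda_beta) (intro neg homogeneous_add prod M)
qed

lemma discriminant_form_eqI:
  fixes b :: "3 \<Rightarrow> 'a::field_char_0 form"
  assumes "F \<in> R 3"
    and "\<And>u v w. mp_eval (($) (\<chi> k. triple u v w k)) F =
      det (conic_matrix (Const u * b 1 + Const v * b 2 + Const w * b 3))"
  shows "discriminant_form b = F"
proof (rule R3_eqI[OF discriminant_form_R3 assms(1)])
  fix x :: "'a^3"
  have x: "x = (\<chi> k. triple (x $ 1) (x $ 2) (x $ 3) k)" by (simp add: vec_eq_iff forall_3)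
  have "mp_eval (($) x) F = det (conic_matrix (Const (x $ 1) * b 1 + Const (x $ 2) * b 2 + Const (x $ 3) * b 3))"
    by (subst x) (rule assms(2))
  then show "mp_eval (($) x) (discriminant_form b) = mp_eval (($) x) F"
    unfolding discriminant_eval(1) det_3 by (simp add: algebra_simps)
qed

lemma discriminant_8a: "discriminant_cubic nodal_cubic (net_8a :: 'a::field_char_0 form set)"
proof -
  let ?b = "triple (qf 0 0 0 0 0 1) (qf 1 0 0 1 0 0) (qf 0 1 0 0 1 (0 :: 'a))"
  have "discriminant_form ?b = cub 0 (-1/4) (-1/4) 0 0 0 0 0 0 (1/4)"
    by (rule discriminant_form_eqI) (simp_all add: qf_comb qf_scale qf_add conic_matrix_qf det_rows field_simps power3_eq_cube)
  moreover have "is_basis ?b net_8a"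
    unfolding named_nets_qf by (rule is_basis_triple) (rule indep3_named)
  ultimately show ?thesis unfolding discriminant_cubic_def by (intro exI[of _ ?b]) (simp add: nodal_cubicI)
qed

lemma discriminant_8c: "discriminant_cubic nodal_cubic (net_8c :: 'a::field_char_0 form set)"
proof -
  let ?b = "triple (qf 0 0 1 0 0 0) (qf 1 0 0 (-1) 0 0) (qf 0 1 0 0 (-1) (0 :: 'a))"
  have "discriminant_form ?b = cub 0 (-1/4) (-1/4) 0 0 0 0 0 0 1"
    by (rule discriminant_form_eqI) (simp_all add: qf_comb qf_scale qf_add conic_matrix_qf det_rows field_simps power3_eq_cube)
  moreover have "is_basis ?b net_8c"
    unfolding named_nets_qf by (rule is_basis_triple) (rule indep3_named)
  ultimately show ?thesis unfolding discriminant_cubic_def by (intro exI[of _ ?b]) (simp add: nodal_cubicI)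
qed

lemma discriminant_7b: "discriminant_cubic cuspidal_cubic (net_7b :: 'a::field_char_0 form set)"
proof -
  \<comment> \<open>The generator -2 Z^2 in place of Z^2 gives Y^2 Z the coefficient 1/2 expected by
    \<open>cuspidal_cubicI\<close>.\<close>
  let ?b = "triple (qf 1 0 0 1 0 0) (qf 0 0 0 0 0 1) (qf 0 0 (-2) 0 0 (0 :: 'a))"
  have "discriminant_form ?b = cub (-1/4) 0 0 0 0 0 (1/2) 0 0 0"
    by (rule discriminant_form_eqI) (simp_all add: qf_comb qf_scale qf_add conic_matrix_qf det_rows field_simps power2_eq_square power3_eq_cube)
  moreover have "is_basis ?b net_7b"
  proof -
    have i: "indep3 (qf 1 0 0 1 0 0) (qf 0 0 0 0 0 1) (qf 0 0 (-2) 0 0 (0 :: 'a))" by (rule indep3_qf) simp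
    have "net_7b = mp.span {qf 1 0 0 1 0 0, qf 0 0 0 0 0 1, qf 0 0 (-2) 0 0 (0 :: 'a)}"
    proof (rule span_of_mem[OF _ i])
      show "net_7b \<in> (nets :: 'a form set set)" by simp
      show "qf 1 0 0 1 0 0 \<in> (net_7b :: 'a form set)" "qf 0 0 0 0 0 1 \<in> (net_7b :: 'a form set)"
        unfolding named_nets_qf by (rule in_span3_generators)+
      show "qf 0 0 (-2) 0 0 0 \<in> (net_7b :: 'a form set)"
        unfolding named_nets_qf by (rule in_span3I[of _ 0 _ 0 _ "-2"]) (simp add: qf_scale)
    qed
    then show ?thesis using is_basis_triple[OF i] by simp
  qed
  ultimately show ?thesis unfolding discriminant_cubic_def by (intro exI[of _ ?b]) (simp add: cuspidal_cubicI)
qed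

section \<open>Obstructions to specialization\<close>

text \<open>\<open>\<alpha>\<close> is the value of \<open>inv4\<close> and \<open>\<beta>\<close>
  that of the square of \<open>inv2\<close> for some basis. Another basis multiplies both by the
  same fourth power, so the pair is zero or a point of the projective line.\<close>

definition kinv_net :: "'a::field_char_0 form set \<Rightarrow> 'a \<Rightarrow> 'a \<Rightarrow> bool" where
  "kinv_net V \<alpha> \<beta> \<longleftrightarrow> (\<exists>p q r. V = mp.span {p, q, r} \<and> indep3 p q r \<and> p \<in> R 2 \<and> q \<in> R 2 \<and> r \<in> R 2 \<and>
     (\<forall>c. kinv c (pluecker (triple p q r)) = \<beta> * c + \<alpha>))"

lemma kinv_netI:
  "indep3 p q r \<Longrightarrow> p \<in> R 2 \<Longrightarrow> q \<in> R 2 \<Longrightarrow> r \<in> R 2 \<Longrightarrow>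
    (\<And>c. kinv c (pluecker (triple p q r)) = \<beta> * c + \<alpha>) \<Longrightarrow> kinv_net (mp.span {p, q, r}) \<alpha> \<beta>"
  unfolding kinv_net_def by blast

lemma kinv_net_nets: "kinv_net V \<alpha> \<beta> \<Longrightarrow> V \<in> nets"
  unfolding kinv_net_def using span3_nets by blast

lemma kinv_net_weierstrass:
  "kinv_net (J (weierstrass a b)) (- 331776 * a ^ 3 - 2985984 * b\<^sup>2) (746496 * (b\<^sup>2 :: 'a::field_char_0))"
  unfolding J_weierstrass by (rule kinv_netI[OF indep3_weierstrass qf_in_R2 qf_in_R2 qf_in_R2], unfold kinv_weierstrass) (simp add: algebra_simps)

lemma kinv_net_named:
  "kinv_net (net_8a :: 'a::field_char_0 form set) (-1) 1" "kinv_net (net_7a :: 'a form set) (-1) 1"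
  "kinv_net (net_6a :: 'a form set) (-1) 1"
  "kinv_net (net_8c :: 'a form set) (-256) 64" "kinv_net (net_7c :: 'a form set) (-256) 64"
  "kinv_net (net_6d :: 'a form set) (-256) 64"
  "kinv_net (net_7b :: 'a form set) 0 0" "kinv_net (net_6b :: 'a form set) 0 0" "kinv_net (net_6c :: 'a form set) 0 0"
  "kinv_net (net_5a :: 'a form set) 0 0" "kinv_net (net_5b :: 'a form set) 0 0" "kinv_net (net_4 :: 'a form set) 0 0"
  "kinv_net (net_2a :: 'a form set) 0 0" "kinv_net (net_2b :: 'a form set) 0 0"
  unfolding named_nets_qf
  by (rule kinv_netI, rule indep3_named, simp_all add: kinv_named)+

lemma kinv_net_orbit:
  assumes "kinv_net V \<alpha> \<beta>" "kinv_net W \<alpha>' \<beta>'" "orbit V = orbit W"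
  shows "\<exists>e. \<alpha>' = e * \<alpha> \<and> \<beta>' = e * \<beta>"
proof -
  obtain p q r where V: "V = mp.span {p, q, r}" "indep3 p q r" "p \<in> R 2" "q \<in> R 2" "r \<in> R 2"
    "\<forall>c. kinv c (pluecker (triple p q r)) = \<beta> * c + \<alpha>" using assms(1) unfolding kinv_net_def by blast
  obtain p' q' r' where W: "W = mp.span {p', q', r'}" "indep3 p' q' r'"
    "\<forall>c. kinv c (pluecker (triple p' q' r')) = \<beta>' * c + \<alpha>'" using assms(2) unfolding kinv_net_def by blast
  have "mp.span {p', q', r'} \<in> orbit (mp.span {p, q, r})" using assms(3) unfolding V(1) W(1) orbit_eq by simp
  then obtain e where e: "\<And>c. kinv c (pluecker (triple p' q' r')) = e * kinv c (pluecker (triple p q r))"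
    by (rule same_orbit_kinv[OF V(2-5) W(2)]) blast
  have "\<beta>' * c + \<alpha>' = e * (\<beta> * c + \<alpha>)" for c using e[of c] V(6) W(3) by simp
  from this[of 0] this[of 1] show ?thesis by (auto simp: algebra_simps)
qed

text \<open>The invariants \<open>kinv c\<close> form a pencil, so one member of it vanishes on the orbit of \<open>V\<close>.\<close>

lemma kinv_net_specialization:
  assumes "kinv_net V \<alpha> \<beta>" "kinv_net W \<alpha>' \<beta>'" "specialization (orbit V) (orbit W)"
  shows "\<alpha> * \<beta>' = \<alpha>' * \<beta>"
proof (rule ccontr)
  assume ne: "\<alpha> * \<beta>' \<noteq> \<alpha>' * \<beta>"
  obtain p q r where V: "V = mp.span {p, q, r}" "indep3 p q r" "p \<in> R 2" "q \<in> R 2" "r \<in> R 2"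
    "\<forall>c. kinv c (pluecker (triple p q r)) = \<beta> * c + \<alpha>" using assms(1) unfolding kinv_net_def by blast
  obtain p' q' r' where W: "W = mp.span {p', q', r'}" "indep3 p' q' r'" "p' \<in> R 2" "q' \<in> R 2" "r' \<in> R 2"
    "\<forall>c. kinv c (pluecker (triple p' q' r')) = \<beta>' * c + \<alpha>'" using assms(2) unfolding kinv_net_def by blast
  \<comment> \<open>\<open>kinv 1 - kinv 0\<close> is the square of \<open>inv2\<close> and
    \<open>kinv 0\<close> is \<open>inv4\<close>, so \<open>?P\<close> vanishes on \<open>V\<close>;
    it also covers the member of the pencil at c = infinity.\<close>
  let ?P = "\<lambda>w. \<alpha> * (kinv 1 w - kinv 0 w) - \<beta> * kinv 0 w"
  have "\<not> specialization (orbit V) (orbit W)"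
  proof (rule not_specialization)
    show "hom_fun 4 ?P" by (intro hom_fun_diff hom_fun_scale hom_fun_kinv)
    show "\<exists>b. is_basis b U \<and> ?P (pluecker b) = 0" if U: "U \<in> orbit V" for U
    proof -
      obtain b d where "is_basis b U" "\<And>c. kinv c (pluecker b) = d ^ 8 * kinv c (pluecker (triple p q r))"
        by (rule kinv_orbit[OF V(2-5) U[unfolded V(1)]]) blast
      then show ?thesis using V(6) by (intro exI[of _ b]) (simp add: algebra_simps)
    qed
    show "W \<in> nets" by (rule kinv_net_nets[OF assms(2)])
    show "is_basis (triple p' q' r') W" unfolding W(1) by (rule is_basis_triple[OF W(2)])
    show "?P (pluecker (triple p' q' r')) \<noteq> 0" using W(6) ne by (simp add: mult.commute)
  qed (rule orbit_refl)
  then show False using assms(3) by blast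
qed

text \<open>The pencil vanishes on both sides here, so the cone condition decides. The three numbers
  after the underscores are the vertex of the cone, for instance (0, -2, 1) for #6b, whose Jacobian
  cubic is X^2 (Y + 2Z) up to a factor.\<close>

lemma not_specialization_7b:
  fixes N :: "'a::field_char_0 form set"
  assumes "N \<in> {net_6b, net_6c, net_5a, net_5b, net_4, net_2a, net_2b}"
  shows "\<not> specialization (orbit N) (orbit net_7b)"
proof -
  have h: "hess (jac (pluecker (triple (qf 1 0 0 1 0 0) (qf 0 0 0 0 0 1) (qf 0 0 1 0 0 (0::'a))))) \<noteq> 0"
    by (simp add: hess_def jac_def bracket_pluecker)
  note n = not_specialization_cone[OF _ qf_in_R2 qf_in_R2 qf_in_R2 coneI indep3_named(7) qf_in_R2 qf_in_R2 qf_in_R2 h]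
  have "\<not> specialization (orbit net_6b) (orbit (net_7b :: 'a form set))" unfolding named_nets_qf
    by (rule n[of _ _ _ _ _ _ _ _ _ _ _ _ _ _ _ _ _ _ 0 "-2" 1], rule indep3_named) (simp_all add: jac_def bracket_pluecker)
  moreover have "\<not> specialization (orbit net_6c) (orbit (net_7b :: 'a form set))" unfolding named_nets_qf
    by (rule n[of _ _ _ _ _ _ _ _ _ _ _ _ _ _ _ _ _ _ 0 1 0], rule indep3_named) (simp_all add: jac_def bracket_pluecker)
  moreover have "\<not> specialization (orbit net_5a) (orbit (net_7b :: 'a form set))" unfolding named_nets_qf
    by (rule n[of _ _ _ _ _ _ _ _ _ _ _ _ _ _ _ _ _ _ 0 1 0], rule indep3_named) (simp_all add: jac_def bracket_pluecker)
  moreover have "\<not> specialization (orbit net_5b) (orbit (net_7b :: 'a form set))" unfolding named_nets_qf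
    by (rule n[of _ _ _ _ _ _ _ _ _ _ _ _ _ _ _ _ _ _ 1 0 0], rule indep3_named) (simp_all add: jac_def bracket_pluecker)
  moreover have "\<not> specialization (orbit net_4) (orbit (net_7b :: 'a form set))" unfolding named_nets_qf
    by (rule n[of _ _ _ _ _ _ _ _ _ _ _ _ _ _ _ _ _ _ 1 0 0], rule indep3_named) (simp_all add: jac_def bracket_pluecker)
  moreover have "\<not> specialization (orbit net_2a) (orbit (net_7b :: 'a form set))" unfolding named_nets_qf
    by (rule n[of _ _ _ _ _ _ _ _ _ _ _ _ _ _ _ _ _ _ 0 1 0], rule indep3_named) (simp_all add: jac_def bracket_pluecker)
  moreover have "\<not> specialization (orbit net_2b) (orbit (net_7b :: 'a form set))" unfolding named_nets_qf
    by (rule n[of _ _ _ _ _ _ _ _ _ _ _ _ _ _ _ _ _ _ 0 0 1], rule indep3_named) (simp_all add: jac_def bracket_pluecker)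
  ultimately show ?thesis using assms by blast
qed

text \<open>The pencil does not separate #8a from #7a and #6a, but #8a has the single base point (0,
  0, 1).\<close>

lemma orbit_8a_base_points:
  fixes W :: "'a::field_char_0 form set"
  assumes "\<And>q. q \<in> W \<Longrightarrow> mp_eval (($) (axis 2 1)) q = 0" "\<And>q. q \<in> W \<Longrightarrow> mp_eval (($) (axis 3 1)) q = 0"
  shows "orbit W \<noteq> orbit net_8a"
proof
  assume "orbit W = orbit net_8a"
  then have "W \<in> orbit net_8a" unfolding orbit_eq .
  then obtain A where A: "invertible A" "W = lin_subst A ` net_8a" unfolding orbit_def by blast
  have base: "x $ 1 = 0 \<and> x $ 2 = 0" if "\<And>q. q \<in> net_8a \<Longrightarrow> mp_eval (($) x) q = 0" for x :: "'a^3"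
  proof -
    have "X * Y \<in> (net_8a :: 'a form set)" "X\<^sup>2 + Y * Z \<in> (net_8a :: 'a form set)" "Y\<^sup>2 + X * Z \<in> (net_8a :: 'a form set)"
      unfolding net_8a_def by (rule in_span3_generators)+
    from this[THEN that] show ?thesis by auto
  qed
  have "(A *v axis 2 1) $ 1 = 0 \<and> (A *v axis 2 1) $ 2 = 0" "(A *v axis 3 1) $ 1 = 0 \<and> (A *v axis 3 1) $ 2 = 0"
    by (rule base, rule assms[unfolded A(2), OF imageI, unfolded mp_eval_lin_subst], assumption)+
  then have "A $ 1 $ 2 = 0" "A $ 2 $ 2 = 0" "A $ 1 $ 3 = 0" "A $ 2 $ 3 = 0"
    by (simp_all add: matrix_vector_mult_def sum_3 axis_def)
  then show False using A(1) by (simp add: invertible_det_nz det_3)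
qed

text \<open>The pencil does not separate #8c from #7c and #6d, but the only squares in #8c are the
  multiples of Z^2.\<close>

lemma orbit_8c_squares:
  fixes W :: "'a::field_char_0 form set"
  assumes "qf 0 1 0 0 0 0 \<in> W" "qf 0 0 1 0 0 0 \<in> W"
  shows "orbit W \<noteq> orbit net_8c"
proof
  assume "orbit W = orbit net_8c"
  then have "net_8c \<in> orbit W" unfolding orbit_eq by simp
  then obtain A where A: "invertible A" "net_8c = lin_subst A ` W" unfolding orbit_def by blast
  \<comment> \<open>The form in question is the square of x X + y Y + z Z.\<close>
  have square: "x = 0 \<and> y = 0" if xyz: "qf (x\<^sup>2) (y\<^sup>2) (z\<^sup>2) (2 * (y * z)) (2 * (x * z)) (2 * (x * y)) \<in> net_8c" for x y z :: 'a
  proof -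
    obtain a b c where "qf (x\<^sup>2) (y\<^sup>2) (z\<^sup>2) (2 * (y * z)) (2 * (x * z)) (2 * (x * y)) =
        Const a * qf 0 0 1 0 0 0 + Const b * qf 1 0 0 (-1) 0 0 + Const c * qf 0 1 0 0 (-1) 0"
      using xyz unfolding named_nets_qf in_span3 by blast
    then have "x\<^sup>2 = b" "y\<^sup>2 = c" "2 * (y * z) = - b" "2 * (x * z) = - c" "x = 0 \<or> y = 0"
      unfolding qf_scale qf_add qf_eq_iff by simp_all
    then show ?thesis by auto
  qed
  have "lin_subst A (qf 0 1 0 0 0 0) \<in> net_8c" "lin_subst A (qf 0 0 1 0 0 0) \<in> net_8c"
    unfolding A(2) by (rule imageI, rule assms)+
  then have "qf ((A$2$1)\<^sup>2) ((A$2$2)\<^sup>2) ((A$2$3)\<^sup>2) (2 * (A$2$2 * A$2$3)) (2 * (A$2$1 * A$2$3)) (2 * (A$2$1 * A$2$2)) \<in> net_8c"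
    "qf ((A$3$1)\<^sup>2) ((A$3$2)\<^sup>2) ((A$3$3)\<^sup>2) (2 * (A$3$2 * A$3$3)) (2 * (A$3$1 * A$3$3)) (2 * (A$3$1 * A$3$2)) \<in> net_8c"
    by (simp_all add: lin_subst_qf)
  from this[THEN square] show False using A(1) by (simp add: invertible_det_nz det_3)
qed

section \<open>The specializations\<close>

lemma orbit_cases:
  fixes V :: "'k::{alg_closed_field, field_char_0} form set"
  assumes V: "V \<in> nets"
  shows "(\<exists>a b. 4 * a ^ 3 + 27 * b\<^sup>2 \<noteq> 0 \<and> orbit V = orbit (J (weierstrass a b))) \<or>
    (\<exists>N\<in>{net_8a, net_7a, net_6a, net_8c, net_7c, net_6d, net_7b, net_6b, net_6c, net_5a, net_5b, net_4, net_2a, net_2b}.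
      orbit V = orbit N)"
proof -
  have N: "\<exists>N\<in>S. orbit V = orbit N" if *: "\<exists>N\<in>S'. N \<in> orbit V" "S' \<subseteq> S" for S S'
    using * unfolding orbit_eq by blast
  consider \<phi> where "smooth_cubic \<phi>" "V = J \<phi>" | "\<exists>N\<in>{net_8a, net_7a, net_6a, net_5b, net_4}. N \<in> orbit V"
    | "\<exists>N\<in>nets_with_square. N \<in> orbit V"
    using classification_of_nets[OF V] unfolding orbit_of_square_def by blast
  then show ?thesis
  proof cases
    case 1
    obtain A a b where W: "invertible A" "lin_subst A \<phi> = weierstrass a b" "4 * a ^ 3 + 27 * b\<^sup>2 \<noteq> 0"
      by (rule smooth_cubic_weierstrass[OF 1(1)])
    have "orbit V = orbit (J (weierstrass a b))"
      using form_iso_orbit_J[OF form_isoI[OF W(1,2)]] unfolding orbit_eq 1(2) by simp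
    then show ?thesis using W(3) by blast
  next
    case 2
    show ?thesis by (rule disjI2, rule N[OF 2]) auto
  next
    case 3
    show ?thesis by (rule disjI2, rule N[OF 3[unfolded nets_with_square_def]]) auto
  qed
qed

lemma J_smooth_weierstrass:
  fixes \<phi> :: "'k::{alg_closed_field, field_char_0} form"
  assumes "smooth_cubic \<phi>" "\<not> form_iso \<phi> fermat"
  obtains a b where "a \<noteq> 0" "4 * a ^ 3 + 27 * b\<^sup>2 \<noteq> 0" "orbit (J \<phi>) = orbit (J (weierstrass a b))"
proof -
  obtain A a b where A: "invertible A" "lin_subst A \<phi> = weierstrass a b" and d: "4 * a ^ 3 + 27 * b\<^sup>2 \<noteq> 0"
    by (rule smooth_cubic_weierstrass[OF assms(1)])
  have "a \<noteq> 0"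
  proof
    assume a: "a = 0"
    then have "b \<noteq> 0" using d by auto
    then obtain B where B: "invertible B" "lin_subst B (weierstrass 0 b) = fermat" by (rule weierstrass_fermat)
    have "lin_subst (A ** B) \<phi> = fermat" using A(2) B(2) a by (simp flip: lin_subst_lin_subst)
    then show False using assms(2) form_isoI invertible_mult[OF A(1) B(1)] by blast
  qed
  moreover have "orbit (J \<phi>) = orbit (J (weierstrass a b))"
    using form_iso_orbit_J[OF form_isoI[OF A]] unfolding orbit_eq by simp
  ultimately show thesis using that d by blast
qed

text \<open>An intermediate orbit either has the same ratio of invariants as (a, b), and then the
  same j, or it is null. The position at j = infinity is excluded by the nonzero discriminant, the
  named orbits at j = 0 by a \<noteq> 0, and the null orbits other than #7b cannot specialize to
  #7b.\<close>

lemma elementary_specialization_7b: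
  fixes a b :: "'k::{alg_closed_field, field_char_0}"
  assumes a: "a \<noteq> 0" and d: "4 * a ^ 3 + 27 * b\<^sup>2 \<noteq> 0"
  shows "elementary_specialization (orbit (J (weierstrass a b))) (orbit net_7b)"
  unfolding elementary_specialization_def
proof (intro conjI ballI impI)
  show "orbit (J (weierstrass a b)) \<in> orbits" "orbit (net_7b :: 'k form set) \<in> orbits"
    unfolding orbits_def by (intro imageI J_weierstrass_nets named_nets)+
  show "specialization (orbit (J (weierstrass a b))) (orbit net_7b)" by (rule J_weierstrass_spec_7b[OF a])
  show "orbit (J (weierstrass a b)) \<noteq> orbit net_7b"
  proof
    assume "orbit (J (weierstrass a b)) = orbit net_7b"
    from kinv_net_orbit[OF kinv_net_named(7) kinv_net_weierstrass this[symmetric]] show False using a by auto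
  qed
  fix C :: "'k form set set"
  assume "C \<in> orbits" and C: "specialization C (orbit net_7b) \<and> specialization (orbit (J (weierstrass a b))) C"
  then obtain V where V: "V \<in> nets" "C = orbit V" unfolding orbits_def by blast
  note rel = kinv_net_specialization[OF kinv_net_weierstrass[of a b]]
  from orbit_cases[OF V(1)] show "C = orbit (J (weierstrass a b)) \<or> C = orbit net_7b"
  proof (elim disjE exE conjE bexE)
    fix a' b' assume d': "4 * a' ^ 3 + 27 * b'\<^sup>2 \<noteq> 0" and C': "orbit V = orbit (J (weierstrass a' b'))"
    have "(- 331776 * a ^ 3 - 2985984 * b\<^sup>2) * (746496 * b'\<^sup>2) = (- 331776 * a' ^ 3 - 2985984 * b'\<^sup>2) * (746496 * b\<^sup>2)"
      by (rule rel[OF kinv_net_weierstrass]) (use C V C' in simp)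
    then have "(- 331776 * 746496) * (a ^ 3 * b'\<^sup>2) = (- 331776 * 746496) * (a' ^ 3 * b\<^sup>2)" by (simp add: algebra_simps)
    then have "a ^ 3 * b'\<^sup>2 = a' ^ 3 * b\<^sup>2" by simp
    from weierstrass_scaling[OF this d d'] show ?thesis unfolding orbit_eq V(2) C' by simp
  next
    fix N :: "'k form set"
    assume N: "N \<in> {net_8a, net_7a, net_6a, net_8c, net_7c, net_6d, net_7b, net_6b, net_6c, net_5a, net_5b, net_4, net_2a, net_2b}"
      and C': "orbit V = orbit N"
    \<comment> \<open>This is the member c = 1 of the pencil: 331776 = 4 * 82944 and 2985984 -
      746496 = 27 * 82944.\<close>
    have 1: False if "kinv_net N (-1) 1"
    proof -
      have "- 331776 * a ^ 3 - 2985984 * b\<^sup>2 = - (746496 * b\<^sup>2)" using rel[OF that] C V C' by simp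
      then have "82944 * (4 * a ^ 3 + 27 * b\<^sup>2) = 0" by algebra
      then show False using d unfolding mult_eq_0_iff by simp
    qed
    \<comment> \<open>This is the member c = 4, in which b^2 cancels because 2985984 = 4 *
      746496.\<close>
    have 2: False if "kinv_net N (-256) 64"
    proof -
      have "(- 331776 * a ^ 3 - 2985984 * b\<^sup>2) * 64 = -256 * (746496 * b\<^sup>2)" by (rule rel[OF that]) (use C V C' in simp)
      then have "21233664 * a ^ 3 = 0" by algebra
      then show False using a by simp
    qed
    have 3: False if "N \<in> {net_6b, net_6c, net_5a, net_5b, net_4, net_2a, net_2b}"
      using not_specialization_7b[OF that] C V C' by simp
    have "N = net_7b"
      using N 1 2 3 kinv_net_named(1-6)[where ?'a = 'k] by blast
    then show ?thesis using V C' by simp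
  qed
qed

lemma specializations_7b:
  assumes "B \<in> {orbit net_6b, orbit net_6c, orbit net_5a, orbit net_5b, orbit net_4, orbit net_2a, orbit net_2b}"
  shows "specialization (orbit (net_7b :: 'a::field_char_0 form set)) B"
  using assms spec_7b_6b spec_7b_6c spec_7b_5a spec_7b_5b spec_7b_4
    specialization_trans[OF spec_7b_4 spec_4_2a] specialization_trans[OF spec_7b_4 spec_4_2b] by blast

text \<open>A nonzero \<open>inv4\<close> separates \<open>N\<close> from the orbits on which both
  invariants vanish.\<close>

lemma null_specializations:
  fixes N :: "'a::field_char_0 form set"
  assumes "kinv_net N \<alpha> \<beta>" "\<alpha> \<noteq> 0" "specialization (orbit N) (orbit net_7b)"
  shows "{orbit net_7b, orbit net_6b, orbit net_6c, orbit net_5a, orbit net_5b, orbit net_4, orbit net_2a, orbit net_2b} \<subseteq>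
    {B \<in> orbits. B \<noteq> orbit N \<and> specialization (orbit N) B}"
proof
  fix B :: "'a form set set"
  assume B: "B \<in> {orbit net_7b, orbit net_6b, orbit net_6c, orbit net_5a, orbit net_5b, orbit net_4, orbit net_2a, orbit net_2b}"
  obtain M :: "'a form set" where M: "B = orbit M" "kinv_net M 0 0"
    using B kinv_net_named(7-14)[where ?'a = 'a] by blast
  have "B \<noteq> orbit N" using kinv_net_orbit[OF M(2) assms(1)] M(1) assms(2) by auto
  moreover have "specialization (orbit N) B"
    using B assms(3) specialization_trans[OF assms(3) specializations_7b] by blast
  moreover have "B \<in> orbits" unfolding orbits_def M(1) by (rule imageI[OF kinv_net_nets[OF M(2)]])
  ultimately show "B \<in> {B \<in> orbits. B \<noteq> orbit N \<and> specialization (orbit N) B}" by blast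
qed

lemma specializations_8a:
  "{B \<in> orbits. B \<noteq> orbit net_8a \<and> specialization (orbit (net_8a :: 'k::{alg_closed_field, field_char_0} form set)) B} =
    {orbit net_7a, orbit net_7b, orbit net_6a, orbit net_6b, orbit net_6c,
     orbit net_5a, orbit net_5b, orbit net_4, orbit net_2a, orbit net_2b}" (is "?L = ?R")
proof
  show "?L \<subseteq> ?R"
  proof
    fix B assume "B \<in> ?L"
    then obtain V where V: "V \<in> nets" "B = orbit V" and B: "B \<noteq> orbit net_8a" "specialization (orbit net_8a) B"
      unfolding orbits_def by blast
    note rel = kinv_net_specialization[OF kinv_net_named(1)]
    from orbit_cases[OF V(1)] show "B \<in> ?R"
    proof (elim disjE exE conjE bexE)
      fix a b assume d: "4 * a ^ 3 + 27 * b\<^sup>2 \<noteq> 0" and V': "orbit V = orbit (J (weierstrass a b))"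
      have "-1 * (746496 * b\<^sup>2) = (- 331776 * a ^ 3 - 2985984 * b\<^sup>2) * 1"
        by (rule rel[OF kinv_net_weierstrass]) (use V V' B in simp)
      then have "82944 * (4 * a ^ 3 + 27 * b\<^sup>2) = 0" by algebra
      then show ?thesis using d unfolding mult_eq_0_iff by simp
    next
      fix N :: "'k form set"
      assume N: "N \<in> {net_8a, net_7a, net_6a, net_8c, net_7c, net_6d, net_7b, net_6b, net_6c, net_5a, net_5b, net_4, net_2a, net_2b}"
        and V': "orbit V = orbit N"
      have 1: False if "kinv_net N (-256) 64"
      proof -
        have "-1 * 64 = (-256) * (1 :: 'k)" by (rule rel[OF that]) (use V V' B in simp)
        then show False by simp
      qed
      have "N \<noteq> net_8a" using B V V' by blast
      moreover have "N \<noteq> net_8c" "N \<noteq> net_7c" "N \<noteq> net_6d" using 1 kinv_net_named(4-6)[where ?'a = 'k] by blast+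
      ultimately have "N \<in> {net_7a, net_7b, net_6a, net_6b, net_6c, net_5a, net_5b, net_4, net_2a, net_2b}"
        using N by (simp only: insert_iff empty_iff simp_thms disj_ac)
      then have "orbit N \<in> orbit ` {net_7a, net_7b, net_6a, net_6b, net_6c, net_5a, net_5b, net_4, net_2a, net_2b}" by (rule imageI)
      then show ?thesis unfolding V(2) V' by simp
    qed
  qed
  have 7: "orbit net_7a \<noteq> orbit (net_8a :: 'k form set)"
    by (rule orbit_8a_base_points) (auto simp: net_7a_def in_span3 axis_def)
  have 6: "orbit net_6a \<noteq> orbit (net_8a :: 'k form set)"
    by (rule orbit_8a_base_points) (auto simp: net_6a_def in_span3 axis_def)
  have "orbit net_7a \<in> ?L" unfolding orbits_def using named_nets(3) 7 spec_8a_7a by blast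
  moreover have "orbit net_6a \<in> ?L" unfolding orbits_def using named_nets(6) 6 spec_8a_6a by blast
  moreover note null_specializations[OF kinv_net_named(1) _ spec_8a_7b]
  ultimately show "?R \<subseteq> ?L" unfolding insert_subset by simp
qed

lemma specializations_8c:
  "{B \<in> orbits. B \<noteq> orbit net_8c \<and> specialization (orbit (net_8c :: 'k::{alg_closed_field, field_char_0} form set)) B} =
    {orbit net_7b, orbit net_7c, orbit net_6b, orbit net_6c, orbit net_6d,
     orbit net_5a, orbit net_5b, orbit net_4, orbit net_2a, orbit net_2b}" (is "?L = ?R")
proof
  show "?L \<subseteq> ?R"
  proof
    fix B assume "B \<in> ?L"
    then obtain V where V: "V \<in> nets" "B = orbit V" and B: "B \<noteq> orbit net_8c" "specialization (orbit net_8c) B"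
      unfolding orbits_def by blast
    note rel = kinv_net_specialization[OF kinv_net_named(4)]
    from orbit_cases[OF V(1)] show "B \<in> ?R"
    proof (elim disjE exE conjE bexE)
      fix a b assume d: "4 * a ^ 3 + 27 * b\<^sup>2 \<noteq> 0" and V': "orbit V = orbit (J (weierstrass a b))"
      have "-256 * (746496 * b\<^sup>2) = (- 331776 * a ^ 3 - 2985984 * b\<^sup>2) * 64"
        by (rule rel[OF kinv_net_weierstrass]) (use V V' B in simp)
      then have "21233664 * a ^ 3 = 0" by algebra
      \<comment> \<open>Smooth cubics with j = 0 are not excluded by the pencil; they are isomorphic
        to the Fermat cubic, whose net is #6d and belongs to the list.\<close>
      then have a: "a = 0" by simp
      then have "b \<noteq> 0" using d by auto
      then obtain A where "invertible A" "lin_subst A (weierstrass 0 b) = fermat" by (rule weierstrass_fermat)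
      then have "orbit (J (weierstrass 0 b)) = orbit net_6d"
        using form_iso_orbit_J[OF form_isoI] J_fermat unfolding orbit_eq by metis
      then show ?thesis unfolding V(2) V' a by simp
    next
      fix N :: "'k form set"
      assume N: "N \<in> {net_8a, net_7a, net_6a, net_8c, net_7c, net_6d, net_7b, net_6b, net_6c, net_5a, net_5b, net_4, net_2a, net_2b}"
        and V': "orbit V = orbit N"
      have 1: False if "kinv_net N (-1) 1"
      proof -
        have "-256 * 1 = (-1) * (64 :: 'k)" by (rule rel[OF that]) (use V V' B in simp)
        then show False by simp
      qed
      have "N \<noteq> net_8c" using B V V' by blast
      moreover have "N \<noteq> net_8a" "N \<noteq> net_7a" "N \<noteq> net_6a" using 1 kinv_net_named(1-3)[where ?'a = 'k] by blast+
      ultimately have "N \<in> {net_7b, net_7c, net_6b, net_6c, net_6d, net_5a, net_5b, net_4, net_2a, net_2b}"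
        using N by (simp only: insert_iff empty_iff simp_thms disj_ac)
      then have "orbit N \<in> orbit ` {net_7b, net_7c, net_6b, net_6c, net_6d, net_5a, net_5b, net_4, net_2a, net_2b}" by (rule imageI)
      then show ?thesis unfolding V(2) V' by simp
    qed
  qed
  have 7: "orbit net_7c \<noteq> orbit (net_8c :: 'k form set)" and 6: "orbit net_6d \<noteq> orbit (net_8c :: 'k form set)"
    unfolding named_nets_qf(5,9) by (rule orbit_8c_squares; rule in_span3_generators)+
  have "orbit net_7c \<in> ?L" unfolding orbits_def using named_nets(5) 7 spec_8c_7c by blast
  moreover have "orbit net_6d \<in> ?L" unfolding orbits_def using named_nets(9) 6 spec_8c_6d by blast
  moreover note null_specializations[OF kinv_net_named(4) _ spec_8c_7b]
  ultimately show "?R \<subseteq> ?L" unfolding insert_subset by simp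
qed

theorem theorem1:
  shows
    "(\<forall>V :: 'k::{alg_closed_field, field_char_0} form set.
        V \<in> nets \<and> discriminant_cubic smooth_cubic V \<longrightarrow> (\<exists>\<phi>. smooth_cubic \<phi> \<and> V = J \<phi>)) \<and>
     (\<forall>\<phi> \<psi> :: 'k form. smooth_cubic \<phi> \<and> smooth_cubic \<psi> \<and> j_invariant \<phi> = j_invariant \<psi> \<longrightarrow>
        orbit (J \<phi>) = orbit (J \<psi>)) \<and>

     (\<forall>\<phi> :: 'k form. smooth_cubic \<phi> \<and> \<not> form_iso \<phi> fermat \<longrightarrow>
        elementary_specialization (orbit (J \<phi>)) (orbit net_7b)) \<and>
     discriminant_cubic cuspidal_cubic (net_7b :: 'k form set) \<and>

     (\<forall>B \<in> {orbit net_6b, orbit net_6c, orbit net_5a, orbit net_5b, orbit net_4,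
             orbit net_2a, orbit net_2b}.
        specialization (orbit (net_7b :: 'k form set)) B \<and>
        (\<forall>\<phi>. smooth_cubic \<phi> \<and> \<not> form_iso \<phi> fermat \<longrightarrow> specialization (orbit (J \<phi>)) B)) \<and>

     discriminant_cubic nodal_cubic (net_8a :: 'k form set) \<and>
     discriminant_cubic nodal_cubic (net_8c :: 'k form set) \<and>
     {B \<in> orbits. B \<noteq> orbit net_8a \<and> specialization (orbit (net_8a :: 'k form set)) B} =
       {orbit net_7a, orbit net_7b, orbit net_6a, orbit net_6b, orbit net_6c,
        orbit net_5a, orbit net_5b, orbit net_4, orbit net_2a, orbit net_2b} \<and>
     {B \<in> orbits. B \<noteq> orbit net_8c \<and> specialization (orbit (net_8c :: 'k form set)) B} =
       {orbit net_7b, orbit net_7c, orbit net_6b, orbit net_6c, orbit net_6d,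
        orbit net_5a, orbit net_5b, orbit net_4, orbit net_2a, orbit net_2b}"
proof (intro conjI allI impI ballI)
  fix V :: "'k form set"
  assume "V \<in> nets \<and> discriminant_cubic smooth_cubic V"
  then show "\<exists>\<phi>. smooth_cubic \<phi> \<and> V = J \<phi>" using smooth_discriminant_imp_J by blast
next
  fix \<phi> \<psi> :: "'k form"
  assume "smooth_cubic \<phi> \<and> smooth_cubic \<psi> \<and> j_invariant \<phi> = j_invariant \<psi>"
  then show "orbit (J \<phi>) = orbit (J \<psi>)" using j_invariant_determines_orbit by blast
next
  fix \<phi> :: "'k form"
  assume \<phi>: "smooth_cubic \<phi> \<and> \<not> form_iso \<phi> fermat"
  obtain a b where "a \<noteq> 0" "4 * a ^ 3 + 27 * b\<^sup>2 \<noteq> 0" "orbit (J \<phi>) = orbit (J (weierstrass a b))"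
    by (rule J_smooth_weierstrass[OF conjunct1[OF \<phi>] conjunct2[OF \<phi>]])
  then show "elementary_specialization (orbit (J \<phi>)) (orbit net_7b)" using elementary_specialization_7b by simp
next
  fix B :: "'k form set set"
  assume B: "B \<in> {orbit net_6b, orbit net_6c, orbit net_5a, orbit net_5b, orbit net_4, orbit net_2a, orbit net_2b}"
  show 1: "specialization (orbit net_7b) B" by (rule specializations_7b[OF B])
  fix \<phi> :: "'k form"
  assume \<phi>: "smooth_cubic \<phi> \<and> \<not> form_iso \<phi> fermat"
  obtain a b where ab: "a \<noteq> 0" "orbit (J \<phi>) = orbit (J (weierstrass a b))"
    by (rule J_smooth_weierstrass[OF conjunct1[OF \<phi>] conjunct2[OF \<phi>]])
  show "specialization (orbit (J \<phi>)) B"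
    unfolding ab(2) by (rule specialization_trans[OF J_weierstrass_spec_7b[OF ab(1)] specializations_7b[OF B]])
qed (rule discriminant_7b discriminant_8a discriminant_8c specializations_8a specializations_8c)+

end
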